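(* Let $A$ be a $\Delta$-separable Frobenius algebra in an additive symmetric strict monoidal category whose Nakayama automorphism $N$ is an involution, and suppose the idempotents $P^{NS}=q_{+1}$ and $P^R=q_{-1}$ of $A$ are split, with images $Z_+=Z^{NS}$ and $Z_-=Z^R$. Let $Z=Z_+\oplus Z_-$, with $\mu_Z,\eta_Z,\Delta_Z,\varepsilon_Z,N^Z$ as in the context. Then: (1) $(\mu_Z,\eta_Z,\Delta_Z,\varepsilon_Z)$ define the structure of a $\mathbb Z_2$-graded Frobenius algebra on $Z$ with graded components $Z_+$ and $Z_-$ (with $\mathbb Z_2=\{\pm1\}$ written multiplicatively). (2) $N^Z$ is the Nakayama automorphism of $Z$. It satisfies $(N^Z)^2=\mathrm{id}_Z$ and $N^Z\circ\iota^Z_+=\iota^Z_+$. (3) The product of $Z$ is graded commutative in the sense that for $\alpha,\beta\in\{\pm1\}$, $$\mu_Z\circ\sigma_{Z,Z}\circ(\iota^Z_\alpha\otimes\iota^Z_\beta)=\mu_Z\circ(N^Z_\gamma\otimes\mathrm{id}_Z)\circ(\iota^Z_\alpha\otimes\iota^Z_\beta)=\mu_Z\circ(\mathrm{id}_Z\otimes N^Z_\gamma)\circ(\iota^Z_\alpha\otimes\iota^Z_\beta),$$ where $\gamma=-1$ if $\alpha=\beta=-1$ and $\gamma=1$ otherwise, and $N^Z_{+1}=\mathrm{id}_Z$, $N^Z_{-1}=N^Z$.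
   Context: The category has tensor unit $\mathbf 1$ and symmetric braiding $\sigma_{U,V}$, and $\otimes$ is biadditive. A Frobenius algebra is an object $A$ with a unital associative algebra structure $(\mu,\eta)$ and a counital coassociative coalgebra structure $(\Delta,\varepsilon)$ such that $(\mathrm{id}\otimes\mu)(\Delta\otimes\mathrm{id})=\Delta\mu=(\mu\otimes\mathrm{id})(\mathrm{id}\otimes\Delta)$. Put $b=\varepsilon\circ\mu$. The Nakayama automorphism is $N=(b\otimes\mathrm{id}_A)\circ(\mathrm{id}_A\otimes\sigma_{A,A})\circ(\mathrm{id}_A\otimes(\Delta\circ\eta))$. $A$ is $\Delta$-separable if $\mu\circ\Delta\circ\eta=\eta$ (equivalently $\mu\circ\Delta=\mathrm{id}_A$). $N_{+1}=\mathrm{id}_A$, $N_{-1}=N$. For $\nu\in\{\pm1\}$ let $q_\nu=\mu\circ\sigma_{A,A}\circ(N_{-\nu}\otimes\mathrm{id}_A)\circ\Delta$; this is an idempotent. Choose a splitting $\iota^A_\nu:Z_\nu\to A$, $\pi^A_\nu:A\to Z_\nu$ with $\iota^A_\nu\pi^A_\nu=q_\nu$, $\pi^A_\nu\iota^A_\nu=\mathrm{id}$. Let $\iota^Z_\nu:Z_\nu\to Z$, $\pi^Z_\nu:Z\to Z_\nu$ be the embeddings and projections of the direct sum, and $e_\nu=\iota^A_\nu\circ\pi^Z_\nu:Z\to A$, $f_\nu=\iota^Z_\nu\circ\pi^A_\nu:A\to Z$. Define $$\mu_Z=\sum_{\alpha,\beta=\pm1}f_{\alpha\beta}\circ\mu\circ(e_\alpha\otimes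 e_\beta),\quad \eta_Z=f_+\circ\eta,\quad \Delta_Z=\sum_{\alpha,\beta=\pm1}(f_\alpha\otimes f_\beta)\circ\Delta\circ e_{\alpha\beta},\quad \varepsilon_Z=\varepsilon\circ e_+,$$ $$N^Z=\sum_{\nu=\pm1}f_\nu\circ N\circ e_\nu .$$ A $\mathbb Z_2$-graded Frobenius algebra is a Frobenius algebra whose structure morphisms respect the grading: $\mu_Z$ maps $Z_\alpha\otimes Z_\beta$ to $Z_{\alpha\beta}$, $\eta_Z$ factors through $Z_+$, $\Delta_Z$ maps $Z_\gamma$ to $\bigoplus_{\alpha\beta=\gamma}Z_\alpha\otimes Z_\beta$, and $\varepsilon_Z$ vanishes on $Z_-$. *)

theory Defs
  imports "HOL-Algebra.Group"
begin

section \<open>Additive symmetric strict monoidal categories\<close>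

text \<open>The composite \<open>g \<bullet> f\<close> is first \<open>f\<close>, then \<open>g\<close>. The operations are total functions whose values are constrained on objects and (composable or
  parallel) morphisms only. Tensor products of objects and of morphisms are written
  \<open>\<odot>\<close> and \<open>\<boxtimes>\<close>.\<close>

record ('o, 'm) cat_data =
  Obj :: "'o set"
  Hom :: "'o \<Rightarrow> 'o \<Rightarrow> 'm set"
  Id :: "'o \<Rightarrow> 'm"
  Comp :: "'m \<Rightarrow> 'm \<Rightarrow> 'm" (infixr "\<bullet>\<index>" 60)
  TUnit :: "'o"
  TObj :: "'o \<Rightarrow> 'o \<Rightarrow> 'o" (infixr "\<odot>\<index>" 70)
  TMor :: "'m \<Rightarrow> 'm \<Rightarrow> 'm" (infixr "\<boxtimes>\<index>" 70)
  Braid :: "'o \<Rightarrow> 'o \<Rightarrow> 'm"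
  ZeroMor :: "'o \<Rightarrow> 'o \<Rightarrow> 'm"
  AddMor :: "'m \<Rightarrow> 'm \<Rightarrow> 'm" (infixl "\<boxplus>\<index>" 55)

locale category =
  fixes C :: "('o, 'm) cat_data" (structure)
  assumes hom_obj: "f \<in> Hom C X Y \<Longrightarrow> X \<in> Obj C \<and> Y \<in> Obj C"
    and hom_disjoint: "f \<in> Hom C X Y \<Longrightarrow> f \<in> Hom C X' Y' \<Longrightarrow> X = X' \<and> Y = Y'"
    and id_hom: "X \<in> Obj C \<Longrightarrow> Id C X \<in> Hom C X X"
    and comp_hom: "f \<in> Hom C X Y \<Longrightarrow> g \<in> Hom C Y W \<Longrightarrow> g \<bullet> f \<in> Hom C X W"
    and comp_assoc: "f \<in> Hom C X Y \<Longrightarrow> g \<in> Hom C Y W \<Longrightarrow> h \<in> Hom C W V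
      \<Longrightarrow> (h \<bullet> g) \<bullet> f = h \<bullet> (g \<bullet> f)"
    and comp_id_left: "f \<in> Hom C X Y \<Longrightarrow> Id C Y \<bullet> f = f"
    and comp_id_right: "f \<in> Hom C X Y \<Longrightarrow> f \<bullet> Id C X = f"

locale strict_monoidal_category = category +
  assumes tunit_obj: "TUnit C \<in> Obj C"
    and tensor_obj: "X \<in> Obj C \<Longrightarrow> Y \<in> Obj C \<Longrightarrow> X \<odot> Y \<in> Obj C"
    and tensor_hom: "f \<in> Hom C X Y \<Longrightarrow> g \<in> Hom C X' Y' \<Longrightarrow> f \<boxtimes> g \<in> Hom C (X \<odot> X') (Y \<odot> Y')"
    and tensor_id: "X \<in> Obj C \<Longrightarrow> Y \<in> Obj C \<Longrightarrow> Id C X \<boxtimes> Id C Y = Id C (X \<odot> Y)"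
    and interchange: "f \<in> Hom C X Y \<Longrightarrow> g \<in> Hom C Y W \<Longrightarrow> f' \<in> Hom C X' Y' \<Longrightarrow> g' \<in> Hom C Y' W'
      \<Longrightarrow> (g \<bullet> f) \<boxtimes> (g' \<bullet> f') = (g \<boxtimes> g') \<bullet> (f \<boxtimes> f')"
    and tensor_obj_assoc: "X \<in> Obj C \<Longrightarrow> Y \<in> Obj C \<Longrightarrow> W \<in> Obj C \<Longrightarrow> (X \<odot> Y) \<odot> W = X \<odot> (Y \<odot> W)"
    and tensor_obj_unit: "X \<in> Obj C \<Longrightarrow> TUnit C \<odot> X = X \<and> X \<odot> TUnit C = X"
    and tensor_assoc: "f \<in> Hom C X Y \<Longrightarrow> g \<in> Hom C X' Y' \<Longrightarrow> h \<in> Hom C X'' Y''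
      \<Longrightarrow> (f \<boxtimes> g) \<boxtimes> h = f \<boxtimes> (g \<boxtimes> h)"
    and tensor_unit: "f \<in> Hom C X Y
      \<Longrightarrow> Id C (TUnit C) \<boxtimes> f = f \<and> f \<boxtimes> Id C (TUnit C) = f"

text \<open>The second hexagon identity follows from the first one and symmetry.\<close>

locale symmetric_strict_monoidal_category = strict_monoidal_category +
  assumes braid_hom: "X \<in> Obj C \<Longrightarrow> Y \<in> Obj C \<Longrightarrow> Braid C X Y \<in> Hom C (X \<odot> Y) (Y \<odot> X)"
    and braid_natural: "f \<in> Hom C X X' \<Longrightarrow> g \<in> Hom C Y Y'
      \<Longrightarrow> Braid C X' Y' \<bullet> (f \<boxtimes> g) = (g \<boxtimes> f) \<bullet> Braid C X Y"
    and braid_hexagon: "X \<in> Obj C \<Longrightarrow> Y \<in> Obj C \<Longrightarrow> W \<in> Obj C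
      \<Longrightarrow> Braid C X (Y \<odot> W) = (Id C Y \<boxtimes> Braid C X W) \<bullet> (Braid C X Y \<boxtimes> Id C W)"
    and braid_symmetric: "X \<in> Obj C \<Longrightarrow> Y \<in> Obj C
      \<Longrightarrow> Braid C Y X \<bullet> Braid C X Y = Id C (X \<odot> Y)"

definition hom_group :: "('o, 'm) cat_data \<Rightarrow> 'o \<Rightarrow> 'o \<Rightarrow> 'm monoid" where
  "hom_group C X Y = \<lparr>carrier = Hom C X Y, monoid.mult = AddMor C, one = ZeroMor C X Y\<rparr>"

locale preadditive_category = category +
  assumes hom_comm_group: "X \<in> Obj C \<Longrightarrow> Y \<in> Obj C \<Longrightarrow> comm_group (hom_group C X Y)"
    and comp_add_left: "f \<in> Hom C X Y \<Longrightarrow> g \<in> Hom C Y W \<Longrightarrow> g' \<in> Hom C Y W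
      \<Longrightarrow> (g \<boxplus> g') \<bullet> f = (g \<bullet> f) \<boxplus> (g' \<bullet> f)"
    and comp_add_right: "f \<in> Hom C X Y \<Longrightarrow> f' \<in> Hom C X Y \<Longrightarrow> g \<in> Hom C Y W
      \<Longrightarrow> g \<bullet> (f \<boxplus> f') = (g \<bullet> f) \<boxplus> (g \<bullet> f')"

definition zero_object :: "('o, 'm) cat_data \<Rightarrow> 'o \<Rightarrow> bool" where
  "zero_object C N \<longleftrightarrow> N \<in> Obj C \<and>
     (\<forall>X\<in>Obj C. (\<exists>!f. f \<in> Hom C X N) \<and> (\<exists>!f. f \<in> Hom C N X))"

definition direct_sum ::
  "('o, 'm) cat_data \<Rightarrow> 'o \<Rightarrow> 'o \<Rightarrow> 'o \<Rightarrow> 'm \<Rightarrow> 'm \<Rightarrow> 'm \<Rightarrow> 'm \<Rightarrow> bool" where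
  "direct_sum C S X Y i\<^sub>X i\<^sub>Y p\<^sub>X p\<^sub>Y \<longleftrightarrow>
     X \<in> Obj C \<and> Y \<in> Obj C \<and> S \<in> Obj C \<and>
     i\<^sub>X \<in> Hom C X S \<and> i\<^sub>Y \<in> Hom C Y S \<and> p\<^sub>X \<in> Hom C S X \<and> p\<^sub>Y \<in> Hom C S Y \<and>
     p\<^sub>X \<bullet>\<^bsub>C\<^esub> i\<^sub>X = Id C X \<and> p\<^sub>Y \<bullet>\<^bsub>C\<^esub> i\<^sub>Y = Id C Y \<and>
     p\<^sub>Y \<bullet>\<^bsub>C\<^esub> i\<^sub>X = ZeroMor C X Y \<and> p\<^sub>X \<bullet>\<^bsub>C\<^esub> i\<^sub>Y = ZeroMor C Y X \<and>
     (i\<^sub>X \<bullet>\<^bsub>C\<^esub> p\<^sub>X) \<boxplus>\<^bsub>C\<^esub> (i\<^sub>Y \<bullet>\<^bsub>C\<^esub> p\<^sub>Y) = Id C S"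

locale additive_category = preadditive_category +
  assumes ex_zero_object: "\<exists>N. zero_object C N"
    and ex_direct_sum: "X \<in> Obj C \<Longrightarrow> Y \<in> Obj C
      \<Longrightarrow> \<exists>S i\<^sub>X i\<^sub>Y p\<^sub>X p\<^sub>Y. direct_sum C S X Y i\<^sub>X i\<^sub>Y p\<^sub>X p\<^sub>Y"

locale additive_symmetric_strict_monoidal_category =
  symmetric_strict_monoidal_category + additive_category +
  assumes tensor_add_left: "f \<in> Hom C X Y \<Longrightarrow> f' \<in> Hom C X Y \<Longrightarrow> g \<in> Hom C X' Y'
      \<Longrightarrow> (f \<boxplus> f') \<boxtimes> g = (f \<boxtimes> g) \<boxplus> (f' \<boxtimes> g)"
    and tensor_add_right: "f \<in> Hom C X Y \<Longrightarrow> g \<in> Hom C X' Y' \<Longrightarrow> g' \<in> Hom C X' Y'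
      \<Longrightarrow> f \<boxtimes> (g \<boxplus> g') = (f \<boxtimes> g) \<boxplus> (f \<boxtimes> g')"

section \<open>Frobenius algebras\<close>

record ('o, 'm) frobenius_data =
  Car :: "'o"
  Mul :: "'m"
  Unit :: "'m"
  Comul :: "'m"
  Counit :: "'m"

context
  fixes C :: "('o, 'm) cat_data" (structure)
begin

definition algebra :: "'o \<Rightarrow> 'm \<Rightarrow> 'm \<Rightarrow> bool" where
  "algebra A \<mu> \<eta> \<longleftrightarrow>
     A \<in> Obj C \<and> \<mu> \<in> Hom C (A \<odot> A) A \<and> \<eta> \<in> Hom C (TUnit C) A \<and>
     \<mu> \<bullet> (\<mu> \<boxtimes> Id C A) = \<mu> \<bullet> (Id C A \<boxtimes> \<mu>) \<and>
     \<mu> \<bullet> (\<eta> \<boxtimes> Id C A) = Id C A \<and> \<mu> \<bullet> (Id C A \<boxtimes> \<eta>) = Id C A"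

definition coalgebra :: "'o \<Rightarrow> 'm \<Rightarrow> 'm \<Rightarrow> bool" where
  "coalgebra A \<Delta> \<epsilon> \<longleftrightarrow>
     A \<in> Obj C \<and> \<Delta> \<in> Hom C A (A \<odot> A) \<and> \<epsilon> \<in> Hom C A (TUnit C) \<and>
     (\<Delta> \<boxtimes> Id C A) \<bullet> \<Delta> = (Id C A \<boxtimes> \<Delta>) \<bullet> \<Delta> \<and>
     (\<epsilon> \<boxtimes> Id C A) \<bullet> \<Delta> = Id C A \<and> (Id C A \<boxtimes> \<epsilon>) \<bullet> \<Delta> = Id C A"

definition frobenius_algebra :: "('o, 'm) frobenius_data \<Rightarrow> bool" where
  "frobenius_algebra F \<longleftrightarrow>
     algebra (Car F) (Mul F) (Unit F) \<and> coalgebra (Car F) (Comul F) (Counit F) \<and>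
     (Id C (Car F) \<boxtimes> Mul F) \<bullet> (Comul F \<boxtimes> Id C (Car F)) = Comul F \<bullet> Mul F \<and>
     (Mul F \<boxtimes> Id C (Car F)) \<bullet> (Id C (Car F) \<boxtimes> Comul F) = Comul F \<bullet> Mul F"

definition delta_separable :: "('o, 'm) frobenius_data \<Rightarrow> bool" where
  "delta_separable F \<longleftrightarrow> Mul F \<bullet> Comul F \<bullet> Unit F = Unit F"

definition frobenius_pairing :: "('o, 'm) frobenius_data \<Rightarrow> 'm" where
  "frobenius_pairing F = Counit F \<bullet> Mul F"

definition nakayama :: "('o, 'm) frobenius_data \<Rightarrow> 'm" where
  "nakayama F = (frobenius_pairing F \<boxtimes> Id C (Car F)) \<bullet>
     (Id C (Car F) \<boxtimes> Braid C (Car F) (Car F)) \<bullet>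
     (Id C (Car F) \<boxtimes> (Comul F \<bullet> Unit F))"

section \<open>The graded algebra on the images of the idempotents\<close>

text \<open>The group \<open>\<int>\<^sub>2 = {\<plusminus>1}\<close> is represented by the integers \<open>1\<close> and \<open>-1\<close>; families
  indexed by \<open>\<int>\<^sub>2\<close> are functions on \<^typ>\<open>int\<close> whose other values are irrelevant.\<close>

definition sum_pm :: "(int \<Rightarrow> 'm) \<Rightarrow> 'm" where
  "sum_pm h = h 1 \<boxplus> h (-1)"

text \<open>\<open>N\<^sub>\<nu>\<close> for an endomorphism \<open>N\<close> of \<open>X\<close>: \<open>N\<^sub>+\<^sub>1 = id\<close> and \<open>N\<^sub>-\<^sub>1 = N\<close>.\<close>

definition signed :: "'o \<Rightarrow> 'm \<Rightarrow> int \<Rightarrow> 'm" where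
  "signed X N \<nu> = (if \<nu> = -1 then N else Id C X)"

definition q_idem :: "('o, 'm) frobenius_data \<Rightarrow> int \<Rightarrow> 'm" where
  "q_idem F \<nu> = Mul F \<bullet> Braid C (Car F) (Car F) \<bullet>
     (signed (Car F) (nakayama F) (-\<nu>) \<boxtimes> Id C (Car F)) \<bullet> Comul F"

definition splitting :: "'o \<Rightarrow> 'm \<Rightarrow> 'o \<Rightarrow> 'm \<Rightarrow> 'm \<Rightarrow> bool" where
  "splitting X p Y i r \<longleftrightarrow>
     i \<in> Hom C Y X \<and> r \<in> Hom C X Y \<and> i \<bullet> r = p \<and> r \<bullet> i = Id C Y"

definition graded_sum :: "'o \<Rightarrow> (int \<Rightarrow> 'o) \<Rightarrow> (int \<Rightarrow> 'm) \<Rightarrow> (int \<Rightarrow> 'm) \<Rightarrow> bool" where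
  "graded_sum Z Zc \<iota> \<pi> \<longleftrightarrow>
     direct_sum C Z (Zc 1) (Zc (-1)) (\<iota> 1) (\<iota> (-1)) (\<pi> 1) (\<pi> (-1))"

text \<open>For \<open>\<alpha>, \<gamma> \<in> {\<plusminus>1}\<close> the only \<open>\<beta>\<close> with \<open>\<alpha> * \<beta> = \<gamma>\<close> is \<open>\<alpha> * \<gamma>\<close>. A morphism to the direct
  sum of the \<open>Zc \<alpha> \<odot> Zc (\<alpha> * \<gamma>)\<close> is given by its two components \<open>d \<alpha>\<close>, and the embedding of
  this direct sum into \<open>Z \<odot> Z\<close> sends them to the sum of the \<open>(\<iota> \<alpha> \<boxtimes> \<iota> (\<alpha> * \<gamma>)) \<bullet> d \<alpha>\<close>.\<close>

definition Z2_graded_frobenius_algebra ::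
  "('o, 'm) frobenius_data \<Rightarrow> (int \<Rightarrow> 'o) \<Rightarrow> (int \<Rightarrow> 'm) \<Rightarrow> (int \<Rightarrow> 'm) \<Rightarrow> bool" where
  "Z2_graded_frobenius_algebra F Zc \<iota> \<pi> \<longleftrightarrow>
     frobenius_algebra F \<and> graded_sum (Car F) Zc \<iota> \<pi> \<and>
     (\<forall>\<alpha>\<in>{1, -1}. \<forall>\<beta>\<in>{1, -1}. \<exists>m\<in>Hom C (Zc \<alpha> \<odot> Zc \<beta>) (Zc (\<alpha> * \<beta>)).
        Mul F \<bullet> (\<iota> \<alpha> \<boxtimes> \<iota> \<beta>) = \<iota> (\<alpha> * \<beta>) \<bullet> m) \<and>
     (\<exists>u\<in>Hom C (TUnit C) (Zc 1). Unit F = \<iota> 1 \<bullet> u) \<and>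
     (\<forall>\<gamma>\<in>{1, -1}. \<exists>d. (\<forall>\<alpha>\<in>{1, -1}. d \<alpha> \<in> Hom C (Zc \<gamma>) (Zc \<alpha> \<odot> Zc (\<alpha> * \<gamma>))) \<and>
        Comul F \<bullet> \<iota> \<gamma> = sum_pm (\<lambda>\<alpha>. (\<iota> \<alpha> \<boxtimes> \<iota> (\<alpha> * \<gamma>)) \<bullet> d \<alpha>)) \<and>
     Counit F \<bullet> \<iota> (-1) = ZeroMor C (Zc (-1)) (TUnit C)"

definition graded_frobenius_data ::
  "('o, 'm) frobenius_data \<Rightarrow> 'o \<Rightarrow> (int \<Rightarrow> 'm) \<Rightarrow> (int \<Rightarrow> 'm) \<Rightarrow> ('o, 'm) frobenius_data" where
  "graded_frobenius_data F Z e f =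
     \<lparr>Car = Z,
      Mul = sum_pm (\<lambda>\<alpha>. sum_pm (\<lambda>\<beta>. f (\<alpha> * \<beta>) \<bullet> Mul F \<bullet> (e \<alpha> \<boxtimes> e \<beta>))),
      Unit = f 1 \<bullet> Unit F,
      Comul = sum_pm (\<lambda>\<alpha>. sum_pm (\<lambda>\<beta>. (f \<alpha> \<boxtimes> f \<beta>) \<bullet> Comul F \<bullet> e (\<alpha> * \<beta>))),
      Counit = Counit F \<bullet> e 1\<rparr>"

definition graded_nakayama ::
  "('o, 'm) frobenius_data \<Rightarrow> (int \<Rightarrow> 'm) \<Rightarrow> (int \<Rightarrow> 'm) \<Rightarrow> 'm" where
  "graded_nakayama F e f = sum_pm (\<lambda>\<nu>. f \<nu> \<bullet> nakayama F \<bullet> e \<nu>)"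

end

end

theory Submission
  imports Defs
begin

text \<open>Write \<open>c = \<Delta> \<eta> = c\<^sub>1 \<otimes> c\<^sub>2\<close> and \<open>b = \<epsilon> \<mu>\<close>. The Nakayama automorphism is determined by
  \<open>b(y, N x) = b(x, y)\<close>; it is multiplicative, and when \<open>N\<^sup>2 = id\<close> one gets \<open>c\<^sub>2 \<otimes> c\<^sub>1 = N c\<^sub>1 \<otimes> c\<^sub>2\<close>.
  The image of \<open>q\<^sub>\<nu>\<close> is the \<open>\<nu>\<close>-twisted centre: its elements \<open>z\<close> satisfy \<open>y z = z N\<^sub>\<nu>(y)\<close>. From this one
  computes \<open>q\<^sub>\<alpha>\<^sub>\<beta>(x q\<^sub>\<beta>(z)) = q\<^sub>\<alpha>(x) q\<^sub>\<beta>(z)\<close> and its mirror image, and \<open>q\<^sub>\<nu>\<close> is self-adjoint for \<open>b\<close>, so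
  that the dual statement \<open>(q\<^sub>\<alpha> \<otimes> q\<^sub>\<beta>) \<Delta> q\<^sub>\<alpha>\<^sub>\<beta> = (q\<^sub>\<alpha> \<otimes> q\<^sub>\<beta>) \<Delta>\<close> holds as well. Hence all axioms of a
  Frobenius algebra pass from \<open>A\<close> to the homogeneous components of the operations on \<open>Z\<close>. Graded
  commutativity is the twisted centrality, and it yields \<open>b\<^sub>Z(y, N\<^sup>Z x) = b\<^sub>Z(x, y)\<close>, which identifies
  the Nakayama automorphism of \<open>Z\<close>.\<close>

section \<open>Morphisms between tensor powers of an object\<close>

text \<open>The snake identities for b and c make b nondegenerate, so an equation can be checked
  after one strand has been bent; most facts about N and q_\<nu> come from this. Multiplicativity of
  N is a rotation argument: b(yz, x) is b(x, N(yz)) by one flip and b(x N(y), N(z)) by two cyclic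
  rotations. The involution makes \<nu> \<mapsto> N_\<nu> a homomorphism on the signs; moving a
  homogeneous factor through a product composes such twists, and this is why degrees multiply.
  Separability says c_1 c_2 = 1, hence q_1(1) = 1; with absorption this gives idempotence of
  q_\<nu>, and with self-adjointness \<epsilon> q_1 = \<epsilon>. One obstacle appears at the end:
  in mixed degrees graded commutativity carries no twist, whereas the Nakayama automorphism of Z
  acts on Z_- by N, which may differ from the identity. There both sides of the characterising
  equation vanish, because \<epsilon>_Z kills products of degree -1.\<close>

context strict_monoidal_category
begin

primrec tpow :: "'a \<Rightarrow> nat \<Rightarrow> 'a" where
  "tpow A 0 = TUnit C"
| "tpow A (Suc n) = A \<odot> tpow A n"

lemma tpow_obj [simp]: "A \<in> Obj C \<Longrightarrow> tpow A n \<in> Obj C"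
  by (induction n) (auto simp: tunit_obj tensor_obj)

lemma tpow_add: "A \<in> Obj C \<Longrightarrow> tpow A (m + n) = tpow A m \<odot> tpow A n"
  by (induction m) (auto simp: tensor_obj_unit tensor_obj_assoc)

end

locale tensor_powers = symmetric_strict_monoidal_category C
  for C :: "('o, 'm) cat_data" (structure) +
  fixes A :: 'o
  assumes A_obj [simp]: "A \<in> Obj C"
begin

abbreviation pw :: "nat \<Rightarrow> 'o" where "pw \<equiv> tpow A"
abbreviation I :: "nat \<Rightarrow> 'm" where "I n \<equiv> Id C (pw n)"

lemma I_hom: "I n \<in> Hom C (pw n) (pw n)"
  by (simp add: id_hom)

lemma I_add: "I m \<boxtimes> I n = I (m + n)"
  by (simp add: tensor_id tpow_add)

lemma pow_hom: "f \<in> Hom C (pw i) (pw j) \<Longrightarrow> g \<in> Hom C (pw k) (pw l)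
    \<Longrightarrow> f \<boxtimes> g \<in> Hom C (pw (i + k)) (pw (j + l))"
  by (simp add: tensor_hom tpow_add)

text \<open>A pair \<open>(n, f)\<close> stands for a morphism \<open>f\<close> to the \<open>n\<close>-th tensor power of \<open>A\<close>, and
  \<open>app i j g m\<close> composes it with \<open>g : A\<^sup>i \<rightarrow> A\<^sup>j\<close> on the factors \<open>m, \<dots>, m + i - 1\<close>. Equations
  between string diagrams thus become equations between iterated applications, read from the inside
  out, in which every subdiagram is a subterm. The number \<open>n\<close> is stored because the powers of
  \<open>A\<close> need not be distinct objects.\<close>

definition ok :: "nat \<times> 'm \<Rightarrow> bool" where
  "ok s \<longleftrightarrow> (\<exists>X. snd s \<in> Hom C X (pw (fst s)))"

definition app :: "nat \<Rightarrow> nat \<Rightarrow> 'm \<Rightarrow> nat \<Rightarrow> nat \<times> 'm \<Rightarrow> nat \<times> 'm" where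
  "app i j g m s = (fst s - i + j, (I m \<boxtimes> g \<boxtimes> I (fst s - i - m)) \<bullet> snd s)"

lemma fst_app [simp]: "fst (app i j g m s) = fst s - i + j"
  by (simp add: app_def)

lemma layer_hom:
  assumes "g \<in> Hom C (pw i) (pw j)"
  shows "I m \<boxtimes> g \<boxtimes> I k \<in> Hom C (pw (m + i + k)) (pw (m + j + k))"
  using pow_hom[OF I_hom pow_hom[OF assms I_hom]] by (simp add: add.assoc)

lemma ok_app [simp]:
  assumes "g \<in> Hom C (pw i) (pw j)" "ok s" "m + i \<le> fst s"
  shows "ok (app i j g m s)"
proof -
  obtain k where k: "fst s = m + i + k"
    using assms(3) le_Suc_ex by blast
  then show ?thesis
    using assms layer_hom[OF assms(1), of m k] comp_hom unfolding ok_def app_def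
    by (fastforce simp: add.commute add.left_commute)
qed

lemma layer_comp:
  assumes "g \<in> Hom C (pw i) (pw j)" "h \<in> Hom C (pw l) (pw i)"
  shows "(I m \<boxtimes> g \<boxtimes> I k) \<bullet> (I m \<boxtimes> h \<boxtimes> I k) = I m \<boxtimes> (g \<bullet> h) \<boxtimes> I k"
proof -
  have "(g \<bullet> h) \<boxtimes> I k = (g \<boxtimes> I k) \<bullet> (h \<boxtimes> I k)"
    using interchange[OF assms(2,1) I_hom I_hom, of k] comp_id_left[OF I_hom, of k] by simp
  moreover have "I m \<boxtimes> ((g \<boxtimes> I k) \<bullet> (h \<boxtimes> I k)) = (I m \<boxtimes> g \<boxtimes> I k) \<bullet> (I m \<boxtimes> h \<boxtimes> I k)"
    using interchange[OF I_hom I_hom pow_hom[OF assms(2) I_hom] pow_hom[OF assms(1) I_hom], of m k]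
      comp_id_left[OF I_hom, of m] by simp
  ultimately show ?thesis by simp
qed

lemma app_comp:
  assumes "g \<in> Hom C (pw i) (pw j)" "h \<in> Hom C (pw l) (pw i)" "ok s" "m + l \<le> fst s"
  shows "app i j g m (app l i h m s) = app l j (g \<bullet> h) m s"
proof -
  obtain k where k: "fst s = m + l + k"
    using assms(4) le_Suc_ex by blast
  obtain X where X: "snd s \<in> Hom C X (pw (m + l + k))"
    using assms(3) k unfolding ok_def by auto
  have "(I m \<boxtimes> g \<boxtimes> I k) \<bullet> (I m \<boxtimes> h \<boxtimes> I k) \<bullet> snd s = (I m \<boxtimes> (g \<bullet> h) \<boxtimes> I k) \<bullet> snd s"
    using comp_assoc[OF X layer_hom[OF assms(2)] layer_hom[OF assms(1)]] layer_comp[OF assms(1,2)]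
    by simp
  then show ?thesis using k by (simp add: app_def)
qed

lemma app_id:
  assumes "ok s" "m + i \<le> fst s"
  shows "app i i (I i) m s = s"
proof -
  obtain k where k: "fst s = m + i + k"
    using assms(2) le_Suc_ex by blast
  obtain X where X: "snd s \<in> Hom C X (pw (m + i + k))"
    using assms(1) k unfolding ok_def by auto
  have "(I m \<boxtimes> I i \<boxtimes> I k) \<bullet> snd s = snd s"
    using comp_id_left[OF X] by (simp add: I_add add.assoc)
  then show ?thesis using k by (simp add: app_def prod_eq_iff)
qed

text \<open>This and its mirror image let idle strands of a box disappear, so that an axiom
  containing \<open>\<boxtimes> Id C A\<close> becomes a statement about a smaller box at a
  position.\<close>

lemma app_tensor_left:
  assumes "g \<in> Hom C (pw i) (pw j)" "m + i + l \<le> fst s"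
  shows "app (i + l) (j + l) (g \<boxtimes> I l) m s = app i j g m s"
proof -
  obtain k where k: "fst s = m + i + l + k"
    using assms(2) le_Suc_ex by blast
  have "(g \<boxtimes> I l) \<boxtimes> I k = g \<boxtimes> I (l + k)"
    using tensor_assoc[OF assms(1) I_hom I_hom] by (simp add: I_add)
  then show ?thesis using k by (simp add: app_def)
qed

lemma app_tensor_right:
  assumes "g \<in> Hom C (pw i) (pw j)" "m + i + l \<le> fst s"
  shows "app (l + i) (l + j) (I l \<boxtimes> g) m s = app i j g (m + l) s"
proof -
  obtain k where k: "fst s = m + i + l + k"
    using assms(2) le_Suc_ex by blast
  have "I m \<boxtimes> (I l \<boxtimes> g) \<boxtimes> I k = I (m + l) \<boxtimes> g \<boxtimes> I k"
    using tensor_assoc[OF I_hom assms(1) I_hom, of l k]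
      tensor_assoc[OF I_hom I_hom pow_hom[OF assms(1) I_hom], of m l k]
    by (simp add: I_add)
  then show ?thesis using k by (simp add: app_def)
qed

text \<open>Boxes on disjoint strands commute; h is shifted because g replaces i strands to its left
  by j. As a rewrite rule this always makes the left box act first, which gives a normal form for
  independent boxes.\<close>

lemma app_interchange:
  assumes g: "g \<in> Hom C (pw i) (pw j)" and h: "h \<in> Hom C (pw i') (pw j')"
    and s: "ok s" "m' + i' \<le> fst s" and le: "m + i \<le> m'"
  shows "app i j g m (app i' j' h m' s) = app i' j' h (m' - i + j) (app i j g m s)"
proof -
  obtain l where l: "m' = m + i + l"
    using le le_Suc_ex by blast
  \<comment> \<open>There are l strands between the boxes; padding h by them makes both boxes part
    of one block of i + l + i' strands.\<close>
  let ?h = "I l \<boxtimes> h" and ?s = "fst s - i - m"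
  have h': "?h \<in> Hom C (pw (l + i')) (pw (l + j'))"
    by (rule pow_hom[OF I_hom h])
  have 1: "(g \<boxtimes> I (l + j')) \<bullet> (I i \<boxtimes> ?h) = (I j \<boxtimes> ?h) \<bullet> (g \<boxtimes> I (l + i'))"
    using interchange[OF I_hom g h' I_hom] interchange[OF g I_hom I_hom h']
      comp_id_left[OF g] comp_id_right[OF g] comp_id_left[OF h'] comp_id_right[OF h'] by simp
  have right: "app (i + (l + i')) (i + (l + j')) (I i \<boxtimes> ?h) m s = app i' j' h m' s"
    using s l app_tensor_right[OF h', of m i s] app_tensor_right[OF h, of "m + i" l s]
    by (simp add: add.assoc)
  have "app i j g m (app i' j' h m' s)
      = app (i + (l + j')) (j + (l + j')) (g \<boxtimes> I (l + j')) m
          (app (i + (l + i')) (i + (l + j')) (I i \<boxtimes> ?h) m s)"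
    unfolding right using s l by (intro app_tensor_left[OF g, symmetric]) auto
  also have "\<dots> = app (j + (l + i')) (j + (l + j')) (I j \<boxtimes> ?h) m
          (app (i + (l + i')) (j + (l + i')) (g \<boxtimes> I (l + i')) m s)"
    using s l by (simp add: app_comp[OF pow_hom[OF g I_hom] pow_hom[OF I_hom h']]
        app_comp[OF pow_hom[OF I_hom h'] pow_hom[OF g I_hom]] 1)
  also have "app (i + (l + i')) (j + (l + i')) (g \<boxtimes> I (l + i')) m s = app i j g m s"
    using s l by (intro app_tensor_left[OF g]) auto
  also have "app (j + (l + i')) (j + (l + j')) (I j \<boxtimes> ?h) m (app i j g m s)
      = app i' j' h (m' - i + j) (app i j g m s)"
    using s l app_tensor_right[OF h', of m j "app i j g m s"]
      app_tensor_right[OF h, of "m + j" l "app i j g m s"]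
    by (simp add: ac_simps)
  finally show ?thesis .
qed

end

section \<open>Consequences of the hexagon and of symmetry\<close>

context symmetric_strict_monoidal_category
begin

text \<open>Both sides invert the braiding of W with X \<otimes> Y, which the given hexagon splits
  into two crossings: symmetry makes the left side its inverse, and undoing the two crossings one
  after the other is the right side.\<close>

lemma braid_hexagon':
  assumes [simp]: "X \<in> Obj C" "Y \<in> Obj C" "W \<in> Obj C"
  shows "Braid C (X \<odot> Y) W = (Braid C X W \<boxtimes> Id C Y) \<bullet> (Id C X \<boxtimes> Braid C Y W)"
proof -
  let ?l = "Braid C (X \<odot> Y) W" and ?m = "Braid C W (X \<odot> Y)"
  let ?b = "Braid C X W \<boxtimes> Id C Y" and ?c = "Id C X \<boxtimes> Braid C Y W"
  let ?d = "Id C X \<boxtimes> Braid C W Y" and ?e = "Braid C W X \<boxtimes> Id C Y"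
  have b: "?b \<in> Hom C (X \<odot> (W \<odot> Y)) (W \<odot> (X \<odot> Y))"
    using tensor_hom[OF braid_hom id_hom, of X W Y] by (simp add: tensor_obj_assoc)
  have c: "?c \<in> Hom C (X \<odot> (Y \<odot> W)) (X \<odot> (W \<odot> Y))"
    using tensor_hom[OF id_hom braid_hom, of X Y W] by simp
  have d: "?d \<in> Hom C (X \<odot> (W \<odot> Y)) (X \<odot> (Y \<odot> W))"
    using tensor_hom[OF id_hom braid_hom, of X W Y] by simp
  have e: "?e \<in> Hom C (W \<odot> (X \<odot> Y)) (X \<odot> (W \<odot> Y))"
    using tensor_hom[OF braid_hom id_hom, of W X Y] by (simp add: tensor_obj_assoc)
  have l: "?l \<in> Hom C (X \<odot> (Y \<odot> W)) (W \<odot> (X \<odot> Y))"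
    using braid_hom[of "X \<odot> Y" W] by (simp add: tensor_obj tensor_obj_assoc)
  have eb: "?e \<bullet> ?b = Id C (X \<odot> (W \<odot> Y))"
    using interchange[OF braid_hom braid_hom id_hom id_hom, of X W Y] comp_id_left[OF id_hom, of Y]
    by (simp add: braid_symmetric tensor_id tensor_obj tensor_obj_assoc)
  have dc: "?d \<bullet> ?c = Id C (X \<odot> (Y \<odot> W))"
    using interchange[OF id_hom id_hom braid_hom braid_hom, of X Y W] comp_id_left[OF id_hom, of X]
    by (simp add: braid_symmetric tensor_id tensor_obj)
  have lm: "?l \<bullet> ?m = Id C (W \<odot> (X \<odot> Y))"
    by (simp add: braid_symmetric tensor_obj)
  have m: "?m = ?d \<bullet> ?e"
    by (simp add: braid_hexagon)
  have m_hom: "?m \<in> Hom C (W \<odot> (X \<odot> Y)) (X \<odot> (Y \<odot> W))"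
    unfolding m by (rule comp_hom[OF e d])
  have bc: "?b \<bullet> ?c \<in> Hom C (X \<odot> (Y \<odot> W)) (W \<odot> (X \<odot> Y))"
    by (rule comp_hom[OF c b])
  have "?m \<bullet> ?b \<bullet> ?c = ?d \<bullet> (?e \<bullet> ?b) \<bullet> ?c"
    unfolding m comp_assoc[OF bc e d] comp_assoc[OF c b e] ..
  also have "\<dots> = Id C (X \<odot> (Y \<odot> W))"
    unfolding eb comp_id_left[OF c] dc ..
  finally have "?l \<bullet> ?m \<bullet> ?b \<bullet> ?c = ?l"
    by (simp add: comp_id_right[OF l])
  then show ?thesis
    using comp_assoc[OF bc m_hom l] comp_id_left[OF bc] by (simp add: lm)
qed

text \<open>With the other two objects equal to the unit, the hexagon says that this braiding is
  idempotent; by symmetry it is invertible, hence the identity.\<close>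

lemma braid_unit:
  assumes [simp]: "X \<in> Obj C"
  shows "Braid C X (TUnit C) = Id C X" "Braid C (TUnit C) X = Id C X"
proof -
  let ?b = "Braid C X (TUnit C)" and ?c = "Braid C (TUnit C) X"
  have b: "?b \<in> Hom C X X" and c: "?c \<in> Hom C X X"
    using braid_hom[of X "TUnit C"] braid_hom[of "TUnit C" X]
    by (simp_all add: tunit_obj tensor_obj_unit)
  have cb: "?c \<bullet> ?b = Id C X"
    using braid_symmetric[of X "TUnit C"] by (simp add: tunit_obj tensor_obj_unit)
  have "?b = ?b \<bullet> ?b"
    using braid_hexagon[of X "TUnit C" "TUnit C"] tensor_unit[OF b]
    by (simp add: tunit_obj tensor_obj_unit)
  then have "?c \<bullet> ?b = ?c \<bullet> ?b \<bullet> ?b"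
    by simp
  also have "\<dots> = ?b"
    using comp_assoc[OF b b c] comp_id_left[OF b] by (simp add: cb)
  finally show 1: "?b = Id C X"
    using cb by simp
  show "?c = Id C X"
    using cb comp_id_right[OF c] by (simp add: 1)
qed

end

section \<open>Crossings of strands\<close>

context tensor_powers
begin

lemma pw_simps: "pw 0 = TUnit C" "pw (Suc 0) = A" "pw 2 = A \<odot> A" "pw 3 = A \<odot> A \<odot> A"
  by (auto simp: numeral_2_eq_2 numeral_3_eq_3 tensor_obj_unit)

abbreviation br :: "nat \<Rightarrow> nat \<times> 'm \<Rightarrow> nat \<times> 'm" where
  "br \<equiv> app 2 2 (Braid C A A)"

lemma br_hom [simp]: "Braid C A A \<in> Hom C (pw 2) (pw 2)"
  by (simp add: pw_simps braid_hom)

lemma br_br [simp]: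
  assumes "ok s" "m + 2 \<le> fst s"
  shows "br m (br m s) = s"
  using assms app_comp[OF br_hom br_hom assms] app_id[OF assms]
  by (simp add: braid_symmetric pw_simps)

text \<open>\<open>over i m\<close> moves the factor to the right of a block of \<open>i\<close> factors to its left, and
  \<open>under i m\<close> moves the factor to the left of such a block to its right.\<close>

abbreviation over :: "nat \<Rightarrow> nat \<Rightarrow> nat \<times> 'm \<Rightarrow> nat \<times> 'm" where
  "over i \<equiv> app (i + 1) (i + 1) (Braid C (pw i) A)"
abbreviation under :: "nat \<Rightarrow> nat \<Rightarrow> nat \<times> 'm \<Rightarrow> nat \<times> 'm" where
  "under i \<equiv> app (i + 1) (i + 1) (Braid C A (pw i))"

lemma pw_Suc': "pw (i + 1) = pw i \<odot> A" "pw (i + 1) = A \<odot> pw i"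
  using tpow_add[of A i 1] by (simp_all add: tensor_obj_unit)

lemma over_hom: "Braid C (pw i) A \<in> Hom C (pw (i + 1)) (pw (i + 1))"
  using braid_hom[of "pw i" A] pw_Suc'[of i] by simp

lemma under_hom: "Braid C A (pw i) \<in> Hom C (pw (i + 1)) (pw (i + 1))"
  using braid_hom[of A "pw i"] pw_Suc'[of i] by simp

lemma over_natural:
  assumes g: "g \<in> Hom C (pw i) (pw j)" and s: "ok s" "m + i + 1 \<le> fst s"
  shows "over j m (app i j g m s) = app i j g (m + 1) (over i m s)"
proof -
  have I1: "I 1 = Id C A" by (simp add: tensor_obj_unit)
  have "over j m (app i j g m s) = over j m (app (i + 1) (j + 1) (g \<boxtimes> I 1) m s)"
    using s by (simp only: app_tensor_left[OF g])
  also have "\<dots> = app (i + 1) (j + 1) (Braid C (pw j) A \<bullet> (g \<boxtimes> I 1)) m s"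
    using s by (intro app_comp over_hom pow_hom g I_hom) auto
  also have "Braid C (pw j) A \<bullet> (g \<boxtimes> I 1) = (I 1 \<boxtimes> g) \<bullet> Braid C (pw i) A"
    unfolding I1 using braid_natural[OF g id_hom[of A]] by simp
  also have "app (i + 1) (j + 1) ((I 1 \<boxtimes> g) \<bullet> Braid C (pw i) A) m s
      = app (1 + i) (1 + j) (I 1 \<boxtimes> g) m (over i m s)"
    using s pow_hom[OF I_hom g, of 1] over_hom[of i]
    by (subst app_comp[symmetric, where i = "i + 1"]) (auto simp: add.commute)
  also have "\<dots> = app i j g (m + 1) (over i m s)"
    using s by (intro app_tensor_right g) auto
  finally show ?thesis .
qed

lemma under_natural:
  assumes g: "g \<in> Hom C (pw i) (pw j)" and s: "ok s" "m + i + 1 \<le> fst s"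
  shows "under j m (app i j g (m + 1) s) = app i j g m (under i m s)"
proof -
  have I1: "I 1 = Id C A" by (simp add: tensor_obj_unit)
  have "under j m (app i j g (m + 1) s) = under j m (app (1 + i) (1 + j) (I 1 \<boxtimes> g) m s)"
    using s by (simp only: app_tensor_right[OF g])
  also have "\<dots> = app (i + 1) (j + 1) (Braid C A (pw j) \<bullet> (I 1 \<boxtimes> g)) m s"
    using s pow_hom[OF I_hom g, of 1] under_hom[of j]
    by (subst app_comp[symmetric, where i = "j + 1"]) (auto simp: add.commute)
  also have "Braid C A (pw j) \<bullet> (I 1 \<boxtimes> g) = (g \<boxtimes> I 1) \<bullet> Braid C A (pw i)"
    unfolding I1 using braid_natural[OF id_hom[of A] g] by simp
  also have "app (i + 1) (j + 1) ((g \<boxtimes> I 1) \<bullet> Braid C A (pw i)) m s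
      = app (i + 1) (j + 1) (g \<boxtimes> I 1) m (under i m s)"
    using s by (intro app_comp[symmetric] under_hom pow_hom g I_hom) auto
  also have "\<dots> = app i j g m (under i m s)"
    using s under_hom[of i] by (intro app_tensor_left g) auto
  finally show ?thesis .
qed

text \<open>For blocks of length 0, 1 and 2 there is nothing to cross, one crossing, or two
  crossings by the hexagons. The left sides have the forms that \<open>over\<close> and
  \<open>under\<close> take under simplification, for instance \<open>A \<odot> TUnit C\<close> for
  the first power.\<close>

lemma over_under_simps:
  assumes "ok s"
  shows "m + 1 \<le> fst s \<Longrightarrow> app (Suc 0) (Suc 0) (Braid C (TUnit C) A) m s = s"
    "m + 1 \<le> fst s \<Longrightarrow> app (Suc 0) (Suc 0) (Braid C A (TUnit C)) m s = s"
    "app (Suc (Suc 0)) (Suc (Suc 0)) (Braid C (A \<odot> TUnit C) A) m s = br m s"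
    "app (Suc (Suc 0)) (Suc (Suc 0)) (Braid C A (A \<odot> TUnit C)) m s = br m s"
    "m + 3 \<le> fst s \<Longrightarrow> app 3 3 (Braid C (pw 2) A) m s = br m (br (Suc m) s)"
    "m + 3 \<le> fst s \<Longrightarrow> app 3 3 (Braid C A (pw 2)) m s = br (Suc m) (br m s)"
proof -
  show "m + 1 \<le> fst s \<Longrightarrow> app (Suc 0) (Suc 0) (Braid C (TUnit C) A) m s = s"
    "m + 1 \<le> fst s \<Longrightarrow> app (Suc 0) (Suc 0) (Braid C A (TUnit C)) m s = s"
    using app_id[OF assms, of m "Suc 0"] by (simp_all add: braid_unit tensor_obj_unit)
  show "app (Suc (Suc 0)) (Suc (Suc 0)) (Braid C (A \<odot> TUnit C) A) m s = br m s"
    "app (Suc (Suc 0)) (Suc (Suc 0)) (Braid C A (A \<odot> TUnit C)) m s = br m s"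
    by (simp_all add: numeral_2_eq_2 tensor_obj_unit)
  have l: "Braid C A A \<boxtimes> Id C A \<in> Hom C (pw 3) (pw 3)"
    and r: "Id C A \<boxtimes> Braid C A A \<in> Hom C (pw 3) (pw 3)"
    using pow_hom[OF br_hom I_hom, of "Suc 0"] pow_hom[OF I_hom br_hom, of "Suc 0"]
    by (simp_all add: numeral_2_eq_2 numeral_3_eq_3 tensor_obj_unit)
  have left: "app 3 3 (Braid C A A \<boxtimes> Id C A) m t = br m t"
    and right: "app 3 3 (Id C A \<boxtimes> Braid C A A) m t = br (Suc m) t" if "m + 3 \<le> fst t" for t
    using that app_tensor_left[OF br_hom, of m "Suc 0" t] app_tensor_right[OF br_hom,
        of m "Suc 0" t]
    by (simp_all add: numeral_3_eq_3 numeral_2_eq_2 tensor_obj_unit)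
  show "app 3 3 (Braid C (pw 2) A) m s = br m (br (Suc m) s)" if "m + 3 \<le> fst s"
    using that assms app_comp[OF l r, of s m]
    by (simp add: left right pw_simps braid_hexagon')
  show "app 3 3 (Braid C A (pw 2)) m s = br (Suc m) (br m s)" if "m + 3 \<le> fst s"
    using that assms app_comp[OF r l, of s m]
    by (simp add: left right pw_simps braid_hexagon)
qed

text \<open>Naturality of the passage of one strand across a block of two, applied to the crossing
  inside that block.\<close>

lemma yang_baxter:
  assumes "ok s" "m + 3 \<le> fst s"
  shows "br (Suc m) (br m (br (Suc m) s)) = br m (br (Suc m) (br m s))"
  using assms over_natural[OF br_hom, of s m] by (simp add: over_under_simps)

text \<open>This lemma and the three after it glue boxes that share all legs of one of them and
  leave one leg of the other over, the shape of the associativity, unit, counit and Frobenius laws.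
  The leg counts are tied by equations so that numerals match as well as successors.\<close>

lemma app_app_left:
  assumes "g \<in> Hom C (pw j') (pw k)" "h \<in> Hom C (pw i) (pw j)" "ok s" "m + i' \<le> fst s"
    and "i' = Suc i" "j' = Suc j"
  shows "app j' k g m (app i j h m s) = app i' k (g \<bullet> (h \<boxtimes> Id C A)) m s"
proof -
  have I1: "Id C A = I 1" by (simp add: tensor_obj_unit)
  have "app i j h m s = app i' j' (h \<boxtimes> Id C A) m s"
    using assms app_tensor_left[OF assms(2), of m 1 s] by (simp add: I1)
  then show ?thesis
    using assms pow_hom[OF assms(2) I_hom[of 1]] by (simp add: app_comp I1)
qed

lemma app_app_right:
  assumes "g \<in> Hom C (pw j') (pw k)" "h \<in> Hom C (pw i) (pw j)" "ok s" "m + i' \<le> fst s"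
    and "i' = Suc i" "j' = Suc j"
  shows "app j' k g m (app i j h (Suc m) s) = app i' k (g \<bullet> (Id C A \<boxtimes> h)) m s"
proof -
  have I1: "Id C A = I 1" by (simp add: tensor_obj_unit)
  have "app i j h (Suc m) s = app i' j' (Id C A \<boxtimes> h) m s"
    using assms app_tensor_right[OF assms(2), of m 1 s] by (simp add: I1)
  then show ?thesis
    using assms pow_hom[OF I_hom[of 1] assms(2)] by (simp add: app_comp I1)
qed

lemma app_left_app:
  assumes "g \<in> Hom C (pw j) (pw k)" "h \<in> Hom C (pw i) (pw j')" "ok s" "m + i \<le> fst s"
    and "j' = Suc j" "k' = Suc k"
  shows "app j k g m (app i j' h m s) = app i k' ((g \<boxtimes> Id C A) \<bullet> h) m s"
proof -
  have I1: "Id C A = I 1" by (simp add: tensor_obj_unit)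
  have "app j k g m (app i j' h m s) = app j' k' (g \<boxtimes> Id C A) m (app i j' h m s)"
    using assms app_tensor_left[OF assms(1), of m 1 "app i j' h m s"] by (simp add: I1)
  then show ?thesis
    using assms pow_hom[OF assms(1) I_hom[of 1]] by (simp add: app_comp I1)
qed

lemma app_right_app:
  assumes "g \<in> Hom C (pw j) (pw k)" "h \<in> Hom C (pw i) (pw j')" "ok s" "m + i \<le> fst s"
    and "j' = Suc j" "k' = Suc k"
  shows "app j k g (Suc m) (app i j' h m s) = app i k' ((Id C A \<boxtimes> g) \<bullet> h) m s"
proof -
  have I1: "Id C A = I 1" by (simp add: tensor_obj_unit)
  have "app j k g (Suc m) (app i j' h m s) = app j' k' (Id C A \<boxtimes> g) m (app i j' h m s)"
    using assms app_tensor_right[OF assms(1), of m 1 "app i j' h m s"] by (simp add: I1)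
  then show ?thesis
    using assms pow_hom[OF I_hom[of 1] assms(1)] by (simp add: app_comp I1)
qed

lemma app_Id:
  assumes "ok s" "m + 1 \<le> fst s"
  shows "app (Suc 0) (Suc 0) (Id C A) m s = s"
  using app_id[of s m 1] assms by (simp add: tensor_obj_unit)

lemma br_unary:
  assumes "g \<in> Hom C A A" "ok s" "m + 2 \<le> fst s"
  shows "br m (app (Suc 0) (Suc 0) g m s) = app (Suc 0) (Suc 0) g (Suc m) (br m s)"
    "br m (app (Suc 0) (Suc 0) g (Suc m) s) = app (Suc 0) (Suc 0) g m (br m s)"
  using assms over_natural[of g 1 1 s m] under_natural[of g 1 1 s m]
  by (simp_all add: over_under_simps tensor_obj_unit numeral_2_eq_2)

text \<open>The exit from the strand calculus: a box that takes all strands is just composed.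
  Started at an identity, an equation of iterated applications thus becomes an equation of
  morphisms.\<close>

lemma app_exact:
  assumes "g \<in> Hom C (pw i) (pw j)"
  shows "app i j g 0 (i, f) = (j, g \<bullet> f)"
proof -
  have "I 0 \<boxtimes> g \<boxtimes> I 0 = g"
    using tensor_unit[OF assms] by simp
  then show ?thesis by (simp add: app_def)
qed

lemma app_whisker:
  assumes "g \<in> Hom C A A"
  shows "app (Suc 0) (Suc 0) g 0 (2, f) = (2, (g \<boxtimes> Id C A) \<bullet> f)"
    "app (Suc 0) (Suc 0) g (Suc 0) (2, f) = (2, (Id C A \<boxtimes> g) \<bullet> f)"
proof -
  have "g \<boxtimes> Id C A \<in> Hom C (A \<odot> A) (A \<odot> A)" "Id C A \<boxtimes> g \<in> Hom C (A \<odot> A) (A \<odot> A)"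
    using tensor_hom[OF assms id_hom[OF A_obj]] tensor_hom[OF id_hom[OF A_obj] assms] by simp_all
  then show "app (Suc 0) (Suc 0) g 0 (2, f) = (2, (g \<boxtimes> Id C A) \<bullet> f)"
    "app (Suc 0) (Suc 0) g (Suc 0) (2, f) = (2, (Id C A \<boxtimes> g) \<bullet> f)"
    using tensor_unit assms by (simp_all add: app_def tensor_obj_unit)
qed

lemma ok_Id: "ok (n, I n)"
  by (auto simp: ok_def intro: I_hom)

end

section \<open>Frobenius algebras and the Nakayama automorphism\<close>

locale frobenius_object = symmetric_strict_monoidal_category C
  for C :: "('o, 'm) cat_data" (structure) +
  fixes F :: "('o, 'm) frobenius_data"
  assumes frobenius: "frobenius_algebra C F"
begin

abbreviation A :: 'o where "A \<equiv> Car F"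

sublocale tensor_powers C "Car F"
  using frobenius by unfold_locales (simp add: frobenius_algebra_def algebra_def)

abbreviation b :: 'm where "b \<equiv> frobenius_pairing C F"
abbreviation c :: 'm where "c \<equiv> Comul F \<bullet> Unit F"
abbreviation N :: 'm where "N \<equiv> nakayama C F"

lemma structure_hom [simp]:
  "Mul F \<in> Hom C (A \<odot> A) A" "Unit F \<in> Hom C (TUnit C) A"
  "Comul F \<in> Hom C A (A \<odot> A)" "Counit F \<in> Hom C A (TUnit C)"
  using frobenius by (auto simp: frobenius_algebra_def algebra_def coalgebra_def)

lemma structure_laws:
  "Mul F \<bullet> (Mul F \<boxtimes> Id C A) = Mul F \<bullet> (Id C A \<boxtimes> Mul F)"
  "Mul F \<bullet> (Unit F \<boxtimes> Id C A) = Id C A" "Mul F \<bullet> (Id C A \<boxtimes> Unit F) = Id C A"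
  "(Comul F \<boxtimes> Id C A) \<bullet> Comul F = (Id C A \<boxtimes> Comul F) \<bullet> Comul F"
  "(Counit F \<boxtimes> Id C A) \<bullet> Comul F = Id C A" "(Id C A \<boxtimes> Counit F) \<bullet> Comul F = Id C A"
  "(Id C A \<boxtimes> Mul F) \<bullet> (Comul F \<boxtimes> Id C A) = Comul F \<bullet> Mul F"
  "(Mul F \<boxtimes> Id C A) \<bullet> (Id C A \<boxtimes> Comul F) = Comul F \<bullet> Mul F"
  using frobenius by (auto simp only: frobenius_algebra_def algebra_def coalgebra_def)

lemma b_hom [simp]: "b \<in> Hom C (A \<odot> A) (TUnit C)"
  unfolding frobenius_pairing_def by (rule comp_hom[of _ _ A]) simp_all

lemma c_hom [simp]: "c \<in> Hom C (TUnit C) (A \<odot> A)"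
  by (rule comp_hom[of _ _ A]) simp_all

lemma N_hom [simp]: "N \<in> Hom C A A"
proof -
  have "Id C A \<boxtimes> c \<in> Hom C A (A \<odot> (A \<odot> A))"
    using tensor_hom[OF id_hom c_hom, of A] by (simp add: tensor_obj_unit)
  moreover have "Id C A \<boxtimes> Braid C A A \<in> Hom C (A \<odot> (A \<odot> A)) (A \<odot> (A \<odot> A))"
    by (intro tensor_hom id_hom braid_hom A_obj)
  moreover have "b \<boxtimes> Id C A \<in> Hom C (A \<odot> (A \<odot> A)) A"
    using tensor_hom[OF b_hom id_hom, of A] by (simp add: tensor_obj_unit tensor_obj_assoc)
  ultimately show ?thesis
    unfolding nakayama_def by (blast intro: comp_hom)
qed

lemma pw_2 [simp]: "pw 2 = A \<odot> A" 
  by (rule pw_simps)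

lemma A_unit [simp]: "A \<odot> TUnit C = A"
  by (simp add: tensor_obj_unit)

lemma braid_A_hom [simp]: "Braid C A A \<in> Hom C (A \<odot> A) (A \<odot> A)"
  by (simp add: braid_hom)

section \<open>The Frobenius axioms as rules for strands\<close>

abbreviation mu where "mu \<equiv> app 2 (Suc 0) (Mul F)"
abbreviation eta where "eta \<equiv> app 0 (Suc 0) (Unit F)"
abbreviation dl where "dl \<equiv> app (Suc 0) 2 (Comul F)"
abbreviation ep where "ep \<equiv> app (Suc 0) 0 (Counit F)"
abbreviation pr where "pr \<equiv> app 2 0 b"
abbreviation cp where "cp \<equiv> app 0 2 c"
abbreviation nk where "nk \<equiv> app (Suc 0) (Suc 0) N"

lemma mu_assoc:
  assumes "ok s" "m + 3 \<le> fst s"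
  shows "mu m (mu m s) = mu m (mu (Suc m) s)"
  using assms
    app_app_left[of "Mul F" 2 1 "Mul F" 2 1 s m 3] app_app_right[of "Mul F" 2 1 "Mul F" 2 1 s m 3]
  by (simp add: structure_laws)

lemma mu_eta:
  assumes "ok s" "m + 1 \<le> fst s"
  shows "mu m (eta m s) = s" "mu m (eta (Suc m) s) = s"
proof -
  have "mu m (eta m s) = app (Suc 0) (Suc 0) (Mul F \<bullet> (Unit F \<boxtimes> Id C A)) m s"
    using assms by (intro app_app_left) auto
  then show "mu m (eta m s) = s"
    using assms by (simp only: structure_laws app_Id)
  have "mu m (eta (Suc m) s) = app (Suc 0) (Suc 0) (Mul F \<bullet> (Id C A \<boxtimes> Unit F)) m s"
    using assms by (intro app_app_right) auto
  then show "mu m (eta (Suc m) s) = s"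
    using assms by (simp only: structure_laws app_Id)
qed

lemma ep_dl:
  assumes "ok s" "m + 1 \<le> fst s"
  shows "ep m (dl m s) = s" "ep (Suc m) (dl m s) = s"
proof -
  have "ep m (dl m s) = app (Suc 0) (Suc 0) ((Counit F \<boxtimes> Id C A) \<bullet> Comul F) m s"
    using assms by (intro app_left_app) auto
  then show "ep m (dl m s) = s"
    using assms by (simp only: structure_laws app_Id)
  have "ep (Suc m) (dl m s) = app (Suc 0) (Suc 0) ((Id C A \<boxtimes> Counit F) \<bullet> Comul F) m s"
    using assms by (intro app_right_app) auto
  then show "ep (Suc m) (dl m s) = s"
    using assms by (simp only: structure_laws app_Id)
qed

lemma pr_eq: "ok s \<Longrightarrow> m + 2 \<le> fst s \<Longrightarrow> pr m s = ep m (mu m s)"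
  using app_comp[of "Counit F" 1 0 "Mul F" 2 s m] by (simp add: frobenius_pairing_def)

lemma cp_eq: "ok s \<Longrightarrow> m \<le> fst s \<Longrightarrow> cp m s = dl m (eta m s)"
  using app_comp[of "Comul F" 1 2 "Unit F" 0 s m] by simp

lemma dl_mu:
  assumes "ok s" "m + 2 \<le> fst s"
  shows "dl m (mu m s) = mu (Suc m) (dl m s)" "dl m (mu m s) = mu m (dl (Suc m) s)"
proof -
  let ?l = "Comul F \<boxtimes> Id C A" and ?r = "Id C A \<boxtimes> Comul F"
  have l: "?l \<in> Hom C (pw 2) (pw 3)" and r: "?r \<in> Hom C (pw 2) (pw 3)"
    using pow_hom[of "Comul F" 1 2 "I 1" 1 1] pow_hom[of "I 1" 1 1 "Comul F" 1 2] I_hom[of 1]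
    by (simp_all add: pw_simps(4))
  have "app 2 3 ?l m s = dl m s" "app 2 3 ?r m s = dl (Suc m) s"
    using assms app_tensor_left[of "Comul F" 1 2 m 1 s] app_tensor_right[of "Comul F" 1 2 m 1 s]
    by (simp_all add: numeral_2_eq_2 numeral_3_eq_3)
  moreover have "app 2 2 ((Id C A \<boxtimes> Mul F) \<bullet> ?l) m s = mu (Suc m) (app 2 3 ?l m s)"
    "app 2 2 ((Mul F \<boxtimes> Id C A) \<bullet> ?r) m s = mu m (app 2 3 ?r m s)"
    using assms l r app_right_app[of "Mul F" 2 1 ?l 2 3 s m 2] app_left_app[of "Mul F" 2 1 ?r 2 3 s
        m 2]
    by (simp_all add: pw_simps(4))
  moreover have "dl m (mu m s) = app 2 2 (Comul F \<bullet> Mul F) m s"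
    using assms app_comp[of "Comul F" 1 2 "Mul F" 2 s m] by simp
  ultimately show "dl m (mu m s) = mu (Suc m) (dl m s)" "dl m (mu m s) = mu m (dl (Suc m) s)"
    by (simp_all add: structure_laws)
qed

lemma br_mu:
  assumes "ok s" "m + 3 \<le> fst s"
  shows "br m (mu m s) = mu (Suc m) (br m (br (Suc m) s))"
    "br m (mu (Suc m) s) = mu m (br (Suc m) (br m s))"
  using assms over_natural[of "Mul F" 2 1 s m] under_natural[of "Mul F" 2 1 s m]
    over_under_simps(5,6)[of s m]
  by (simp_all add: over_under_simps numeral_2_eq_2 numeral_3_eq_3)

lemma br_dl:
  assumes "ok s" "m + 2 \<le> fst s"
  shows "br m (br (Suc m) (dl m s)) = dl (Suc m) (br m s)"
    "br (Suc m) (br m (dl (Suc m) s)) = dl m (br m s)"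
  using assms over_natural[of "Comul F" 1 2 s m] under_natural[of "Comul F" 1 2 s m]
    over_under_simps(5)[of "dl m s" m] over_under_simps(6)[of "dl (Suc m) s" m]
  by (simp_all add: over_under_simps numeral_2_eq_2 numeral_3_eq_3)

text \<open>Naturality pulls the whole cup through the strand with two crossings; cancelling one of
  them leaves one crossing on each side. The lemma \<open>pr_br\<close> is the same for the cap
  b.\<close>

lemma br_cp:
  assumes "ok s" "m + 1 \<le> fst s"
  shows "br (Suc m) (cp m s) = br m (cp (Suc m) s)"
proof -
  have "br m (br (Suc m) (cp m s)) = cp (Suc m) s"
    using assms over_natural[of c 0 2 s m] over_under_simps(5)[of "cp m s" m]
    by (simp add: over_under_simps)
  then have "br m (br m (br (Suc m) (cp m s))) = br m (cp (Suc m) s)"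
    by simp
  then show ?thesis
    using assms by simp
qed

lemma pr_br:
  assumes "ok s" "m + 3 \<le> fst s"
  shows "pr m (br (Suc m) s) = pr (Suc m) (br m s)"
proof -
  have "pr m (br (Suc m) s) = pr (Suc m) (br m (br (Suc m) (br (Suc m) s)))"
    using assms over_natural[of b 2 0 "br (Suc m) s" m] over_under_simps(5)[of "br (Suc m) s" m]
    by (simp add: over_under_simps)
  then show ?thesis
    using assms by simp
qed

lemmas ic = app_interchange

text \<open>The Frobenius relation turns multiplication into a leg of c into \<Delta> of a product
  with the unit, after which the unit and counit laws finish. So b and c exhibit A as its own dual,
  and strands can be bent from here on.\<close>

lemma snake:
  assumes "ok s" "m + 1 \<le> fst s"
  shows "pr m (cp (Suc m) s) = s" "pr (Suc m) (cp m s) = s"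
proof -
  have "pr m (cp (Suc m) s) = ep m (mu m (dl (Suc m) (eta (Suc m) s)))"
    using assms by (simp add: pr_eq cp_eq)
  also have "\<dots> = ep m (dl m (mu m (eta (Suc m) s)))"
    using assms by (simp add: dl_mu(2))
  also have "\<dots> = s"
    using assms by (simp add: ep_dl mu_eta)
  finally show "pr m (cp (Suc m) s) = s" .
  have "pr (Suc m) (cp m s) = ep (Suc m) (mu (Suc m) (dl m (eta m s)))"
    using assms by (simp add: pr_eq cp_eq)
  also have "\<dots> = ep (Suc m) (dl m (mu m (eta m s)))"
    using assms by (simp add: dl_mu(1))
  also have "\<dots> = s"
    using assms by (simp add: ep_dl mu_eta)
  finally show "pr (Suc m) (cp m s) = s" .
qed

text \<open>In Sweedler notation \<Delta>(x) = x c_1 \<otimes> c_2 = c_1 \<otimes> c_2 x, the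
  Frobenius relations for the product of x with 1. Comultiplication is thereby reduced to \<mu> and
  the single tensor c.\<close>

lemma dl_eq:
  assumes "ok s" "m + 1 \<le> fst s"
  shows "dl m s = mu m (cp (Suc m) s)" "dl m s = mu (Suc m) (cp m s)"
proof -
  have "mu m (cp (Suc m) s) = dl m (mu m (eta (Suc m) s))"
    using assms by (simp add: cp_eq dl_mu(2))
  then show "dl m s = mu m (cp (Suc m) s)"
    using assms by (simp add: mu_eta)
  have "mu (Suc m) (cp m s) = dl m (mu m (eta m s))"
    using assms by (simp add: cp_eq dl_mu(1))
  then show "dl m s = mu (Suc m) (cp m s)"
    using assms by (simp add: mu_eta)
qed

lemma pr_mu:
  assumes "ok s" "m + 3 \<le> fst s"
  shows "pr m (mu m s) = pr m (mu (Suc m) s)"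
  using assms by (simp add: pr_eq mu_assoc)

lemma pr_eta:
  assumes "ok s" "m + 1 \<le> fst s"
  shows "pr m (eta m s) = ep m s" "pr m (eta (Suc m) s) = ep m s"
  using assms by (simp_all add: pr_eq mu_eta)

lemma nk_eq:
  assumes "ok s" "m + 1 \<le> fst s"
  shows "nk m s = pr m (br (Suc m) (cp (Suc m) s))"
proof -
  let ?c = "Id C A \<boxtimes> c" and ?s = "Id C A \<boxtimes> Braid C A A" and ?b = "b \<boxtimes> Id C A"
  have c: "?c \<in> Hom C (pw 1) (pw 3)" and s: "?s \<in> Hom C (pw 3) (pw 3)"
    and b: "?b \<in> Hom C (pw 3) (pw 1)"
    using pow_hom[of "I 1" 1 1 c 0 2] pow_hom[of "I 1" 1 1 "Braid C A A" 2 2]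
      pow_hom[of b 2 0 "I 1" 1 1] I_hom[of 1]
    by (simp_all add: pw_simps(4))
  have c': "app 1 3 ?c m s = cp (Suc m) s"
    using assms app_tensor_right[of c 0 2 m 1 s]
    by (simp add: numeral_2_eq_2 numeral_3_eq_3)
  have s': "app 3 3 ?s m (cp (Suc m) s) = br (Suc m) (cp (Suc m) s)"
    using assms app_tensor_right[of "Braid C A A" 2 2 m 1 "cp (Suc m) s"]
    by (simp add: numeral_2_eq_2 numeral_3_eq_3)
  have b': "app 3 1 ?b m (br (Suc m) (cp (Suc m) s)) = pr m (br (Suc m) (cp (Suc m) s))"
    using assms app_tensor_left[of b 2 0 m 1 "br (Suc m) (cp (Suc m) s)"]
    by (simp add: numeral_2_eq_2 numeral_3_eq_3)
  have "nk m s = app 1 1 (?b \<bullet> ?s \<bullet> ?c) m s"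
    by (simp add: nakayama_def)
  also have "\<dots> = app 3 1 ?b m (app 3 3 ?s m (app 1 3 ?c m s))"
    using assms by (simp only: app_comp[OF b comp_hom[OF c s]] app_comp[OF s c])
  finally show ?thesis
    unfolding c' s' b' .
qed

text \<open>In elements N(x) = b(x, c_2) c_1. Creating the cup to the left of x instead leaves c_1
  next to an earlier strand, ready for a snake.\<close>

lemma nk_eq':
  assumes "ok s" "m + 1 \<le> fst s"
  shows "nk m s = pr (Suc m) (br (Suc m) (cp m s))"
  using assms by (simp add: nk_eq pr_br br_cp)

lemma br_nk:
  assumes "ok s" "m + 2 \<le> fst s"
  shows "br m (nk m s) = nk (Suc m) (br m s)" "br m (nk (Suc m) s) = nk m (br m s)"
  using assms by (simp_all add: br_unary)

text \<open>This is b(y, N x) = b(x, y): with N x = c_1 b(x, c_2) the remaining factor b(y, c_1) c_2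
  straightens to y.\<close>

lemma pr_nk_right:
  assumes "ok s" "m + 2 \<le> fst s"
  shows "pr m (nk (Suc m) s) = pr m (br m s)"
  using assms by (simp add: nk_eq' ic snake)

lemma b_N: "b \<bullet> (Id C A \<boxtimes> N) = b \<bullet> Braid C A A"
proof -
  have "Id C A \<boxtimes> N \<in> Hom C (A \<odot> A) (A \<odot> A)"
    using tensor_hom[OF id_hom[OF A_obj] N_hom] .
  then show ?thesis
    using pr_nk_right[of "(2, Id C (A \<odot> A))" 0] ok_Id[of 2] 
    by (simp add: app_whisker app_exact comp_id_right[OF braid_A_hom] comp_id_right)
qed

text \<open>Nondegeneracy: the snake identity recovers a morphism h from b (id \<otimes> h), and N
  and g both give b \<sigma>. It will identify the Nakayama automorphism of Z without evaluating its
  definition there.\<close>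

lemma nakayama_unique:
  assumes g: "g \<in> Hom C A A" and b: "b \<bullet> (Id C A \<boxtimes> g) = b \<bullet> Braid C A A"
  shows "N = g"
proof -
  let ?g = "app (Suc 0) (Suc 0) g" and ?s = "(1, Id C A)"
  have pr: "pr m (app (Suc 0) (Suc 0) h (Suc m) s) = app 2 0 (b \<bullet> (Id C A \<boxtimes> h)) m s"
    if "h \<in> Hom C A A" "ok s" "m + 2 \<le> fst s" for h m s
    using that by (intro app_app_right) auto
  have cup: "h \<bullet> Id C A
      = snd (pr 1 (app (Suc 0) (Suc 0) h 2 (cp 0 ?s)))" if h: "h \<in> Hom C A A" for h
  proof -
    have "app (Suc 0) (Suc 0) h 0 ?s = pr 1 (cp 0 (app (Suc 0) (Suc 0) h 0 ?s))"
      using h ok_Id[of 1] by (simp add: snake)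
    also have "cp 0 (app (Suc 0) (Suc 0) h 0 ?s) = app (Suc 0) (Suc 0) h 2 (cp 0 ?s)"
      using h ok_Id[of 1] by (simp add: ic numeral_2_eq_2)
    finally have "snd (app (Suc 0) (Suc 0) h 0 ?s) = snd (pr 1 (app (Suc 0) (Suc 0) h 2 (cp 0 ?s)))"
      by (rule arg_cong)
    then show ?thesis
      using h by (simp add: app_exact)
  qed
  have "N \<bullet> Id C A = g \<bullet> Id C A"
    unfolding cup[OF g] cup[OF N_hom]
    using pr[OF g, of "cp 0 ?s" 1] pr[OF N_hom, of "cp 0 ?s" 1] ok_Id[of 1]
    by (simp add: b b_N numeral_2_eq_2)
  then show ?thesis
    using g by (simp add: comp_id_right[OF N_hom] comp_id_right[OF g])
qed

end

text \<open>A named predicate, because the simplifier would split membership in {1, -1} into cases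
  at every side condition.\<close>

definition sign :: "int \<Rightarrow> bool" where
  "sign \<nu> \<longleftrightarrow> \<nu> \<in> {1, -1}"

lemma sign_mult: "sign \<alpha> \<Longrightarrow> sign \<beta> \<Longrightarrow> sign (\<alpha> * \<beta>)"
  by (auto simp: sign_def)

section \<open>Consequences of N being an involution\<close>

locale involutive_frobenius_object = frobenius_object +
  assumes N_involution: "N \<bullet> N = Id C A"
begin

lemma nk_nk:
  assumes "ok s" "m + 1 \<le> fst s"
  shows "nk m (nk m s) = s"
proof -
  have "nk m (nk m s) = app (Suc 0) (Suc 0) (N \<bullet> N) m s"
    using assms by (intro app_comp) auto
  then show ?thesis
    using assms by (simp only: N_involution app_Id)
qed

text \<open>Two flips: b(x, y) = b(y, N x) = b(N x, N y).\<close>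

lemma pr_nk_nk:
  assumes "ok s" "m + 2 \<le> fst s"
  shows "pr m (nk (Suc m) (nk m s)) = pr m s"
proof -
  have "pr m s = pr m (nk (Suc m) (br m s))"
    using assms by (simp add: pr_nk_right)
  also have "\<dots> = pr m (br m (nk m s))"
    using assms by (simp add: br_nk)
  also have "\<dots> = pr m (nk (Suc m) (nk m s))"
    using assms by (simp add: pr_nk_right)
  finally show ?thesis ..
qed

text \<open>Invariance of b under N would put the inverse of N on the left argument; the involution
  makes it N itself.\<close>

lemma pr_nk_left:
  assumes "ok s" "m + 2 \<le> fst s"
  shows "pr m (nk m s) = pr m (br m s)"
  using assms pr_nk_nk[of "nk m s" m] by (simp add: nk_nk pr_nk_right)

lemma cp_br:
  assumes "ok s" "m \<le> fst s"
  shows "br m (cp m s) = nk m (cp m s)"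
proof -
  \<comment> \<open>In elements c_2 b(c_1, t) = N(t): the swapped cup already acts as N.\<close>
  have *: "pr (Suc m) (br m (cp m t)) = nk m t" if "ok t" "m + 1 \<le> fst t" for t
  proof -
    have "pr (Suc m) (br m (cp m t)) = pr m (br m (cp (Suc m) t))"
      using that by (simp add: br_cp flip: pr_br)
    also have "\<dots> = pr m (nk m (cp (Suc m) t))"
      using that by (simp add: pr_nk_left)
    also have "\<dots> = nk m t"
      using that by (simp add: ic snake)
    finally show ?thesis .
  qed
  have "nk m (cp m s) = pr (Suc m) (br m (cp m (cp m s)))"
    using assms by (simp add: *)
  \<comment> \<open>\<open>*\<close> has been applied to the first leg of a second cup. Creating the
    two cups in the other order leaves the one at position m + 2 as a bent strand, which the snake
    removes.\<close>
  also have "cp m (cp m s) = cp (Suc (Suc m)) (cp m s)"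
    using assms ic[of c 0 2 c 0 2 s m m] by simp
  also have "br m \<dots> = cp (Suc (Suc m)) (br m (cp m s))"
    using assms by (simp add: ic)
  also have "pr (Suc m) \<dots> = br m (cp m s)"
    using assms by (simp add: snake)
  finally show ?thesis ..
qed

lemma cp_nk_nk:
  assumes "ok s" "m \<le> fst s"
  shows "nk (Suc m) (nk m (cp m s)) = cp m s"
proof -
  have "nk (Suc m) (nk m (cp m s)) = nk (Suc m) (br m (cp m s))"
    using assms by (simp add: cp_br)
  also have "\<dots> = br m (nk m (cp m s))"
    using assms by (simp add: br_nk)
  also have "\<dots> = cp m s"
    using assms by (simp flip: cp_br)
  finally show ?thesis .
qed

lemma cp_nk:
  assumes "ok s" "m \<le> fst s"
  shows "nk (Suc m) (cp m s) = nk m (cp m s)"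
proof -
  have "nk (Suc m) (cp m s) = nk (Suc m) (nk (Suc m) (nk m (cp m s)))"
    using assms by (simp add: cp_nk_nk)
  then show ?thesis
    using assms by (simp add: nk_nk)
qed

text \<open>Invariance and one flip: b(xy, z) = b(x, yz) = b(yz, N x), so the trilinear form is
  cyclic up to one N.\<close>

lemma pr_mu_rotate:
  assumes "ok s" "m + 3 \<le> fst s"
  shows "pr m (mu m s) = pr m (mu m (nk (Suc (Suc m)) (br (Suc m) (br m s))))"
proof -
  have "pr m (mu m s) = pr m (br m (br m (mu (Suc m) s)))"
    using assms by (simp add: pr_mu)
  also have "\<dots> = pr m (nk (Suc m) (br m (mu (Suc m) s)))"
    using assms by (simp add: pr_nk_right)
  also have "br m (mu (Suc m) s) = mu m (br (Suc m) (br m s))"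
    using assms by (simp add: br_mu)
  also have "nk (Suc m) \<dots> = mu m (nk (Suc (Suc m)) (br (Suc m) (br m s)))"
    using assms by (simp add: ic)
  finally show ?thesis .
qed

text \<open>Two rotations: b(yz, x) = b(zx, N y) = b(x N(y), N z).\<close>

lemma pr_mu_rotate_nk:
  assumes "ok s" "m + 3 \<le> fst s"
  shows "pr m (mu m (br (Suc m) (br m s))) = pr m (mu m (nk (Suc (Suc m)) (nk (Suc m) s)))"
proof -
  \<comment> \<open>The cyclic shift of three strands, kept opaque so that N is moved through it as
    a whole; its cube is trivial by the Yang-Baxter equation.\<close>
  define r where "r t = br (Suc m) (br m t)" for t
  have r [simp]: "ok (r t)" "fst (r t) = fst t" if "ok t" "m + 3 \<le> fst t" for t
    using that by (simp_all add: r_def)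
  have rot: "pr m (mu m t) = pr m (mu m (nk (Suc (Suc m)) (r t)))" if "ok t" "m + 3 \<le> fst t" for t
    unfolding r_def using that by (rule pr_mu_rotate)
  have rn: "r (nk (Suc (Suc m)) t) = nk (Suc m) (r t)" "r (nk (Suc m) t) = nk m (r t)"
    "r (nk m t) = nk (Suc (Suc m)) (r t)"
    if "ok t" "m + 3 \<le> fst t" for t
    using that by (simp_all add: r_def br_nk ic)
  have r3: "r (r (r t)) = t" if "ok t" "m + 3 \<le> fst t" for t
    using that by (simp add: r_def yang_baxter)
  have "pr m (mu m (r s)) = pr m (mu m (nk (Suc (Suc m)) (r (r s))))"
    using assms by (simp add: rot[of "r s"])
  also have "\<dots> = pr m (mu m (nk (Suc (Suc m)) (r (nk (Suc (Suc m)) (r (r s))))))"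
    using assms by (subst rot) simp_all
  also have "\<dots> = pr m (mu m (nk (Suc (Suc m)) (nk (Suc m) s)))"
    using assms by (simp add: rn r3)
  finally show ?thesis
    by (simp add: r_def)
qed

text \<open>For every x, b(x, N(yz)) = b(yz, x) = b(x N(y), N z) = b(x, N(y) N(z)). Taking the
  second leg of a cup for x removes b.\<close>

lemma nk_mu:
  assumes "ok s" "m + 2 \<le> fst s"
  shows "nk m (mu m s) = mu m (nk (Suc m) (nk m s))"
proof -
  have cup: "pr (Suc m) (cp m t) = t" if "ok t" "m + 1 \<le> fst t" for t
    using that by (rule snake)
  have "nk m (mu m s) = pr (Suc m) (cp m (nk m (mu m s)))"
    using assms by (simp add: cup)
  also have "cp m (nk m (mu m s)) = nk (Suc (Suc m)) (mu (Suc (Suc m)) (cp m s))"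
    using assms by (simp add: ic)
  also have "pr (Suc m) \<dots> = pr (Suc m) (br (Suc m) (mu (Suc (Suc m)) (cp m s)))"
    using assms by (simp add: pr_nk_right)
  also have "\<dots> = pr (Suc m) (mu (Suc m) (nk (Suc (Suc (Suc m))) (nk (Suc (Suc m)) (cp m s))))"
    using assms by (simp add: br_mu pr_mu_rotate_nk)
  also have "\<dots> = pr (Suc m) (mu (Suc (Suc m)) (nk (Suc (Suc (Suc m))) (nk (Suc (Suc m)) (cp m s))))"
    using assms by (simp add: pr_mu)
  also have "\<dots> = pr (Suc m) (cp m (mu m (nk (Suc m) (nk m s))))"
    using assms by (simp add: ic)
  finally show ?thesis
    using assms by (simp add: cup)
qed

subsection \<open>The idempotents and twisted centrality\<close>

abbreviation ns where "ns \<nu> \<equiv> app (Suc 0) (Suc 0) (signed C A N \<nu>)"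
abbreviation qq where "qq \<nu> \<equiv> app (Suc 0) (Suc 0) (q_idem C F \<nu>)"

lemma signed_hom [simp]: "signed C A N \<nu> \<in> Hom C A A"
  by (simp add: signed_def id_hom)

lemma ns_eq: "ok s \<Longrightarrow> m + 1 \<le> fst s \<Longrightarrow> ns \<nu> m s = (if \<nu> = -1 then nk m s else s)"
  by (simp add: signed_def app_Id)

lemma br_ns:
  assumes "ok s" "m + 2 \<le> fst s"
  shows "br m (ns \<nu> m s) = ns \<nu> (Suc m) (br m s)" "br m (ns \<nu> (Suc m) s) = ns \<nu> m (br m s)"
  using assms by (simp_all add: br_unary)

lemma ns_mu:
  assumes "ok s" "m + 2 \<le> fst s"
  shows "ns \<nu> m (mu m s) = mu m (ns \<nu> (Suc m) (ns \<nu> m s))"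
  using assms by (simp add: ns_eq nk_mu)

lemma cp_ns:
  assumes "ok s" "m \<le> fst s"
  shows "ns \<nu> (Suc m) (cp m s) = ns \<nu> m (cp m s)"
  using assms by (simp add: ns_eq cp_nk)

lemma q_hom [simp]: "q_idem C F \<nu> \<in> Hom C A A"
proof -
  have "signed C A N (- \<nu>) \<boxtimes> Id C A \<in> Hom C (A \<odot> A) (A \<odot> A)"
    by (intro tensor_hom id_hom) simp_all
  then show ?thesis
    unfolding q_idem_def by (meson comp_hom braid_A_hom structure_hom)
qed

text \<open>In elements q_\<nu>(x) = x_2 N_{-\<nu>}(x_1); by \<open>dl_eq\<close> also q_\<nu>(x) =
  c_2 x N_{-\<nu>}(c_1).\<close>

lemma qq_eq:
  assumes "ok s" "m + 1 \<le> fst s"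
  shows "qq \<nu> m s = mu m (br m (ns (- \<nu>) m (dl m s)))"
proof -
  let ?n = "signed C A N (- \<nu>) \<boxtimes> Id C A"
  have n: "?n \<in> Hom C (A \<odot> A) (A \<odot> A)"
    by (intro tensor_hom id_hom) simp_all
  have n': "app 2 2 ?n m (dl m s) = ns (- \<nu>) m (dl m s)"
    using assms app_tensor_left[of "signed C A N (- \<nu>)" 1 1 m 1 "dl m s"]
    by (simp add: numeral_2_eq_2)
  have nd: "?n \<bullet> Comul F \<in> Hom C A (A \<odot> A)"
    using comp_hom[OF structure_hom(3) n] .
  have bnd: "Braid C A A \<bullet> ?n \<bullet> Comul F \<in> Hom C A (A \<odot> A)"
    using comp_hom[OF nd braid_A_hom] .
  have "app (Suc 0) 2 (?n \<bullet> Comul F) m s = ns (- \<nu>) m (dl m s)"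
    using assms n app_comp[of ?n 2 2 "Comul F" 1 s m] by (simp add: n')
  moreover have "app (Suc 0) 2 (Braid C A A \<bullet> ?n \<bullet> Comul F) m s
      = br m (app (Suc 0) 2 (?n \<bullet> Comul F) m s)"
    using assms nd app_comp[of "Braid C A A" 2 2 "?n \<bullet> Comul F" 1 s m] by simp
  moreover have "qq \<nu> m s = mu m (app (Suc 0) 2 (Braid C A A \<bullet> ?n \<bullet> Comul F) m s)"
    using assms bnd app_comp[of "Mul F" 2 1 "Braid C A A \<bullet> ?n \<bullet> Comul F" 1 s m]
    by (simp add: q_idem_def)
  ultimately show ?thesis by simp
qed

lemma br_qq:
  assumes "ok s" "m + 2 \<le> fst s"
  shows "br m (qq \<nu> m s) = qq \<nu> (Suc m) (br m s)" "br m (qq \<nu> (Suc m) s) = qq \<nu> m (br m s)"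
  using assms by (simp_all add: br_unary)

text \<open>In Sweedler notation, with \<open>c = c\<^sub>1 \<otimes> c\<^sub>2\<close>: \<open>c\<^sub>1 \<otimes> y c\<^sub>2 = c\<^sub>1 N(y) \<otimes> c\<^sub>2\<close>.\<close>

lemma cp_slide:
  assumes "ok s" "m + 1 \<le> fst s"
  shows "mu (Suc m) (br (Suc m) (cp m s)) = mu m (br (Suc m) (cp m (nk m s)))"
proof -
  have "mu (Suc m) (br (Suc m) (cp m s)) = mu (Suc m) (br m (cp (Suc m) s))"
    using assms by (simp add: br_cp)
  \<comment> \<open>The symmetry of c in the form c = N(c_2) \<otimes> c_1. Now y multiplies c_1,
    and \<open>dl_eq\<close> can carry it over to c_2.\<close>
  also have "cp (Suc m) s = nk (Suc m) (br (Suc m) (cp (Suc m) s))"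
    using assms by (simp add: cp_br nk_nk)
  also have "mu (Suc m) (br m \<dots>) = nk m (br m (mu m (cp (Suc m) s)))"
    using assms by (simp add: br_nk br_mu ic)
  also have "mu m (cp (Suc m) s) = mu (Suc m) (cp m s)"
    using assms by (simp flip: dl_eq)
  also have "nk m (br m \<dots>) = br m (mu (Suc m) (nk (Suc (Suc m)) (nk (Suc m) (cp m s))))"
    using assms by (simp add: nk_mu flip: br_nk)
  also have "nk (Suc m) (cp m s) = br m (cp m s)"
    using assms by (simp add: cp_br cp_nk)
  also have "br m (mu (Suc m) (nk (Suc (Suc m)) \<dots>)) = mu m (br (Suc m) (nk (Suc (Suc m)) (cp m s)))"
    using assms by (simp add: br_mu ic)
  also have "\<dots> = mu m (br (Suc m) (cp m (nk m s)))"
    using assms by (simp add: ic)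
  finally show ?thesis .
qed

text \<open>\<open>cp_slide\<close> multiplied by x from the left, since \<Delta>(x) = x c_1
  \<otimes> c_2. It reads x_1 \<otimes> y x_2 = x_1 N(y) \<otimes> x_2.\<close>

lemma dl_slide:
  assumes "ok s" "m + 2 \<le> fst s"
  shows "mu (Suc m) (br (Suc m) (dl m s)) = mu m (br (Suc m) (dl m (nk (Suc m) s)))"
proof -
  have "mu (Suc m) (br (Suc m) (dl m s))
      = mu m (mu (Suc (Suc m)) (br (Suc (Suc m)) (cp (Suc m) s)))"
    using assms by (simp add: dl_eq(1) ic)
  also have "\<dots> = mu m (mu (Suc m) (br (Suc (Suc m)) (cp (Suc m) (nk (Suc m) s))))"
    using assms by (simp add: cp_slide)
  also have "\<dots> = mu m (mu m (br (Suc (Suc m)) (cp (Suc m) (nk (Suc m) s))))"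
    using assms by (simp add: mu_assoc)
  also have "\<dots> = mu m (br (Suc m) (dl m (nk (Suc m) s)))"
    using assms by (simp add: dl_eq(1) ic)
  finally show ?thesis .
qed

text \<open>The image of \<open>q\<^sub>\<nu>\<close> is the \<open>N\<^sub>\<nu>\<close>-twisted centre: \<open>y z = z N\<^sub>\<nu>(y)\<close> for \<open>z\<close> in the image.\<close>

lemma mu_qq:
  assumes s: "ok s" "m + 2 \<le> fst s" and \<nu>: "sign \<nu>"
  shows "mu m (qq \<nu> (Suc m) s) = mu m (ns \<nu> (Suc m) (qq \<nu> m (br m s)))"
proof -
  have "mu m (qq \<nu> (Suc m) s) = mu m (mu (Suc m) (br (Suc m) (ns (- \<nu>) (Suc m) (dl (Suc m) s))))"
    using s by (simp add: qq_eq)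
  also have "\<dots> = mu m (mu m (br (Suc m) (ns (- \<nu>) (Suc m) (dl (Suc m) s))))"
    using s by (simp add: mu_assoc)
  also have "\<dots> = mu m (br m (mu (Suc m) (br m (ns (- \<nu>) (Suc m) (dl (Suc m) s)))))"
    using s by (simp add: br_mu)
  also have "\<dots> = mu m (br m (ns (- \<nu>) m (mu (Suc m) (br m (dl (Suc m) s)))))"
    using s by (simp add: br_ns ic)
  also have "br m (dl (Suc m) s) = br (Suc m) (dl m (br m s))"
    using s by (simp flip: br_dl)
  \<comment> \<open>The slide carries y from x_2 to x_1, the factor on which the twist in q_\<nu>
    acts.\<close>
  also have "mu (Suc m) (br (Suc m) (dl m (br m s)))
      = mu m (br (Suc m) (dl m (nk (Suc m) (br m s))))"
    using s by (simp add: dl_slide)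
  also have "mu m (br m (ns (- \<nu>) m \<dots>))
      = mu m (br m (mu m (br (Suc m) (ns (- \<nu>) (Suc (Suc m)) (ns (- \<nu>) m (dl m (nk (Suc m) (br m
          s))))))))"
    using s by (simp add: ns_mu br_ns ic)
  also have "\<dots>
      = mu m (mu (Suc m) (br m (ns (- \<nu>) (Suc (Suc m)) (ns (- \<nu>) m (dl m (nk (Suc m) (br m s)))))))"
    using s by (simp add: br_mu)
  also have "\<dots>
      = mu m (mu m (br m (ns (- \<nu>) (Suc (Suc m)) (ns (- \<nu>) m (dl m (nk (Suc m) (br m s)))))))"
    using s by (simp add: mu_assoc)
  also have "\<dots> = mu m (mu m (br m (ns (- \<nu>) m (dl m (ns (- \<nu>) (Suc m) (nk (Suc m) (br m s)))))))"
    using s by (simp add: ic)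
  \<comment> \<open>The slide has put N on y and multiplicativity has added N_{-\<nu>}; together
    they are N_\<nu>, for \<nu> = 1 by the involution.\<close>
  also have "ns (- \<nu>) (Suc m) (nk (Suc m) (br m s)) = ns \<nu> (Suc m) (br m s)"
    using s \<nu> by (auto simp: sign_def ns_eq nk_nk)
  also have "mu m (mu m (br m (ns (- \<nu>) m (dl m (ns \<nu> (Suc m) (br m s))))))
      = mu m (ns \<nu> (Suc m) (qq \<nu> m (br m s)))"
    using s by (simp add: qq_eq ic)
  finally show ?thesis .
qed

text \<open>Twisted centrality solved for the other order, q_\<nu>(x) y = N_\<nu>(y) q_\<nu>(x): put
  N_\<nu>(y) for y and use that N_\<nu> is its own inverse.\<close>

lemma mu_qq':
  assumes s: "ok s" "m + 2 \<le> fst s" and \<nu>: "sign \<nu>"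
  shows "mu m (br m (qq \<nu> (Suc m) s)) = mu m (qq \<nu> (Suc m) (ns \<nu> m s))"
proof -
  have "mu m (qq \<nu> (Suc m) (ns \<nu> m s)) = mu m (ns \<nu> (Suc m) (qq \<nu> m (br m (ns \<nu> m s))))"
    using s \<nu> by (simp add: mu_qq)
  also have "\<dots> = mu m (qq \<nu> m (ns \<nu> (Suc m) (ns \<nu> (Suc m) (br m s))))"
    using s by (simp add: br_ns ic)
  also have "\<dots> = mu m (br m (qq \<nu> (Suc m) s))"
    using s \<nu> by (auto simp: sign_def ns_eq nk_nk br_qq)
  finally show ?thesis ..
qed

text \<open>Let z be in the image of q_\<gamma>. Since \<Delta>(x z) = x_1 \<otimes> x_2 z, the left
  side is x_2 z N_{-\<beta>\<gamma>}(x_1). Centrality moves z to the right end and puts N_\<gamma>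
  on x_1; as N_\<gamma> N_{-\<beta>\<gamma>} = N_{-\<beta>}, what is left is q_\<beta>(x) z.\<close>

lemma qq_mu_right:
  assumes s: "ok s" "m + 2 \<le> fst s" and sgn: "sign \<beta>" "sign \<gamma>"
  shows "qq (\<beta> * \<gamma>) m (mu m (qq \<gamma> (Suc m) s)) = mu m (qq \<beta> m (qq \<gamma> (Suc m) s))"
proof -
  let ?n = "ns (- (\<beta> * \<gamma>))"
  have "qq (\<beta> * \<gamma>) m (mu m (qq \<gamma> (Suc m) s))
      = mu m (br m (?n m (mu (Suc m) (dl m (qq \<gamma> (Suc m) s)))))"
    using s by (simp add: qq_eq dl_mu(1))
  also have "\<dots> = mu m (br m (mu (Suc m) (qq \<gamma> (Suc (Suc m)) (?n m (dl m s)))))"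
    using s by (simp add: ic)
  also have "\<dots> = mu m (mu (Suc m) (br (Suc m) (qq \<gamma> (Suc (Suc m)) (br m (?n m (dl m s))))))"
    using s by (simp add: br_mu mu_assoc ic)
  also have "\<dots> = mu m (mu (Suc m) (qq \<gamma> (Suc (Suc m)) (ns \<gamma> (Suc m) (br m (?n m (dl m s))))))"
    using s sgn by (simp add: mu_qq')
  also have "ns \<gamma> (Suc m) (br m (?n m (dl m s))) = br m (ns \<gamma> m (?n m (dl m s)))"
    using s by (simp add: br_ns)
  also have "ns \<gamma> m (?n m (dl m s)) = ns (- \<beta>) m (dl m s)"
    using s sgn by (auto simp: sign_def ns_eq nk_nk)
  also have "mu m (mu (Suc m) (qq \<gamma> (Suc (Suc m)) (br m (ns (- \<beta>) m (dl m s)))))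
      = mu m (qq \<gamma> (Suc m) (mu m (br m (ns (- \<beta>) m (dl m s)))))"
    using s by (simp add: ic flip: mu_assoc)
  also have "\<dots> = mu m (qq \<beta> m (qq \<gamma> (Suc m) s))"
    using s by (simp add: ic flip: qq_eq)
  finally show ?thesis .
qed

text \<open>Let x be in the image of q_\<beta>. From \<Delta>(x z) = c_1 \<otimes> c_2 x z the left
  side is c_2 x z N_{-\<beta>\<gamma>}(c_1). Centrality of x rewrites c_2 x to x N_\<beta>(c_2), and
  N_\<beta> passes to the other leg of c, so x c_2 z N_{-\<gamma>}(c_1) = x q_\<gamma>(z)
  remains.\<close>

lemma qq_mu_left:
  assumes s: "ok s" "m + 2 \<le> fst s" and sgn: "sign \<beta>" "sign \<gamma>"
  shows "qq (\<beta> * \<gamma>) m (mu m (qq \<beta> m s)) = mu m (qq \<gamma> (Suc m) (qq \<beta> m s))"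
proof -
  let ?n = "ns (- (\<beta> * \<gamma>))" and ?n' = "ns (- \<gamma>)" and ?z = "qq \<beta> m s"
  have z: "ok ?z" "fst ?z = fst s"
    using s by simp_all
  have "qq (\<beta> * \<gamma>) m (mu m ?z) = mu m (br m (?n m (mu (Suc m) (cp m (mu m ?z)))))"
    using s z by (simp add: qq_eq dl_eq(2))
  also have "mu (Suc m) (cp m (mu m ?z)) = mu (Suc m) (mu (Suc m) (cp m ?z))"
    using s z by (simp add: ic mu_assoc)
  also have "mu (Suc m) (cp m ?z) = mu (Suc m) (qq \<beta> (Suc (Suc m)) (cp m s))"
    using s by (simp add: ic)
  also have "\<dots> = mu (Suc m) (br (Suc m) (ns \<beta> (Suc m) (qq \<beta> (Suc (Suc m)) (cp m s))))"
    using s sgn by (simp add: mu_qq br_qq br_ns)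
  also have "\<dots> = mu (Suc m) (br (Suc m) (qq \<beta> (Suc (Suc m)) (ns \<beta> (Suc m) (cp m s))))"
    using s by (simp add: ic)
  also have "ns \<beta> (Suc m) (cp m s) = ns \<beta> m (cp m s)"
    using s by (simp add: cp_ns)
  also have "?n m (mu (Suc m) (mu (Suc m) (br (Suc m) (qq \<beta> (Suc (Suc m)) (ns \<beta> m (cp m s))))))
      = mu (Suc m) (mu (Suc m) (br (Suc m) (qq \<beta> (Suc (Suc m)) (?n m (ns \<beta> m (cp m s))))))"
    using s by (simp add: ic)
  also have "?n m (ns \<beta> m (cp m s)) = ?n' m (cp m s)"
    using s sgn by (auto simp: sign_def ns_eq nk_nk)
  also have "mu (Suc m) (mu (Suc m) (br (Suc m) (qq \<beta> (Suc (Suc m)) (?n' m (cp m s)))))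
      = mu (Suc m) (mu (Suc (Suc m)) (br (Suc m) (qq \<beta> (Suc (Suc m)) (?n' m (cp m s)))))"
    using s by (simp add: mu_assoc)
  also have "mu m (br m \<dots>)
      = mu m (mu (Suc m) (br (Suc m) (br m (mu (Suc (Suc m)) (br (Suc m) (qq \<beta> (Suc (Suc m)) (?n' m
          (cp m s))))))))"
    using s by (simp add: br_mu mu_assoc)
  also have "br m (mu (Suc (Suc m)) (br (Suc m) (qq \<beta> (Suc (Suc m)) (?n' m (cp m s)))))
      = mu (Suc (Suc m)) (br m (br (Suc m) (qq \<beta> (Suc (Suc m)) (?n' m (cp m s)))))"
    using s by (simp add: ic)
  also have "\<dots> = mu (Suc (Suc m)) (qq \<beta> m (br m (br (Suc m) (?n' m (cp m s)))))"
    using s by (simp add: br_qq)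
  also have "br (Suc m) (?n' m (cp m s)) = ?n' m (br (Suc m) (cp m s))"
    using s by (simp add: ic)
  also have "br m \<dots> = ?n' (Suc m) (br m (br (Suc m) (cp m s)))"
    using s by (simp add: br_ns)
  \<comment> \<open>The cup crosses the strand of x as a whole, so that its legs stand next to z as
    in q_\<gamma>(z).\<close>
  also have "br m (br (Suc m) (cp m s)) = cp (Suc m) s"
    using s by (simp add: br_cp)
  also have "mu m (mu (Suc m) (br (Suc m) (mu (Suc (Suc m)) (qq \<beta> m (?n' (Suc m) (cp (Suc m) s))))))
      = mu m (mu (Suc m) (br (Suc m) (?n' (Suc m) (mu (Suc (Suc m)) (cp (Suc m) ?z)))))"
    using s by (simp add: ic)
  also have "mu (Suc (Suc m)) (cp (Suc m) ?z) = dl (Suc m) ?z"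
    using s z by (simp add: dl_eq(2))
  also have "mu m (mu (Suc m) (br (Suc m) (?n' (Suc m) \<dots>))) = mu m (qq \<gamma> (Suc m) ?z)"
    using s by (simp add: qq_eq)
  finally show ?thesis .
qed

text \<open>Write q_\<nu>(y) = c_2 y N_{-\<nu>}(c_1). Invariance and a flip of b turn b(x,
  q_\<nu>(y)) into b(N N_{-\<nu>}(c_1) x c_2, y), and the symmetry of c under swapping its legs
  rewrites the first argument to c_2 x N_{-\<nu>}(c_1) = q_\<nu>(x).\<close>

lemma pr_qq:
  assumes s: "ok s" "m + 2 \<le> fst s" and \<nu>: "sign \<nu>"
  shows "pr m (qq \<nu> (Suc m) s) = pr m (qq \<nu> m s)"
proof -
  let ?n = "ns (- \<nu>)"
  have pr: "pr m t = pr m (nk m (br m t))" if "ok t" "m + 2 \<le> fst t" for t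
    using that by (simp add: pr_nk_left)
  have "pr m (qq \<nu> (Suc m) s) = pr m (mu m (br (Suc m) (?n (Suc m) (dl (Suc m) s))))"
    using s by (simp add: qq_eq pr_mu)
  also have "\<dots> = pr m (nk m (br m (mu m (br (Suc m) (?n (Suc m) (dl (Suc m) s))))))"
    using s by (subst pr) simp_all
  also have "\<dots> = pr m (mu (Suc m) (nk m (?n m (br m (dl (Suc m) s)))))"
    using s by (simp add: br_mu br_ns ic)
  also have "\<dots> = pr m (mu m (nk m (?n m (br m (mu (Suc (Suc m)) (cp (Suc m) s))))))"
    using s by (simp add: pr_mu dl_eq(2))
  also have "\<dots> = pr m (mu m (mu (Suc (Suc m)) (nk m (?n m (br m (cp (Suc m) s))))))"
    using s by (simp add: ic)
  also have "\<dots> = pr m (mu (Suc m) (mu m (nk m (?n m (br m (cp (Suc m) s))))))"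
    using s by (simp add: ic)
  also have "\<dots> = pr m (mu m (mu m (nk m (?n m (br (Suc m) (cp m s))))))"
    using s by (simp add: pr_mu br_cp)
  also have "\<dots> = pr m (mu m (mu m (br (Suc m) (nk m (?n m (cp m s))))))"
    using s by (simp add: ic)
  also have "nk m (?n m (cp m s)) = br m (?n m (cp m s))"
    using s \<nu> by (auto simp: sign_def ns_eq cp_br cp_nk cp_nk_nk nk_nk br_nk)
  also have "pr m (mu m (mu m (br (Suc m) (br m (?n m (cp m s))))))
      = pr m (mu m (br m (mu (Suc m) (?n m (cp m s)))))"
    using s by (simp add: br_mu)
  also have "\<dots> = pr m (qq \<nu> m s)"
    using s by (simp add: qq_eq dl_eq(2) ic)
  finally show ?thesis .
qed

text \<open>Self-adjointness for c in place of b, obtained by bending strands with a second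
  cup.\<close>

lemma cp_qq:
  assumes s: "ok s" "m \<le> fst s" and \<nu>: "sign \<nu>"
  shows "qq \<nu> (Suc m) (cp m s) = qq \<nu> m (cp m s)"
proof -
  have "qq \<nu> (Suc m) (cp m s) = pr (Suc m) (cp (Suc (Suc m)) (qq \<nu> (Suc m) (cp m s)))"
    using s by (simp add: snake)
  also have "\<dots> = pr (Suc m) (qq \<nu> (Suc m) (cp (Suc (Suc m)) (cp m s)))"
    using s by (simp add: ic)
  also have "\<dots> = pr (Suc m) (qq \<nu> (Suc (Suc m)) (cp (Suc (Suc m)) (cp m s)))"
    using s \<nu> by (simp add: pr_qq)
  also have "cp (Suc (Suc m)) (cp m s) = cp m (cp m s)"
    using s ic[of c 0 2 c 0 2 s m m] by simp
  also have "qq \<nu> (Suc (Suc m)) \<dots> = cp m (qq \<nu> m (cp m s))"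
    using s by (simp add: ic)
  also have "pr (Suc m) \<dots> = qq \<nu> m (cp m s)"
    using s by (simp add: snake)
  finally show ?thesis .
qed

text \<open>N is multiplicative and N \<otimes> N fixes c, so N(x) c_1 \<otimes> c_2 equals N(x c_1)
  \<otimes> N(c_2).\<close>

lemma dl_nk:
  assumes "ok s" "m + 1 \<le> fst s"
  shows "dl m (nk m s) = nk (Suc m) (nk m (dl m s))"
proof -
  have "dl m (nk m s) = mu m (nk m (cp (Suc m) s))"
    using assms by (simp add: dl_eq(1) ic)
  also have "\<dots> = mu m (nk m (nk (Suc (Suc m)) (nk (Suc m) (cp (Suc m) s))))"
    using assms by (simp add: cp_nk_nk)
  also have "\<dots> = nk (Suc m) (nk m (dl m s))"
    using assms by (simp add: dl_eq(1) nk_mu ic)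
  finally show ?thesis .
qed

lemma nk_qq:
  assumes "ok s" "m + 1 \<le> fst s" "sign \<nu>"
  shows "nk m (qq \<nu> m s) = qq \<nu> m (nk m s)"
  using assms by (auto simp: sign_def qq_eq nk_mu br_nk dl_nk ns_eq ic)

text \<open>Elements z in the image of q_1 are central without twist, so b(y, N z) = b(z, y) = b(y,
  z), and nondegeneracy gives N z = z. This is why N^Z is the identity on Z_+.\<close>

lemma nk_qq_1:
  assumes "ok s" "m + 1 \<le> fst s"
  shows "nk m (qq 1 m s) = qq 1 m s"
proof -
  have "nk m (qq 1 m s) = pr (Suc m) (cp m (nk m (qq 1 m s)))"
    using assms by (simp add: snake)
  also have "\<dots> = pr (Suc m) (nk (Suc (Suc m)) (qq 1 (Suc (Suc m)) (cp m s)))"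
    using assms by (simp add: ic)
  also have "\<dots> = pr (Suc m) (br (Suc m) (qq 1 (Suc (Suc m)) (cp m s)))"
    using assms by (simp add: pr_nk_right)
  also have "\<dots> = pr (Suc m) (qq 1 (Suc (Suc m)) (cp m s))"
    using assms by (simp add: sign_def pr_eq mu_qq' ns_eq)
  also have "\<dots> = pr (Suc m) (cp m (qq 1 m s))"
    using assms by (simp add: ic)
  finally show ?thesis
    using assms by (simp add: snake)
qed

end

section \<open>Units, idempotence and comultiplication in the separable case\<close>

locale separable_frobenius_object = involutive_frobenius_object +
  assumes separable: "delta_separable C F"
begin

abbreviation q where "q \<equiv> q_idem C F"

lemma mu_cp:
  assumes "ok s" "m \<le> fst s"
  shows "mu m (cp m s) = eta m s"
  using assms separable app_comp[of "Mul F" 2 1 c 0 s m] by (simp add: delta_separable_def)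

text \<open>The symmetry of c gives q_1(1) = c_2 N(c_1) = c_1 c_2, which is 1 by
  separability.\<close>

lemma qq_eta:
  assumes "ok s" "m \<le> fst s"
  shows "qq 1 m (eta m s) = eta m s"
proof -
  have "qq 1 m (eta m s) = mu m (br m (nk m (cp m s)))"
    using assms by (simp add: qq_eq ns_eq flip: cp_eq)
  also have "\<dots> = mu m (cp m s)"
    using assms by (simp flip: cp_br)
  finally show ?thesis
    using assms by (simp add: mu_cp)
qed

lemma ep_qq:
  assumes "ok s" "m + 1 \<le> fst s"
  shows "ep m (qq 1 m s) = ep m s"
proof -
  have "ep m (qq 1 m s) = pr m (qq 1 (Suc m) (eta m s))"
    using assms ic[of "Unit F" 0 1 "q_idem C F 1" 1 1 s m m] by (simp flip: pr_eta)
  also have "\<dots> = ep m s"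
    using assms by (simp add: sign_def pr_qq qq_eta pr_eta)
  finally show ?thesis .
qed

text \<open>Absorption with the unit as right factor: q_\<nu>(q_\<nu>(x) 1) = q_\<nu>(x)
  q_1(1).\<close>

lemma qq_qq:
  assumes "ok s" "m + 1 \<le> fst s" "sign \<nu>"
  shows "qq \<nu> m (qq \<nu> m s) = qq \<nu> m s"
proof -
  have "qq (\<nu> * 1) m (mu m (qq \<nu> m (eta (Suc m) s))) = mu m (qq 1 (Suc m) (qq \<nu> m (eta (Suc m) s)))"
    using assms by (intro qq_mu_left) (auto simp: sign_def)
  also have "qq \<nu> m (eta (Suc m) s) = eta (Suc m) (qq \<nu> m s)"
    using assms by (simp add: ic)
  finally show ?thesis
    using assms by (simp add: qq_eta mu_eta)
qed

text \<open>In \<Delta>(t) = t c_1 \<otimes> c_2 self-adjointness moves q_\<beta> from c_2 to c_1.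
  Because \<alpha> = (\<alpha>\<beta>)\<beta>, absorption then replaces q_\<alpha> of the product by
  q_{\<alpha>\<beta>}(t) q_\<beta>(c_1), which depends on t only through
  q_{\<alpha>\<beta>}(t).\<close>

lemma dl_qq:
  assumes s: "ok s" "m + 1 \<le> fst s" and sgn: "sign \<alpha>" "sign \<beta>"
  shows "qq \<beta> (Suc m) (qq \<alpha> m (dl m (qq (\<alpha> * \<beta>) m s))) = qq \<beta> (Suc m) (qq \<alpha> m (dl m s))"
proof -
  have *: "qq \<beta> (Suc m) (qq \<alpha> m (dl m t)) = mu m (qq (\<alpha> * \<beta>) m (qq \<beta> (Suc m) (cp (Suc m) t)))"
    if t: "ok t" "m + 1 \<le> fst t" for t
  proof -
    have "qq \<beta> (Suc m) (qq \<alpha> m (dl m t)) = qq \<alpha> m (mu m (qq \<beta> (Suc (Suc m)) (cp (Suc m) t)))"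
      using t by (simp add: dl_eq(1) ic)
    also have "\<dots> = qq (\<alpha> * \<beta> * \<beta>) m (mu m (qq \<beta> (Suc m) (cp (Suc m) t)))"
      using t sgn by (auto simp: sign_def cp_qq)
    also have "\<dots> = mu m (qq (\<alpha> * \<beta>) m (qq \<beta> (Suc m) (cp (Suc m) t)))"
      using t sgn by (intro qq_mu_right sign_mult) simp_all
    finally show ?thesis .
  qed
  have "sign (\<alpha> * \<beta>)"
    using sgn by (rule sign_mult)
  then show ?thesis
    using s by (simp add: * qq_qq ic)
qed

section \<open>From strands back to equations of morphisms\<close>

lemma tensor_factor:
  assumes "g \<in> Hom C A A" "h \<in> Hom C A A"
  shows "(Id C A \<boxtimes> h) \<bullet> (g \<boxtimes> Id C A) = g \<boxtimes> h" "(g \<boxtimes> Id C A) \<bullet> (Id C A \<boxtimes> h) = g \<boxtimes> h"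
  using interchange[OF assms(1) id_hom id_hom assms(2)] interchange[OF id_hom assms(1) assms(2)
      id_hom]
    comp_id_left[OF assms(1)] comp_id_right[OF assms(1)] comp_id_left[OF assms(2)]
        comp_id_right[OF assms(2)]
  by simp_all

lemma tensor_A_hom [simp]:
  assumes "g \<in> Hom C A A" "h \<in> Hom C A A"
  shows "g \<boxtimes> h \<in> Hom C (A \<odot> A) (A \<odot> A)"
  using assms by (rule tensor_hom)

lemma Id_A_hom [simp]: "Id C A \<in> Hom C A A"
  by (simp add: id_hom)

lemma ok_Id_2 [simp]: "ok (2, Id C (A \<odot> A))"
  using ok_Id[of 2] by simp

lemma ok_Id_1 [simp]: "ok (Suc 0, Id C A)"
  using ok_Id[of "Suc 0"] by simp

lemma q_mu_right:
  assumes "sign \<beta>" "sign \<gamma>"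
  shows "q (\<beta> * \<gamma>) \<bullet> Mul F \<bullet> (Id C A \<boxtimes> q \<gamma>) = Mul F \<bullet> (q \<beta> \<boxtimes> q \<gamma>)"
  using qq_mu_right[of "(2, Id C (A \<odot> A))" 0, OF _ _ assms]
  by (simp add: app_whisker app_exact tensor_factor comp_id_right[OF tensor_A_hom])

lemma q_mu_left:
  assumes "sign \<beta>" "sign \<gamma>"
  shows "q (\<beta> * \<gamma>) \<bullet> Mul F \<bullet> (q \<beta> \<boxtimes> Id C A) = Mul F \<bullet> (q \<beta> \<boxtimes> q \<gamma>)"
  using qq_mu_left[of "(2, Id C (A \<odot> A))" 0, OF _ _ assms]
  by (simp add: app_whisker app_exact tensor_factor comp_id_right[OF tensor_A_hom])

lemma dl_q:
  assumes "sign \<alpha>" "sign \<beta>"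
  shows "(q \<alpha> \<boxtimes> q \<beta>) \<bullet> Comul F \<bullet> q (\<alpha> * \<beta>) = (q \<alpha> \<boxtimes> q \<beta>) \<bullet> Comul F"
proof -
  have a: "(Id C A \<boxtimes> q \<beta>) \<bullet> (q \<alpha> \<boxtimes> Id C A) \<bullet> f = (q \<alpha> \<boxtimes> q \<beta>) \<bullet> f"
    if "f \<in> Hom C A (A \<odot> A)" for f
    using comp_assoc[OF that tensor_A_hom tensor_A_hom, of "q \<alpha>" "Id C A" "Id C A" "q \<beta>"]
    by (simp add: tensor_factor)
  have f: "Comul F \<bullet> q (\<alpha> * \<beta>) \<in> Hom C A (A \<odot> A)"
    by (rule comp_hom[OF q_hom structure_hom(3)])
  show ?thesis
    using dl_qq[of "(1, Id C A)" 0, OF _ _ assms]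
    by (simp add: app_whisker app_exact comp_id_right[OF q_hom]
        comp_id_right[OF structure_hom(3)] a f)
qed

lemma q_eta: "q 1 \<bullet> Unit F = Unit F"
  using qq_eta[of "(0, Id C (TUnit C))" 0] ok_Id[of 0]
  by (simp add: app_exact comp_id_right[OF structure_hom(2)])

lemma ep_q: "Counit F \<bullet> q 1 = Counit F"
  using ep_qq[of "(1, Id C A)" 0]
  by (simp add: app_exact comp_id_right[OF q_hom] comp_id_right[OF structure_hom(4)])

lemma N_q:
  assumes "sign \<nu>"
  shows "N \<bullet> q \<nu> = q \<nu> \<bullet> N"
  using nk_qq[of "(1, Id C A)" 0 \<nu>] assms
  by (simp add: app_exact comp_id_right[OF q_hom] comp_id_right[OF N_hom])

lemma N_q_1: "N \<bullet> q 1 = q 1"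
  using nk_qq_1[of "(1, Id C A)" 0]
  by (simp add: app_exact comp_id_right[OF q_hom])

text \<open>N fixes the image of q_1, so a twist can matter only when both signs are -1.\<close>

lemma ns_qq:
  assumes "ok s" "m + 1 \<le> fst s" and "sign \<alpha>" "sign \<beta>"
  shows "ns \<beta> m (qq \<alpha> m s) = ns (if \<alpha> = -1 \<and> \<beta> = -1 then -1 else 1) m (qq \<alpha> m s)"
  using assms by (auto simp: sign_def ns_eq nk_qq_1)

text \<open>Either factor can play the central one: centrality of the second puts N_\<beta> on the
  first, centrality of the first puts N_\<alpha> on the second. By \<open>ns_qq\<close> both twists
  are N_\<gamma>.\<close>

lemma mu_br_qq:
  assumes s: "ok s" "m + 2 \<le> fst s" and sgn: "sign \<alpha>" "sign \<beta>"
    and \<gamma>: "\<gamma> = (if \<alpha> = -1 \<and> \<beta> = -1 then -1 else 1)"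
  shows "mu m (br m (qq \<beta> (Suc m) (qq \<alpha> m s))) = mu m (ns \<gamma> m (qq \<beta> (Suc m) (qq \<alpha> m s)))"
    "mu m (br m (qq \<beta> (Suc m) (qq \<alpha> m s))) = mu m (ns \<gamma> (Suc m) (qq \<beta> (Suc m) (qq \<alpha> m s)))"
proof -
  have "mu m (br m (qq \<beta> (Suc m) (qq \<alpha> m s))) = mu m (qq \<beta> (Suc m) (ns \<beta> m (qq \<alpha> m s)))"
    using s sgn by (simp add: mu_qq')
  also have "ns \<beta> m (qq \<alpha> m s) = ns \<gamma> m (qq \<alpha> m s)"
    unfolding \<gamma> using s sgn by (intro ns_qq) simp_all
  also have "qq \<beta> (Suc m) (ns \<gamma> m (qq \<alpha> m s)) = ns \<gamma> m (qq \<beta> (Suc m) (qq \<alpha> m s))"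
    using s by (simp add: ic)
  finally show "mu m (br m (qq \<beta> (Suc m) (qq \<alpha> m s))) = mu m (ns \<gamma> m (qq \<beta> (Suc m) (qq \<alpha> m s)))" .
  have swap: "qq \<beta> (Suc m) (qq \<alpha> m s) = qq \<alpha> m (qq \<beta> (Suc m) s)"
    using s by (simp add: ic)
  have "mu m (br m (qq \<alpha> m (qq \<beta> (Suc m) s))) = mu m (qq \<alpha> (Suc m) (br m (qq \<beta> (Suc m) s)))"
    using s by (simp add: br_qq)
  also have "\<dots> = mu m (ns \<alpha> (Suc m) (qq \<alpha> m (qq \<beta> (Suc m) s)))"
    using s sgn by (simp add: mu_qq)
  also have "\<dots> = mu m (ns \<alpha> (Suc m) (qq \<beta> (Suc m) (qq \<alpha> m s)))"
    by (simp only: swap)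
  also have "ns \<alpha> (Suc m) (qq \<beta> (Suc m) (qq \<alpha> m s)) = ns \<gamma> (Suc m) (qq \<beta> (Suc m) (qq \<alpha> m s))"
    unfolding \<gamma> using s sgn ns_qq[of "qq \<alpha> m s" "Suc m" \<beta> \<alpha>] by (simp add: conj_commute)
  finally show "mu m (br m (qq \<beta> (Suc m) (qq \<alpha> m s)))
      = mu m (ns \<gamma> (Suc m) (qq \<beta> (Suc m) (qq \<alpha> m s)))"
    by (simp only: swap)
qed

lemma q_commute:
  assumes "sign \<alpha>" "sign \<beta>" and "\<gamma> = (if \<alpha> = -1 \<and> \<beta> = -1 then -1 else 1)"
  shows "Mul F \<bullet> Braid C A A \<bullet> (q \<alpha> \<boxtimes> q \<beta>)
      = Mul F \<bullet> (signed C A N \<gamma> \<boxtimes> Id C A) \<bullet> (q \<alpha> \<boxtimes> q \<beta>)"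
    "Mul F \<bullet> Braid C A A \<bullet> (q \<alpha> \<boxtimes> q \<beta>)
      = Mul F \<bullet> (Id C A \<boxtimes> signed C A N \<gamma>) \<bullet> (q \<alpha> \<boxtimes> q \<beta>)"
  using mu_br_qq[of "(2, Id C (A \<odot> A))" 0, OF _ _ assms]
  by (simp_all add: app_whisker app_exact tensor_factor comp_id_right[OF tensor_A_hom])

end

section \<open>Domains, codomains and zero morphisms\<close>

context category
begin

text \<open>Domains and codomains as functions turn the typing conditions of the axioms into equations,
  which the simplifier can solve.\<close>

definition arr :: "'m \<Rightarrow> bool" where "arr f \<longleftrightarrow> (\<exists>X Y. f \<in> Hom C X Y)"
definition src :: "'m \<Rightarrow> 'o" where "src f = (THE X. \<exists>Y. f \<in> Hom C X Y)"
definition tgt :: "'m \<Rightarrow> 'o" where "tgt f = (THE Y. \<exists>X. f \<in> Hom C X Y)"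

lemma hom_iff: "f \<in> Hom C X Y \<longleftrightarrow> arr f \<and> src f = X \<and> tgt f = Y"
proof -
  have "src f = X \<and> tgt f = Y" if f: "f \<in> Hom C X Y" for X Y
    unfolding src_def tgt_def by (intro conjI the_equality) (use f hom_disjoint in blast)+
  then show ?thesis
    unfolding arr_def by blast
qed

lemma homD:
  assumes "f \<in> Hom C X Y"
  shows "arr f" "src f = X" "tgt f = Y"
  using assms by (simp_all add: hom_iff)

lemma arr_hom: "arr f \<Longrightarrow> f \<in> Hom C (src f) (tgt f)"
  by (simp add: hom_iff)

lemma arr_obj [simp]: "arr f \<Longrightarrow> src f \<in> Obj C" "arr f \<Longrightarrow> tgt f \<in> Obj C"
  using hom_obj[OF arr_hom] by auto

lemma id_typing [simp]:
  assumes "X \<in> Obj C"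
  shows "arr (Id C X)" "src (Id C X) = X" "tgt (Id C X) = X"
  using homD[OF id_hom[OF assms]] .

lemma comp_typing [simp]:
  assumes "arr f" "arr g" "tgt f = src g"
  shows "arr (g \<bullet> f)" "src (g \<bullet> f) = src f" "tgt (g \<bullet> f) = tgt g"
  using assms homD[OF comp_hom[OF arr_hom[OF assms(1)], of g "tgt g"]] by (simp_all add: hom_iff)

lemma comp_assoc' [simp]:
  assumes "arr f" "arr g" "arr h" "tgt f = src g" "tgt g = src h"
  shows "(h \<bullet> g) \<bullet> f = h \<bullet> g \<bullet> f"
  using assms by (intro comp_assoc[of f "src f" "tgt f" g "tgt g" h "tgt h"])
      (simp_all add: hom_iff)

lemma comp_id [simp]:
  assumes "arr f"
  shows "tgt f = X \<Longrightarrow> Id C X \<bullet> f = f" "src f = X \<Longrightarrow> f \<bullet> Id C X = f"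
  using comp_id_left[OF arr_hom[OF assms]] comp_id_right[OF arr_hom[OF assms]] by auto

text \<open>Composites are kept nested to the right, so the side of a law is no longer a subterm
  once another factor h follows it. This form of the law applies there.\<close>

lemma comp_cong:
  assumes "g \<bullet> f = g' \<bullet> f'" "arr h" "arr f" "arr g" "arr f'" "arr g'"
    and "tgt h = src f" "tgt f = src g" "tgt h = src f'" "tgt f' = src g'"
  shows "g \<bullet> f \<bullet> h = g' \<bullet> f' \<bullet> h"
  using assms comp_assoc'[of h f g] comp_assoc'[of h f' g'] by simp

end

context strict_monoidal_category
begin

lemma tensor_typing [simp]:
  assumes "arr f" "arr g"
  shows "arr (f \<boxtimes> g)" "src (f \<boxtimes> g) = src f \<odot> src g" "tgt (f \<boxtimes> g) = tgt f \<odot> tgt g"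
  using homD[OF tensor_hom[OF arr_hom arr_hom]] assms by auto

lemma tensor_obj_simps [simp]:
  "TUnit C \<in> Obj C"
  "X \<in> Obj C \<Longrightarrow> TUnit C \<odot> X = X" "X \<in> Obj C \<Longrightarrow> X \<odot> TUnit C = X"
  "X \<in> Obj C \<Longrightarrow> Y \<in> Obj C \<Longrightarrow> X \<odot> Y \<in> Obj C"
  "X \<in> Obj C \<Longrightarrow> Y \<in> Obj C \<Longrightarrow> W \<in> Obj C \<Longrightarrow> (X \<odot> Y) \<odot> W = X \<odot> (Y \<odot> W)"
  by (auto simp: tunit_obj tensor_obj_unit tensor_obj tensor_obj_assoc)

lemma tensor_comp:
  assumes "arr f" "arr g" "arr f'" "arr g'" "tgt f = src g" "tgt f' = src g'"
  shows "(g \<boxtimes> g') \<bullet> (f \<boxtimes> f') = (g \<bullet> f) \<boxtimes> (g' \<bullet> f')"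
  using assms
  by (intro interchange[symmetric, of f "src f" "tgt f" g "tgt g" f' "src f'" "tgt f'" g' "tgt g'"])
    (simp_all add: hom_iff)

lemma tensor_comp':
  assumes "arr f" "arr g" "arr f'" "arr g'" "tgt f = src g" "tgt f' = src g'"
    and "arr h" "tgt h = src f \<odot> src f'"
  shows "(g \<boxtimes> g') \<bullet> (f \<boxtimes> f') \<bullet> h = ((g \<bullet> f) \<boxtimes> (g' \<bullet> f')) \<bullet> h"
  using assms tensor_comp[OF assms(1-6)] comp_assoc'[of h "f \<boxtimes> f'" "g \<boxtimes> g'"] by simp

lemma tensor_assoc':
  "arr f \<Longrightarrow> arr g \<Longrightarrow> arr h \<Longrightarrow> (f \<boxtimes> g) \<boxtimes> h = f \<boxtimes> (g \<boxtimes> h)"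
  by (rule tensor_assoc) (auto intro: arr_hom)

lemma tensor_unit' [simp]:
  "arr f \<Longrightarrow> Id C (TUnit C) \<boxtimes> f = f" "arr f \<Longrightarrow> f \<boxtimes> Id C (TUnit C) = f"
  using tensor_unit[OF arr_hom] by auto

lemma tensor_id' [simp]: "X \<in> Obj C \<Longrightarrow> Y \<in> Obj C \<Longrightarrow> Id C X \<boxtimes> Id C Y = Id C (X \<odot> Y)"
  by (rule tensor_id)

end

context preadditive_category
begin

lemma zero_hom [simp]: "X \<in> Obj C \<Longrightarrow> Y \<in> Obj C \<Longrightarrow> ZeroMor C X Y \<in> Hom C X Y"
  using hom_comm_group[of X Y] comm_groupE(2)[of "hom_group C X Y"] by (simp add: hom_group_def)

lemma zero_typing [simp]:
  assumes "X \<in> Obj C" "Y \<in> Obj C"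
  shows "arr (ZeroMor C X Y)" "src (ZeroMor C X Y) = X" "tgt (ZeroMor C X Y) = Y"
  using homD[OF zero_hom[OF assms]] .

lemma add_hom: "f \<in> Hom C X Y \<Longrightarrow> g \<in> Hom C X Y \<Longrightarrow> f \<boxplus> g \<in> Hom C X Y"
  using hom_obj[of f X Y] hom_comm_group[of X Y] comm_groupE(1)[of "hom_group C X Y" f g]
  by (simp add: hom_group_def)

lemma add_typing [simp]:
  assumes "arr f" "arr g" "src f = src g" "tgt f = tgt g"
  shows "arr (f \<boxplus> g)" "src (f \<boxplus> g) = src g" "tgt (f \<boxplus> g) = tgt g"
  using assms homD[OF add_hom[of f "src g" "tgt g" g]] by (simp_all add: hom_iff)

lemma add_zero [simp]:
  assumes "arr f" "src f = X" "tgt f = Y"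
  shows "ZeroMor C X Y \<boxplus> f = f" "f \<boxplus> ZeroMor C X Y = f"
proof -
  interpret G: comm_group "hom_group C X Y"
    using assms by (intro hom_comm_group) auto
  have "f \<in> carrier (hom_group C X Y)"
    using assms by (simp add: hom_group_def hom_iff)
  from G.l_one[OF this] G.r_one[OF this]
  show "ZeroMor C X Y \<boxplus> f = f" "f \<boxplus> ZeroMor C X Y = f"
    by (simp_all add: hom_group_def)
qed

text \<open>In a group only the neutral element is its own double; biadditivity supplies this for
  composites and tensor products with zero.\<close>

lemma add_self_zero:
  assumes "f \<in> Hom C X Y" "f \<boxplus> f = f"
  shows "f = ZeroMor C X Y"
proof -
  interpret G: comm_group "hom_group C X Y"
    using assms(1) hom_obj by (intro hom_comm_group) auto
  have "f \<in> carrier (hom_group C X Y)"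
    using assms by (simp add: hom_group_def)
  from G.l_cancel_one'[OF this this] show ?thesis
    using assms(2) by (simp add: hom_group_def)
qed

lemma add_comp [simp]:
  assumes "arr f" "arr g" "arr h"
  shows "src f = src g \<Longrightarrow> tgt f = tgt g \<Longrightarrow> tgt h = src g \<Longrightarrow> (f \<boxplus> g) \<bullet> h = (f \<bullet> h) \<boxplus> (g \<bullet> h)"
    "src f = src g \<Longrightarrow> tgt f = tgt g \<Longrightarrow> tgt f = src h \<Longrightarrow> h \<bullet> (f \<boxplus> g) = (h \<bullet> f) \<boxplus> (h \<bullet> g)"
  using assms by (auto intro!: comp_add_left comp_add_right simp: hom_iff)

lemma zero_comp [simp]:
  assumes "arr f"
  shows "tgt f = X \<Longrightarrow> Y \<in> Obj C \<Longrightarrow> ZeroMor C X Y \<bullet> f = ZeroMor C (src f) Y"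
    "src f = X \<Longrightarrow> Y \<in> Obj C \<Longrightarrow> f \<bullet> ZeroMor C Y X = ZeroMor C Y (tgt f)"
proof -
  show "ZeroMor C X Y \<bullet> f = ZeroMor C (src f) Y" if "tgt f = X" "Y \<in> Obj C"
  proof (rule add_self_zero)
    let ?z = "ZeroMor C X Y"
    have X: "X \<in> Obj C" using assms that arr_obj by blast
    show "?z \<bullet> f \<in> Hom C (src f) Y" using assms that X by (simp add: hom_iff)
    show "(?z \<bullet> f) \<boxplus> (?z \<bullet> f) = ?z \<bullet> f"
      using assms that X add_comp(1)[of ?z ?z f] by simp
  qed
  show "f \<bullet> ZeroMor C Y X = ZeroMor C Y (tgt f)" if "src f = X" "Y \<in> Obj C"
  proof (rule add_self_zero)
    let ?z = "ZeroMor C Y X"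
    have X: "X \<in> Obj C" using assms that arr_obj by blast
    show "f \<bullet> ?z \<in> Hom C Y (tgt f)" using assms that X by (simp add: hom_iff)
    show "(f \<bullet> ?z) \<boxplus> (f \<bullet> ?z) = f \<bullet> ?z"
      using assms that X add_comp(2)[of ?z ?z f] by simp
  qed
qed

end

context additive_symmetric_strict_monoidal_category
begin

lemma add_tensor [simp]:
  assumes "arr f" "arr g" "arr h" "src f = src g" "tgt f = tgt g"
  shows "(f \<boxplus> g) \<boxtimes> h = (f \<boxtimes> h) \<boxplus> (g \<boxtimes> h)" "h \<boxtimes> (f \<boxplus> g) = (h \<boxtimes> f) \<boxplus> (h \<boxtimes> g)"
  using assms by (auto intro!: tensor_add_left tensor_add_right simp: hom_iff)

lemma zero_tensor [simp]:
  assumes "arr f" "X \<in> Obj C" "Y \<in> Obj C"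
  shows "ZeroMor C X Y \<boxtimes> f = ZeroMor C (X \<odot> src f) (Y \<odot> tgt f)"
    "f \<boxtimes> ZeroMor C X Y = ZeroMor C (src f \<odot> X) (tgt f \<odot> Y)"
proof -
  let ?z = "ZeroMor C X Y"
  have z: "?z \<boxplus> ?z = ?z" using assms by simp
  show "?z \<boxtimes> f = ZeroMor C (X \<odot> src f) (Y \<odot> tgt f)"
  proof (rule add_self_zero)
    show "(?z \<boxtimes> f) \<boxplus> (?z \<boxtimes> f) = ?z \<boxtimes> f"
      using assms add_tensor(1)[of ?z ?z f] z by simp
  qed (use assms in \<open>auto simp: hom_iff\<close>)
  show "f \<boxtimes> ?z = ZeroMor C (src f \<odot> X) (tgt f \<odot> Y)"
  proof (rule add_self_zero)
    show "(f \<boxtimes> ?z) \<boxplus> (f \<boxtimes> ?z) = f \<boxtimes> ?z"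
      using assms add_tensor(2)[of ?z ?z f] z by simp
  qed (use assms in \<open>auto simp: hom_iff\<close>)
qed

end

section \<open>The homogeneous components of the operations\<close>

locale split_frobenius_object =
  additive_symmetric_strict_monoidal_category C + separable_frobenius_object C F
  for C :: "('o, 'm) cat_data" (structure) and F :: "('o, 'm) frobenius_data" +
  fixes Zc :: "int \<Rightarrow> 'o" and \<iota> \<pi> :: "int \<Rightarrow> 'm"
  assumes split: "sign \<nu> \<Longrightarrow> splitting C (Car F) (q_idem C F \<nu>) (Zc \<nu>) (\<iota> \<nu>) (\<pi> \<nu>)"
begin

lemma structure_typing [simp]:
  "arr (Mul F)" "src (Mul F) = A \<odot> A" "tgt (Mul F) = A"
  "arr (Unit F)" "src (Unit F) = TUnit C" "tgt (Unit F) = A"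
  "arr (Comul F)" "src (Comul F) = A" "tgt (Comul F) = A \<odot> A"
  "arr (Counit F)" "src (Counit F) = A" "tgt (Counit F) = TUnit C"
  "arr N" "src N = A" "tgt N = A"
  "arr (q \<nu>)" "src (q \<nu>) = A" "tgt (q \<nu>) = A"
  using structure_hom N_hom q_hom by (simp_all add: hom_iff)

lemma splitting_typing [simp]:
  assumes "sign \<nu>"
  shows "arr (\<iota> \<nu>)" "src (\<iota> \<nu>) = Zc \<nu>" "tgt (\<iota> \<nu>) = A"
    "arr (\<pi> \<nu>)" "src (\<pi> \<nu>) = A" "tgt (\<pi> \<nu>) = Zc \<nu>" "Zc \<nu> \<in> Obj C"
proof -
  have "\<iota> \<nu> \<in> Hom C (Zc \<nu>) A" "\<pi> \<nu> \<in> Hom C A (Zc \<nu>)"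
    using split[OF assms] by (simp_all add: splitting_def)
  then show "arr (\<iota> \<nu>)" "src (\<iota> \<nu>) = Zc \<nu>" "tgt (\<iota> \<nu>) = A"
    "arr (\<pi> \<nu>)" "src (\<pi> \<nu>) = A" "tgt (\<pi> \<nu>) = Zc \<nu>" "Zc \<nu> \<in> Obj C"
    using hom_obj by (auto simp: homD)
qed

lemma splitting_comp [simp]:
  assumes "sign \<nu>"
  shows "\<iota> \<nu> \<bullet> \<pi> \<nu> = q \<nu>" "\<pi> \<nu> \<bullet> \<iota> \<nu> = Id C (Zc \<nu>)"
    "q \<nu> \<bullet> \<iota> \<nu> = \<iota> \<nu>" "\<pi> \<nu> \<bullet> q \<nu> = \<pi> \<nu>"
proof -
  show 1: "\<iota> \<nu> \<bullet> \<pi> \<nu> = q \<nu>" "\<pi> \<nu> \<bullet> \<iota> \<nu> = Id C (Zc \<nu>)"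
    using split[OF assms] by (simp_all add: splitting_def)
  have "(\<iota> \<nu> \<bullet> \<pi> \<nu>) \<bullet> \<iota> \<nu> = \<iota> \<nu>" "\<pi> \<nu> \<bullet> \<iota> \<nu> \<bullet> \<pi> \<nu> = \<pi> \<nu>"
    using assms 1(2) comp_assoc'[of "\<pi> \<nu>" "\<iota> \<nu>" "\<pi> \<nu>"] by simp_all
  then show "q \<nu> \<bullet> \<iota> \<nu> = \<iota> \<nu>" "\<pi> \<nu> \<bullet> q \<nu> = \<pi> \<nu>"
    unfolding 1(1) .
qed

lemma splitting_comp' [simp]:
  assumes "sign \<nu>" "arr h"
  shows "tgt h = A \<Longrightarrow> \<iota> \<nu> \<bullet> \<pi> \<nu> \<bullet> h = q \<nu> \<bullet> h" "tgt h = Zc \<nu> \<Longrightarrow> \<pi> \<nu> \<bullet> \<iota> \<nu> \<bullet> h = h"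
    "tgt h = Zc \<nu> \<Longrightarrow> q \<nu> \<bullet> \<iota> \<nu> \<bullet> h = \<iota> \<nu> \<bullet> h" "tgt h = A \<Longrightarrow> \<pi> \<nu> \<bullet> q \<nu> \<bullet> h = \<pi> \<nu> \<bullet> h"
  using assms by (simp_all flip: comp_assoc')

text \<open>The component Z_\<alpha> \<otimes> Z_\<beta> \<rightarrow> Z_{\<alpha>\<beta>} of the
  product. The laws are proved for components first, where no sums occur.\<close>

definition m :: "int \<Rightarrow> int \<Rightarrow> 'm" where
  "m \<alpha> \<beta> = \<pi> (\<alpha> * \<beta>) \<bullet> Mul F \<bullet> (\<iota> \<alpha> \<boxtimes> \<iota> \<beta>)"

definition d :: "int \<Rightarrow> int \<Rightarrow> 'm" where
  "d \<alpha> \<beta> = (\<pi> \<alpha> \<boxtimes> \<pi> \<beta>) \<bullet> Comul F \<bullet> \<iota> (\<alpha> * \<beta>)"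

definition u :: 'm where "u = \<pi> 1 \<bullet> Unit F"
text \<open>The component of the counit on Z_+, a single morphism; it is not the family e_\<nu> of
  the statement.\<close>

definition e :: 'm where "e = Counit F \<bullet> \<iota> 1"

lemma sign_simps [simp]: "sign 1" "sign (-1)" "sign \<alpha> \<Longrightarrow> sign \<beta> \<Longrightarrow> sign (\<alpha> * \<beta>)"
  by (simp_all add: sign_mult) (simp_all add: sign_def)

lemma sign_square: "sign \<alpha> \<Longrightarrow> \<alpha> * \<alpha> = 1" "sign \<alpha> \<Longrightarrow> \<alpha> * (\<alpha> * \<beta>) = \<beta>"
  by (auto simp: sign_def)

lemma md_typing [simp]:
  assumes "sign \<alpha>" "sign \<beta>"
  shows "arr (m \<alpha> \<beta>)" "src (m \<alpha> \<beta>) = Zc \<alpha> \<odot> Zc \<beta>" "tgt (m \<alpha> \<beta>) = Zc (\<alpha> * \<beta>)"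
    "arr (d \<alpha> \<beta>)" "src (d \<alpha> \<beta>) = Zc (\<alpha> * \<beta>)" "tgt (d \<alpha> \<beta>) = Zc \<alpha> \<odot> Zc \<beta>"
  using assms by (simp_all add: m_def d_def)

lemma ue_typing [simp]:
  "arr u" "src u = TUnit C" "tgt u = Zc 1" "arr e" "src e = Zc 1" "tgt e = TUnit C"
  by (simp_all add: u_def e_def)

text \<open>By absorption a product of homogeneous elements already lies in the image of
  q_{\<alpha>\<beta>}, so the projection in \<open>m\<close> loses nothing.\<close>

lemma iota_m:
  assumes "sign \<alpha>" "sign \<beta>"
  shows "\<iota> (\<alpha> * \<beta>) \<bullet> m \<alpha> \<beta> = Mul F \<bullet> (\<iota> \<alpha> \<boxtimes> \<iota> \<beta>)"
proof -
  have "(Id C A \<boxtimes> q \<beta>) \<bullet> (\<iota> \<alpha> \<boxtimes> \<iota> \<beta>) = \<iota> \<alpha> \<boxtimes> \<iota> \<beta>"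
    using assms by (simp add: tensor_comp)
  then have "\<iota> (\<alpha> * \<beta>) \<bullet> m \<alpha> \<beta> = (q (\<alpha> * \<beta>) \<bullet> Mul F \<bullet> (Id C A \<boxtimes> q \<beta>)) \<bullet> (\<iota> \<alpha> \<boxtimes> \<iota> \<beta>)"
    using assms by (simp add: m_def)
  also have "\<dots> = Mul F \<bullet> (q \<alpha> \<boxtimes> q \<beta>) \<bullet> (\<iota> \<alpha> \<boxtimes> \<iota> \<beta>)"
    using assms by (simp add: q_mu_right del: comp_assoc') simp
  also have "\<dots> = Mul F \<bullet> (\<iota> \<alpha> \<boxtimes> \<iota> \<beta>)"
    using assms by (simp add: tensor_comp)
  finally show ?thesis .
qed

text \<open>Dual to \<open>iota_m\<close>: once both legs are projected, \<Delta> sees only the part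
  of degree \<alpha>\<beta> of its argument.\<close>

lemma d_pi:
  assumes "sign \<alpha>" "sign \<beta>"
  shows "d \<alpha> \<beta> \<bullet> \<pi> (\<alpha> * \<beta>) = (\<pi> \<alpha> \<boxtimes> \<pi> \<beta>) \<bullet> Comul F"
proof -
  have pi: "(\<pi> \<alpha> \<boxtimes> \<pi> \<beta>) \<bullet> (q \<alpha> \<boxtimes> q \<beta>) \<bullet> h = (\<pi> \<alpha> \<boxtimes> \<pi> \<beta>) \<bullet> h"
    if "arr h" "tgt h = A \<odot> A" for h
    using assms that by (simp add: tensor_comp')
  have "d \<alpha> \<beta> \<bullet> \<pi> (\<alpha> * \<beta>) = (\<pi> \<alpha> \<boxtimes> \<pi> \<beta>) \<bullet> Comul F \<bullet> q (\<alpha> * \<beta>)"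
    using assms by (simp add: d_def)
  also have "\<dots> = (\<pi> \<alpha> \<boxtimes> \<pi> \<beta>) \<bullet> (q \<alpha> \<boxtimes> q \<beta>) \<bullet> Comul F \<bullet> q (\<alpha> * \<beta>)"
    using assms by (simp add: pi)
  also have "\<dots> = (\<pi> \<alpha> \<boxtimes> \<pi> \<beta>) \<bullet> (q \<alpha> \<boxtimes> q \<beta>) \<bullet> Comul F"
    using assms by (simp add: dl_q)
  also have "\<dots> = (\<pi> \<alpha> \<boxtimes> \<pi> \<beta>) \<bullet> Comul F"
    by (simp add: pi)
  finally show ?thesis .
qed

lemma iota_u: "\<iota> 1 \<bullet> u = Unit F"
  by (simp add: u_def q_eta)

lemma e_pi: "e \<bullet> \<pi> 1 = Counit F"
  by (simp add: e_def ep_q)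

lemma iota_cancel:
  assumes "\<iota> \<nu> \<bullet> f = \<iota> \<nu> \<bullet> g" "sign \<nu>" "arr f" "arr g" "tgt f = Zc \<nu>" "tgt g = Zc \<nu>"
  shows "f = g"
proof -
  have "\<pi> \<nu> \<bullet> \<iota> \<nu> \<bullet> f = \<pi> \<nu> \<bullet> \<iota> \<nu> \<bullet> g"
    using assms(1) by simp
  then show ?thesis
    using assms(2-) by simp
qed

lemma pi_cancel:
  assumes "f \<bullet> \<pi> \<nu> = g \<bullet> \<pi> \<nu>" "sign \<nu>" "arr f" "arr g" "src f = Zc \<nu>" "src g = Zc \<nu>"
  shows "f = g"
proof -
  have "(f \<bullet> \<pi> \<nu>) \<bullet> \<iota> \<nu> = (g \<bullet> \<pi> \<nu>) \<bullet> \<iota> \<nu>"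
    using assms(1) by simp
  then show ?thesis
    using assms(2-) by simp
qed

text \<open>Under the split monomorphisms \<open>\<iota>\<close> every \<open>m\<close> becomes
  \<open>Mul F\<close>, so this is associativity in A. Laws involving \<open>d\<close> are tested on
  the split epimorphisms \<open>\<pi>\<close> instead.\<close>

lemma m_assoc:
  assumes s: "sign \<alpha>" "sign \<beta>" "sign \<gamma>"
  shows "m (\<alpha> * \<beta>) \<gamma> \<bullet> (m \<alpha> \<beta> \<boxtimes> Id C (Zc \<gamma>)) = m \<alpha> (\<beta> * \<gamma>) \<bullet> (Id C (Zc \<alpha>) \<boxtimes> m \<beta> \<gamma>)"
proof (rule iota_cancel[of "\<alpha> * \<beta> * \<gamma>"])
  have "\<iota> (\<alpha> * \<beta> * \<gamma>) \<bullet> m (\<alpha> * \<beta>) \<gamma> \<bullet> (m \<alpha> \<beta> \<boxtimes> Id C (Zc \<gamma>))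
      = Mul F \<bullet> (\<iota> (\<alpha> * \<beta>) \<boxtimes> \<iota> \<gamma>) \<bullet> (m \<alpha> \<beta> \<boxtimes> Id C (Zc \<gamma>))"
    using s comp_cong[OF iota_m[of "\<alpha> * \<beta>" \<gamma>], of "m \<alpha> \<beta> \<boxtimes> Id C (Zc \<gamma>)"] by simp
  also have "(\<iota> (\<alpha> * \<beta>) \<boxtimes> \<iota> \<gamma>) \<bullet> (m \<alpha> \<beta> \<boxtimes> Id C (Zc \<gamma>))
      = (Mul F \<boxtimes> Id C A) \<bullet> ((\<iota> \<alpha> \<boxtimes> \<iota> \<beta>) \<boxtimes> \<iota> \<gamma>)"
    using s by (simp add: tensor_comp iota_m)
  also have "Mul F \<bullet> \<dots> = Mul F \<bullet> (Id C A \<boxtimes> Mul F) \<bullet> (\<iota> \<alpha> \<boxtimes> (\<iota> \<beta> \<boxtimes> \<iota> \<gamma>))"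
    using s comp_cong[OF structure_laws(1), of "(\<iota> \<alpha> \<boxtimes> \<iota> \<beta>) \<boxtimes> \<iota> \<gamma>"] by (simp add: tensor_assoc')
  also have "(Id C A \<boxtimes> Mul F) \<bullet> (\<iota> \<alpha> \<boxtimes> (\<iota> \<beta> \<boxtimes> \<iota> \<gamma>)) = (\<iota> \<alpha> \<boxtimes> \<iota> (\<beta> * \<gamma>)) \<bullet> (Id C (Zc \<alpha>) \<boxtimes> m \<beta> \<gamma>)"
    using s by (simp add: tensor_comp iota_m)
  also have "Mul F \<bullet> \<dots> = \<iota> (\<alpha> * \<beta> * \<gamma>) \<bullet> m \<alpha> (\<beta> * \<gamma>) \<bullet> (Id C (Zc \<alpha>) \<boxtimes> m \<beta> \<gamma>)"
    using s comp_cong[OF iota_m[of \<alpha> "\<beta> * \<gamma>"], of "Id C (Zc \<alpha>) \<boxtimes> m \<beta> \<gamma>"] by (simp add: mult.assoc)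
  finally show "\<iota> (\<alpha> * \<beta> * \<gamma>) \<bullet> m (\<alpha> * \<beta>) \<gamma> \<bullet> (m \<alpha> \<beta> \<boxtimes> Id C (Zc \<gamma>))
      = \<iota> (\<alpha> * \<beta> * \<gamma>) \<bullet> m \<alpha> (\<beta> * \<gamma>) \<bullet> (Id C (Zc \<alpha>) \<boxtimes> m \<beta> \<gamma>)" .
qed (use s in \<open>simp_all add: mult.assoc\<close>)

lemma pi_pi_cancel:
  assumes "f \<bullet> (\<pi> \<alpha> \<boxtimes> \<pi> \<beta>) = g \<bullet> (\<pi> \<alpha> \<boxtimes> \<pi> \<beta>)" "sign \<alpha>" "sign \<beta>" "arr f" "arr g"
    "src f = Zc \<alpha> \<odot> Zc \<beta>" "src g = Zc \<alpha> \<odot> Zc \<beta>"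
  shows "f = g"
proof -
  have "(f \<bullet> (\<pi> \<alpha> \<boxtimes> \<pi> \<beta>)) \<bullet> (\<iota> \<alpha> \<boxtimes> \<iota> \<beta>) = (g \<bullet> (\<pi> \<alpha> \<boxtimes> \<pi> \<beta>)) \<bullet> (\<iota> \<alpha> \<boxtimes> \<iota> \<beta>)"
    using assms(1) by simp
  then show ?thesis
    using assms(2-) by (simp add: tensor_comp)
qed

text \<open>Absorption allows one of the two idempotents to be dropped. In the Frobenius relations
  one argument of the product is a leg of \<Delta>; the idempotent is kept on the other one.\<close>

lemma m_pi:
  assumes s: "sign \<alpha>" "sign \<beta>"
  shows "m \<alpha> \<beta> \<bullet> (\<pi> \<alpha> \<boxtimes> \<pi> \<beta>) = \<pi> (\<alpha> * \<beta>) \<bullet> Mul F \<bullet> (Id C A \<boxtimes> q \<beta>)"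
    "m \<alpha> \<beta> \<bullet> (\<pi> \<alpha> \<boxtimes> \<pi> \<beta>) = \<pi> (\<alpha> * \<beta>) \<bullet> Mul F \<bullet> (q \<alpha> \<boxtimes> Id C A)"
proof -
  have m: "m \<alpha> \<beta> \<bullet> (\<pi> \<alpha> \<boxtimes> \<pi> \<beta>) = \<pi> (\<alpha> * \<beta>) \<bullet> Mul F \<bullet> (q \<alpha> \<boxtimes> q \<beta>)"
    using s by (simp add: m_def tensor_comp)
  have "\<pi> (\<alpha> * \<beta>) \<bullet> Mul F \<bullet> (Id C A \<boxtimes> q \<beta>)
      = \<pi> (\<alpha> * \<beta>) \<bullet> q (\<alpha> * \<beta>) \<bullet> Mul F \<bullet> (Id C A \<boxtimes> q \<beta>)"
    using s by simp
  then show "m \<alpha> \<beta> \<bullet> (\<pi> \<alpha> \<boxtimes> \<pi> \<beta>) = \<pi> (\<alpha> * \<beta>) \<bullet> Mul F \<bullet> (Id C A \<boxtimes> q \<beta>)"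
    unfolding m q_mu_right[OF s] by simp
  have "\<pi> (\<alpha> * \<beta>) \<bullet> Mul F \<bullet> (q \<alpha> \<boxtimes> Id C A)
      = \<pi> (\<alpha> * \<beta>) \<bullet> q (\<alpha> * \<beta>) \<bullet> Mul F \<bullet> (q \<alpha> \<boxtimes> Id C A)"
    using s by simp
  then show "m \<alpha> \<beta> \<bullet> (\<pi> \<alpha> \<boxtimes> \<pi> \<beta>) = \<pi> (\<alpha> * \<beta>) \<bullet> Mul F \<bullet> (q \<alpha> \<boxtimes> Id C A)"
    unfolding m q_mu_left[OF s] by simp
qed

lemma m_unit:
  assumes s: "sign \<alpha>"
  shows "m 1 \<alpha> \<bullet> (u \<boxtimes> Id C (Zc \<alpha>)) = Id C (Zc \<alpha>)" "m \<alpha> 1 \<bullet> (Id C (Zc \<alpha>) \<boxtimes> u) = Id C (Zc \<alpha>)"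
proof -
  have l: "Unit F \<boxtimes> \<iota> \<alpha> = (Unit F \<boxtimes> Id C A) \<bullet> \<iota> \<alpha>"
    using s tensor_comp[of "Id C (TUnit C)" "Unit F" "\<iota> \<alpha>" "Id C A"] by simp
  have r: "\<iota> \<alpha> \<boxtimes> Unit F = (Id C A \<boxtimes> Unit F) \<bullet> \<iota> \<alpha>"
    using s tensor_comp[of "\<iota> \<alpha>" "Id C A" "Id C (TUnit C)" "Unit F"] by simp
  have "\<iota> \<alpha> \<bullet> m 1 \<alpha> \<bullet> (u \<boxtimes> Id C (Zc \<alpha>)) = Mul F \<bullet> (\<iota> 1 \<boxtimes> \<iota> \<alpha>) \<bullet> (u \<boxtimes> Id C (Zc \<alpha>))"
    using s comp_cong[OF iota_m[of 1 \<alpha>], of "u \<boxtimes> Id C (Zc \<alpha>)"] by simp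
  also have "\<dots> = Mul F \<bullet> (Unit F \<boxtimes> Id C A) \<bullet> \<iota> \<alpha>"
    using s by (simp add: tensor_comp iota_u l)
  also have "\<dots> = \<iota> \<alpha> \<bullet> Id C (Zc \<alpha>)"
    using s comp_cong[of "Mul F" "Unit F \<boxtimes> Id C A" "Id C A" "Id C A" "\<iota> \<alpha>"]
    by (simp add: structure_laws)
  finally show "m 1 \<alpha> \<bullet> (u \<boxtimes> Id C (Zc \<alpha>)) = Id C (Zc \<alpha>)"
    using s by (rule iota_cancel) (use s in simp_all)
  have "\<iota> \<alpha> \<bullet> m \<alpha> 1 \<bullet> (Id C (Zc \<alpha>) \<boxtimes> u) = Mul F \<bullet> (\<iota> \<alpha> \<boxtimes> \<iota> 1) \<bullet> (Id C (Zc \<alpha>) \<boxtimes> u)"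
    using s comp_cong[OF iota_m[of \<alpha> 1], of "Id C (Zc \<alpha>) \<boxtimes> u"] by simp
  also have "\<dots> = Mul F \<bullet> (Id C A \<boxtimes> Unit F) \<bullet> \<iota> \<alpha>"
    using s by (simp add: tensor_comp iota_u r)
  also have "\<dots> = \<iota> \<alpha> \<bullet> Id C (Zc \<alpha>)"
    using s comp_cong[of "Mul F" "Id C A \<boxtimes> Unit F" "Id C A" "Id C A" "\<iota> \<alpha>"]
    by (simp add: structure_laws)
  finally show "m \<alpha> 1 \<bullet> (Id C (Zc \<alpha>) \<boxtimes> u) = Id C (Zc \<alpha>)"
    using s by (rule iota_cancel) (use s in simp_all)
qed

lemma d_counit:
  assumes s: "sign \<alpha>"
  shows "(e \<boxtimes> Id C (Zc \<alpha>)) \<bullet> d 1 \<alpha> = Id C (Zc \<alpha>)" "(Id C (Zc \<alpha>) \<boxtimes> e) \<bullet> d \<alpha> 1 = Id C (Zc \<alpha>)"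
proof -
  have l: "Counit F \<boxtimes> \<pi> \<alpha> = \<pi> \<alpha> \<bullet> (Counit F \<boxtimes> Id C A)"
    using s tensor_comp[of "Counit F" "Id C (TUnit C)" "Id C A" "\<pi> \<alpha>"] by simp
  have r: "\<pi> \<alpha> \<boxtimes> Counit F = \<pi> \<alpha> \<bullet> (Id C A \<boxtimes> Counit F)"
    using s tensor_comp[of "Id C A" "\<pi> \<alpha>" "Counit F" "Id C (TUnit C)"] by simp
  have "((e \<boxtimes> Id C (Zc \<alpha>)) \<bullet> d 1 \<alpha>) \<bullet> \<pi> \<alpha> = (e \<boxtimes> Id C (Zc \<alpha>)) \<bullet> (\<pi> 1 \<boxtimes> \<pi> \<alpha>) \<bullet> Comul F"
    using s d_pi[of 1 \<alpha>] by simp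
  also have "\<dots> = (Counit F \<boxtimes> \<pi> \<alpha>) \<bullet> Comul F"
    using s by (simp add: tensor_comp' e_pi)
  also have "\<dots> = Id C (Zc \<alpha>) \<bullet> \<pi> \<alpha>"
    using s by (simp add: l structure_laws)
  finally show "(e \<boxtimes> Id C (Zc \<alpha>)) \<bullet> d 1 \<alpha> = Id C (Zc \<alpha>)"
    using s by (rule pi_cancel) (use s in simp_all)
  have "((Id C (Zc \<alpha>) \<boxtimes> e) \<bullet> d \<alpha> 1) \<bullet> \<pi> \<alpha> = (Id C (Zc \<alpha>) \<boxtimes> e) \<bullet> (\<pi> \<alpha> \<boxtimes> \<pi> 1) \<bullet> Comul F"
    using s d_pi[of \<alpha> 1] by simp
  also have "\<dots> = (\<pi> \<alpha> \<boxtimes> Counit F) \<bullet> Comul F"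
    using s by (simp add: tensor_comp' e_pi)
  also have "\<dots> = Id C (Zc \<alpha>) \<bullet> \<pi> \<alpha>"
    using s by (simp add: r structure_laws)
  finally show "(Id C (Zc \<alpha>) \<boxtimes> e) \<bullet> d \<alpha> 1 = Id C (Zc \<alpha>)"
    using s by (rule pi_cancel) (use s in simp_all)
qed

lemma d_coassoc:
  assumes s: "sign \<alpha>" "sign \<beta>" "sign \<gamma>"
  shows "(d \<alpha> \<beta> \<boxtimes> Id C (Zc \<gamma>)) \<bullet> d (\<alpha> * \<beta>) \<gamma> = (Id C (Zc \<alpha>) \<boxtimes> d \<beta> \<gamma>) \<bullet> d \<alpha> (\<beta> * \<gamma>)"
proof (rule pi_cancel[of _ "\<alpha> * \<beta> * \<gamma>"])
  have "((d \<alpha> \<beta> \<boxtimes> Id C (Zc \<gamma>)) \<bullet> d (\<alpha> * \<beta>) \<gamma>) \<bullet> \<pi> (\<alpha> * \<beta> * \<gamma>)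
      = (d \<alpha> \<beta> \<boxtimes> Id C (Zc \<gamma>)) \<bullet> (\<pi> (\<alpha> * \<beta>) \<boxtimes> \<pi> \<gamma>) \<bullet> Comul F"
    using s d_pi[of "\<alpha> * \<beta>" \<gamma>] by simp
  also have "\<dots> = ((d \<alpha> \<beta> \<bullet> \<pi> (\<alpha> * \<beta>)) \<boxtimes> \<pi> \<gamma>) \<bullet> Comul F"
    using s by (simp add: tensor_comp')
  also have "\<dots> = (((\<pi> \<alpha> \<boxtimes> \<pi> \<beta>) \<bullet> Comul F) \<boxtimes> (\<pi> \<gamma> \<bullet> Id C A)) \<bullet> Comul F"
    using s by (simp add: d_pi)
  also have "\<dots> = ((\<pi> \<alpha> \<boxtimes> \<pi> \<beta>) \<boxtimes> \<pi> \<gamma>) \<bullet> (Comul F \<boxtimes> Id C A) \<bullet> Comul F"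
    using s tensor_comp'[of "Comul F" "\<pi> \<alpha> \<boxtimes> \<pi> \<beta>" "Id C A" "\<pi> \<gamma>" "Comul F"] by simp
  also have "\<dots> = (\<pi> \<alpha> \<boxtimes> (\<pi> \<beta> \<boxtimes> \<pi> \<gamma>)) \<bullet> (Id C A \<boxtimes> Comul F) \<bullet> Comul F"
    using s by (simp add: structure_laws tensor_assoc')
  also have "\<dots> = (\<pi> \<alpha> \<boxtimes> (d \<beta> \<gamma> \<bullet> \<pi> (\<beta> * \<gamma>))) \<bullet> Comul F"
    using s by (simp add: tensor_comp' d_pi)
  also have "\<dots> = (Id C (Zc \<alpha>) \<boxtimes> d \<beta> \<gamma>) \<bullet> (\<pi> \<alpha> \<boxtimes> \<pi> (\<beta> * \<gamma>)) \<bullet> Comul F"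
    using s by (simp add: tensor_comp')
  also have "\<dots> = ((Id C (Zc \<alpha>) \<boxtimes> d \<beta> \<gamma>) \<bullet> d \<alpha> (\<beta> * \<gamma>)) \<bullet> \<pi> (\<alpha> * \<beta> * \<gamma>)"
    using s d_pi[of \<alpha> "\<beta> * \<gamma>"] by (simp add: mult.assoc)
  finally show "((d \<alpha> \<beta> \<boxtimes> Id C (Zc \<gamma>)) \<bullet> d (\<alpha> * \<beta>) \<gamma>) \<bullet> \<pi> (\<alpha> * \<beta> * \<gamma>)
      = ((Id C (Zc \<alpha>) \<boxtimes> d \<beta> \<gamma>) \<bullet> d \<alpha> (\<beta> * \<gamma>)) \<bullet> \<pi> (\<alpha> * \<beta> * \<gamma>)" .
qed (use s in \<open>simp_all add: mult.assoc\<close>)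

text \<open>Tested on \<pi> \<otimes> \<pi>, \<open>d\<close> turns into \<Delta> and
  \<open>m\<close> into \<mu> with q_\<gamma> left on the strand that \<Delta> does not touch. There
  q_\<gamma> can act first, the relation of A applies, and \<open>m_pi\<close> absorbs q_\<gamma>
  again.\<close>

lemma m_d:
  assumes s: "sign \<alpha>" "sign \<beta>" "sign \<gamma>"
  shows "(Id C (Zc \<alpha>) \<boxtimes> m \<beta> \<gamma>) \<bullet> (d \<alpha> \<beta> \<boxtimes> Id C (Zc \<gamma>)) = d \<alpha> (\<beta> * \<gamma>) \<bullet> m (\<alpha> * \<beta>) \<gamma>"
proof (rule pi_pi_cancel[of _ "\<alpha> * \<beta>" \<gamma>])
  have "((Id C (Zc \<alpha>) \<boxtimes> m \<beta> \<gamma>) \<bullet> (d \<alpha> \<beta> \<boxtimes> Id C (Zc \<gamma>))) \<bullet> (\<pi> (\<alpha> * \<beta>) \<boxtimes> \<pi> \<gamma>)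
      = (Id C (Zc \<alpha>) \<boxtimes> m \<beta> \<gamma>) \<bullet> ((d \<alpha> \<beta> \<bullet> \<pi> (\<alpha> * \<beta>)) \<boxtimes> (\<pi> \<gamma> \<bullet> Id C A))"
    using s by (simp add: tensor_comp)
  also have "\<dots> = (Id C (Zc \<alpha>) \<boxtimes> m \<beta> \<gamma>) \<bullet> ((\<pi> \<alpha> \<boxtimes> \<pi> \<beta>) \<boxtimes> \<pi> \<gamma>) \<bullet> (Comul F \<boxtimes> Id C A)"
    using s tensor_comp[of "Comul F" "\<pi> \<alpha> \<boxtimes> \<pi> \<beta>" "Id C A" "\<pi> \<gamma>"] by (simp add: d_pi)
  also have "\<dots> = (\<pi> \<alpha> \<boxtimes> (m \<beta> \<gamma> \<bullet> (\<pi> \<beta> \<boxtimes> \<pi> \<gamma>))) \<bullet> (Comul F \<boxtimes> Id C A)"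
    using s by (simp add: tensor_assoc' tensor_comp')
  also have "m \<beta> \<gamma> \<bullet> (\<pi> \<beta> \<boxtimes> \<pi> \<gamma>) = \<pi> (\<beta> * \<gamma>) \<bullet> Mul F \<bullet> (Id C A \<boxtimes> q \<gamma>)"
    using s by (simp only: m_pi(1))
  also have "(\<pi> \<alpha> \<boxtimes> (\<pi> (\<beta> * \<gamma>) \<bullet> Mul F \<bullet> (Id C A \<boxtimes> q \<gamma>))) \<bullet> (Comul F \<boxtimes> Id C A)
      = (\<pi> \<alpha> \<boxtimes> \<pi> (\<beta> * \<gamma>)) \<bullet> (Id C A \<boxtimes> Mul F) \<bullet> ((Id C A \<boxtimes> Id C A) \<boxtimes> q \<gamma>) \<bullet> (Comul F \<boxtimes> Id C A)"
    using s by (simp only: tensor_assoc' id_typing A_obj structure_typing)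
      (simp add: tensor_comp' del: tensor_id')
  also have "((Id C A \<boxtimes> Id C A) \<boxtimes> q \<gamma>) \<bullet> (Comul F \<boxtimes> Id C A) = (Comul F \<boxtimes> Id C A) \<bullet> (Id C A \<boxtimes> q \<gamma>)"
    by (simp add: tensor_comp)
  also have "(Id C A \<boxtimes> Mul F) \<bullet> \<dots> = Comul F \<bullet> Mul F \<bullet> (Id C A \<boxtimes> q \<gamma>)"
    using comp_cong[OF structure_laws(7), of "Id C A \<boxtimes> q \<gamma>"] by simp
  also have "(\<pi> \<alpha> \<boxtimes> \<pi> (\<beta> * \<gamma>)) \<bullet> \<dots> = d \<alpha> (\<beta> * \<gamma>) \<bullet> \<pi> (\<alpha> * \<beta> * \<gamma>) \<bullet> Mul F \<bullet> (Id C A \<boxtimes> q \<gamma>)"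
    using s comp_cong[OF d_pi[of \<alpha> "\<beta> * \<gamma>"], of "Mul F \<bullet> (Id C A \<boxtimes> q \<gamma>)"] by (simp add: mult.assoc)
  also have "\<pi> (\<alpha> * \<beta> * \<gamma>) \<bullet> Mul F \<bullet> (Id C A \<boxtimes> q \<gamma>) = m (\<alpha> * \<beta>) \<gamma> \<bullet> (\<pi> (\<alpha> * \<beta>) \<boxtimes> \<pi> \<gamma>)"
    using s by (simp only: m_pi(1) sign_simps)
  also have "d \<alpha> (\<beta> * \<gamma>) \<bullet> \<dots> = (d \<alpha> (\<beta> * \<gamma>) \<bullet> m (\<alpha> * \<beta>) \<gamma>) \<bullet> (\<pi> (\<alpha> * \<beta>) \<boxtimes> \<pi> \<gamma>)"
    using s by (simp add: mult.assoc)
  finally show "((Id C (Zc \<alpha>) \<boxtimes> m \<beta> \<gamma>) \<bullet> (d \<alpha> \<beta> \<boxtimes> Id C (Zc \<gamma>))) \<bullet> (\<pi> (\<alpha> * \<beta>) \<boxtimes> \<pi> \<gamma>)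
      = (d \<alpha> (\<beta> * \<gamma>) \<bullet> m (\<alpha> * \<beta>) \<gamma>) \<bullet> (\<pi> (\<alpha> * \<beta>) \<boxtimes> \<pi> \<gamma>)" .
qed (use s in \<open>simp_all add: mult.assoc\<close>)

lemma m_d':
  assumes s: "sign \<alpha>" "sign \<beta>" "sign \<gamma>"
  shows "(m \<alpha> \<beta> \<boxtimes> Id C (Zc \<gamma>)) \<bullet> (Id C (Zc \<alpha>) \<boxtimes> d \<beta> \<gamma>) = d (\<alpha> * \<beta>) \<gamma> \<bullet> m \<alpha> (\<beta> * \<gamma>)"
proof (rule pi_pi_cancel[of _ \<alpha> "\<beta> * \<gamma>"])
  have "((m \<alpha> \<beta> \<boxtimes> Id C (Zc \<gamma>)) \<bullet> (Id C (Zc \<alpha>) \<boxtimes> d \<beta> \<gamma>)) \<bullet> (\<pi> \<alpha> \<boxtimes> \<pi> (\<beta> * \<gamma>))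
      = (m \<alpha> \<beta> \<boxtimes> Id C (Zc \<gamma>)) \<bullet> ((\<pi> \<alpha> \<bullet> Id C A) \<boxtimes> (d \<beta> \<gamma> \<bullet> \<pi> (\<beta> * \<gamma>)))"
    using s by (simp add: tensor_comp)
  also have "\<dots> = (m \<alpha> \<beta> \<boxtimes> Id C (Zc \<gamma>)) \<bullet> (\<pi> \<alpha> \<boxtimes> (\<pi> \<beta> \<boxtimes> \<pi> \<gamma>)) \<bullet> (Id C A \<boxtimes> Comul F)"
    using s tensor_comp[of "Id C A" "\<pi> \<alpha>" "Comul F" "\<pi> \<beta> \<boxtimes> \<pi> \<gamma>"] by (simp add: d_pi)
  also have "\<dots> = ((m \<alpha> \<beta> \<bullet> (\<pi> \<alpha> \<boxtimes> \<pi> \<beta>)) \<boxtimes> \<pi> \<gamma>) \<bullet> (Id C A \<boxtimes> Comul F)"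
    using s by (simp add: tensor_comp' flip: tensor_assoc')
  also have "m \<alpha> \<beta> \<bullet> (\<pi> \<alpha> \<boxtimes> \<pi> \<beta>) = \<pi> (\<alpha> * \<beta>) \<bullet> Mul F \<bullet> (q \<alpha> \<boxtimes> Id C A)"
    using s by (simp only: m_pi(2))
  also have "((\<pi> (\<alpha> * \<beta>) \<bullet> Mul F \<bullet> (q \<alpha> \<boxtimes> Id C A)) \<boxtimes> \<pi> \<gamma>) \<bullet> (Id C A \<boxtimes> Comul F)
      = (\<pi> (\<alpha> * \<beta>) \<boxtimes> \<pi> \<gamma>) \<bullet> (Mul F \<boxtimes> Id C A) \<bullet> (q \<alpha> \<boxtimes> (Id C A \<boxtimes> Id C A)) \<bullet> (Id C A \<boxtimes> Comul F)"
    using s by (simp only: tensor_assoc'[symmetric] id_typing A_obj structure_typing)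
      (simp add: tensor_comp' del: tensor_id')
  also have "(q \<alpha> \<boxtimes> (Id C A \<boxtimes> Id C A)) \<bullet> (Id C A \<boxtimes> Comul F) = (Id C A \<boxtimes> Comul F) \<bullet> (q \<alpha> \<boxtimes> Id C A)"
    by (simp add: tensor_comp)
  also have "(Mul F \<boxtimes> Id C A) \<bullet> \<dots> = Comul F \<bullet> Mul F \<bullet> (q \<alpha> \<boxtimes> Id C A)"
    using comp_cong[OF structure_laws(8), of "q \<alpha> \<boxtimes> Id C A"] by simp
  also have "(\<pi> (\<alpha> * \<beta>) \<boxtimes> \<pi> \<gamma>) \<bullet> \<dots> = d (\<alpha> * \<beta>) \<gamma> \<bullet> \<pi> (\<alpha> * (\<beta> * \<gamma>)) \<bullet> Mul F \<bullet> (q \<alpha> \<boxtimes> Id C A)"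
    using s comp_cong[OF d_pi[of "\<alpha> * \<beta>" \<gamma>], of "Mul F \<bullet> (q \<alpha> \<boxtimes> Id C A)"] by (simp add: mult.assoc)
  also have "\<pi> (\<alpha> * (\<beta> * \<gamma>)) \<bullet> Mul F \<bullet> (q \<alpha> \<boxtimes> Id C A) = m \<alpha> (\<beta> * \<gamma>) \<bullet> (\<pi> \<alpha> \<boxtimes> \<pi> (\<beta> * \<gamma>))"
    using s by (simp only: m_pi(2) sign_simps)
  also have "d (\<alpha> * \<beta>) \<gamma> \<bullet> \<dots> = (d (\<alpha> * \<beta>) \<gamma> \<bullet> m \<alpha> (\<beta> * \<gamma>)) \<bullet> (\<pi> \<alpha> \<boxtimes> \<pi> (\<beta> * \<gamma>))"
    using s by (simp add: mult.assoc)
  finally show "((m \<alpha> \<beta> \<boxtimes> Id C (Zc \<gamma>)) \<bullet> (Id C (Zc \<alpha>) \<boxtimes> d \<beta> \<gamma>)) \<bullet> (\<pi> \<alpha> \<boxtimes> \<pi> (\<beta> * \<gamma>))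
      = (d (\<alpha> * \<beta>) \<gamma> \<bullet> m \<alpha> (\<beta> * \<gamma>)) \<bullet> (\<pi> \<alpha> \<boxtimes> \<pi> (\<beta> * \<gamma>))" .
qed (use s in \<open>simp_all add: mult.assoc\<close>)

definition n :: "int \<Rightarrow> 'm" where "n \<nu> = \<pi> \<nu> \<bullet> N \<bullet> \<iota> \<nu>"

lemma n_typing [simp]:
  assumes "sign \<nu>"
  shows "arr (n \<nu>)" "src (n \<nu>) = Zc \<nu>" "tgt (n \<nu>) = Zc \<nu>"
  using assms by (simp_all add: n_def)

lemma iota_n:
  assumes "sign \<nu>"
  shows "\<iota> \<nu> \<bullet> n \<nu> = N \<bullet> \<iota> \<nu>"
  using assms comp_cong[OF N_q[OF assms, symmetric], of "\<iota> \<nu>"] by (simp add: n_def)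

lemma n_n:
  assumes s: "sign \<nu>"
  shows "n \<nu> \<bullet> n \<nu> = Id C (Zc \<nu>)"
proof (rule iota_cancel[OF _ s])
  have "\<iota> \<nu> \<bullet> n \<nu> \<bullet> n \<nu> = N \<bullet> N \<bullet> \<iota> \<nu>"
    using s comp_cong[OF iota_n[OF s], of "n \<nu>"] by (simp add: iota_n)
  also have "\<dots> = \<iota> \<nu> \<bullet> Id C (Zc \<nu>)"
    using s comp_cong[of N N "Id C A" "Id C A" "\<iota> \<nu>"] N_involution by simp
  finally show "\<iota> \<nu> \<bullet> n \<nu> \<bullet> n \<nu> = \<iota> \<nu> \<bullet> Id C (Zc \<nu>)" .
qed (use s in simp_all)

lemma n_1: "n 1 = Id C (Zc 1)"
proof (rule iota_cancel[of 1])
  have "N \<bullet> \<iota> 1 = N \<bullet> q 1 \<bullet> \<iota> 1"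
    by simp
  also have "\<dots> = \<iota> 1"
    using comp_cong[of N "q 1" "q 1" "Id C A" "\<iota> 1"] N_q_1 by simp
  finally show "\<iota> 1 \<bullet> n 1 = \<iota> 1 \<bullet> Id C (Zc 1)"
    by (simp add: iota_n)
qed simp_all

lemma signed_iota:
  assumes "sign \<nu>"
  shows "signed C A N \<gamma> \<bullet> \<iota> \<nu> = \<iota> \<nu> \<bullet> signed C (Zc \<nu>) (n \<nu>) \<gamma>"
  using assms by (simp add: signed_def iota_n)

lemma signed_typing [simp]:
  assumes "arr f" "src f = X" "tgt f = X"
  shows "arr (signed C X f \<gamma>)" "src (signed C X f \<gamma>) = X" "tgt (signed C X f \<gamma>) = X"
  using assms arr_obj[OF assms(1)] by (simp_all add: signed_def)

lemma braid_typing [simp]: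
  assumes "X \<in> Obj C" "Y \<in> Obj C"
  shows "arr (Braid C X Y)" "src (Braid C X Y) = X \<odot> Y" "tgt (Braid C X Y) = Y \<odot> X"
  using homD[OF braid_hom[OF assms]] .

text \<open>\<open>q_commute\<close> restricted to homogeneous arguments and cancelled under
  \<open>\<iota>\<close>; both orders of the indices have the same target since signs
  commute.\<close>

lemma m_braid:
  assumes s: "sign \<alpha>" "sign \<beta>" and \<gamma>: "\<gamma> = (if \<alpha> = -1 \<and> \<beta> = -1 then -1 else 1)"
  shows "m \<beta> \<alpha> \<bullet> Braid C (Zc \<alpha>) (Zc \<beta>) = m \<alpha> \<beta> \<bullet> (signed C (Zc \<alpha>) (n \<alpha>) \<gamma> \<boxtimes> Id C (Zc \<beta>))"
    "m \<beta> \<alpha> \<bullet> Braid C (Zc \<alpha>) (Zc \<beta>) = m \<alpha> \<beta> \<bullet> (Id C (Zc \<alpha>) \<boxtimes> signed C (Zc \<beta>) (n \<beta>) \<gamma>)"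
proof -
  have ii: "(q \<alpha> \<boxtimes> q \<beta>) \<bullet> (\<iota> \<alpha> \<boxtimes> \<iota> \<beta>) = \<iota> \<alpha> \<boxtimes> \<iota> \<beta>"
    using s by (simp add: tensor_comp)
  have "\<iota> (\<alpha> * \<beta>) \<bullet> m \<beta> \<alpha> \<bullet> Braid C (Zc \<alpha>) (Zc \<beta>) = Mul F \<bullet> (\<iota> \<beta> \<boxtimes> \<iota> \<alpha>) \<bullet> Braid C (Zc \<alpha>) (Zc \<beta>)"
    using s comp_cong[OF iota_m[of \<beta> \<alpha>], of "Braid C (Zc \<alpha>) (Zc \<beta>)"] by (simp add: mult.commute)
  also have "(\<iota> \<beta> \<boxtimes> \<iota> \<alpha>) \<bullet> Braid C (Zc \<alpha>) (Zc \<beta>) = Braid C A A \<bullet> (\<iota> \<alpha> \<boxtimes> \<iota> \<beta>)"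
    using s by (intro braid_natural[symmetric]) (simp_all add: hom_iff)
  also have "Mul F \<bullet> \<dots> = (Mul F \<bullet> Braid C A A \<bullet> (q \<alpha> \<boxtimes> q \<beta>)) \<bullet> (\<iota> \<alpha> \<boxtimes> \<iota> \<beta>)"
    using s by (simp add: ii)
  finally have 1: "\<iota> (\<alpha> * \<beta>) \<bullet> m \<beta> \<alpha> \<bullet> Braid C (Zc \<alpha>) (Zc \<beta>)
      = (Mul F \<bullet> Braid C A A \<bullet> (q \<alpha> \<boxtimes> q \<beta>)) \<bullet> (\<iota> \<alpha> \<boxtimes> \<iota> \<beta>)" .
  have "(Mul F \<bullet> (signed C A N \<gamma> \<boxtimes> Id C A) \<bullet> (q \<alpha> \<boxtimes> q \<beta>)) \<bullet> (\<iota> \<alpha> \<boxtimes> \<iota> \<beta>)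
      = Mul F \<bullet> (\<iota> \<alpha> \<boxtimes> \<iota> \<beta>) \<bullet> (signed C (Zc \<alpha>) (n \<alpha>) \<gamma> \<boxtimes> Id C (Zc \<beta>))"
    using s by (simp add: ii) (simp add: tensor_comp signed_iota)
  also have "\<dots> = \<iota> (\<alpha> * \<beta>) \<bullet> m \<alpha> \<beta> \<bullet> (signed C (Zc \<alpha>) (n \<alpha>) \<gamma> \<boxtimes> Id C (Zc \<beta>))"
    using s comp_cong[OF iota_m[of \<alpha> \<beta>], of "signed C (Zc \<alpha>) (n \<alpha>) \<gamma> \<boxtimes> Id C (Zc \<beta>)"] by simp
  finally have "\<iota> (\<alpha> * \<beta>) \<bullet> m \<beta> \<alpha> \<bullet> Braid C (Zc \<alpha>) (Zc \<beta>)
      = \<iota> (\<alpha> * \<beta>) \<bullet> m \<alpha> \<beta> \<bullet> (signed C (Zc \<alpha>) (n \<alpha>) \<gamma> \<boxtimes> Id C (Zc \<beta>))"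
    unfolding 1 q_commute(1)[OF s \<gamma>] .
  then show "m \<beta> \<alpha> \<bullet> Braid C (Zc \<alpha>) (Zc \<beta>) = m \<alpha> \<beta> \<bullet> (signed C (Zc \<alpha>) (n \<alpha>) \<gamma> \<boxtimes> Id C (Zc \<beta>))"
    by (rule iota_cancel) (use s in \<open>simp_all add: mult.commute\<close>)
  have "(Mul F \<bullet> (Id C A \<boxtimes> signed C A N \<gamma>) \<bullet> (q \<alpha> \<boxtimes> q \<beta>)) \<bullet> (\<iota> \<alpha> \<boxtimes> \<iota> \<beta>)
      = Mul F \<bullet> (\<iota> \<alpha> \<boxtimes> \<iota> \<beta>) \<bullet> (Id C (Zc \<alpha>) \<boxtimes> signed C (Zc \<beta>) (n \<beta>) \<gamma>)"
    using s by (simp add: ii) (simp add: tensor_comp signed_iota)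
  also have "\<dots> = \<iota> (\<alpha> * \<beta>) \<bullet> m \<alpha> \<beta> \<bullet> (Id C (Zc \<alpha>) \<boxtimes> signed C (Zc \<beta>) (n \<beta>) \<gamma>)"
    using s comp_cong[OF iota_m[of \<alpha> \<beta>], of "Id C (Zc \<alpha>) \<boxtimes> signed C (Zc \<beta>) (n \<beta>) \<gamma>"] by simp
  finally have "\<iota> (\<alpha> * \<beta>) \<bullet> m \<beta> \<alpha> \<bullet> Braid C (Zc \<alpha>) (Zc \<beta>)
      = \<iota> (\<alpha> * \<beta>) \<bullet> m \<alpha> \<beta> \<bullet> (Id C (Zc \<alpha>) \<boxtimes> signed C (Zc \<beta>) (n \<beta>) \<gamma>)"
    unfolding 1 q_commute(2)[OF s \<gamma>] .
  then show "m \<beta> \<alpha> \<bullet> Braid C (Zc \<alpha>) (Zc \<beta>) = m \<alpha> \<beta> \<bullet> (Id C (Zc \<alpha>) \<boxtimes> signed C (Zc \<beta>) (n \<beta>) \<gamma>)"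
    by (rule iota_cancel) (use s in \<open>simp_all add: mult.commute\<close>)
qed

end

section \<open>The operations on the direct sum\<close>

locale graded_frobenius_object = split_frobenius_object +
  fixes Z and i p
  assumes graded_sum: "graded_sum C Z Zc i p"
begin

lemma sum_typing [simp]:
  assumes "sign \<nu>"
  shows "arr (i \<nu>)" "src (i \<nu>) = Zc \<nu>" "tgt (i \<nu>)
      = Z" "arr (p \<nu>)" "src (p \<nu>) = Z" "tgt (p \<nu>) = Zc \<nu>"
  using assms graded_sum by (auto simp: graded_sum_def direct_sum_def sign_def hom_iff)

lemma Z_obj [simp]: "Z \<in> Obj C"
  using graded_sum by (auto simp: graded_sum_def direct_sum_def)

lemma p_i [simp]:
  "p 1 \<bullet> i 1 = Id C (Zc 1)" "p (-1) \<bullet> i (-1) = Id C (Zc (-1))"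
  "p (-1) \<bullet> i 1 = ZeroMor C (Zc 1) (Zc (-1))" "p 1 \<bullet> i (-1) = ZeroMor C (Zc (-1)) (Zc 1)"
  using graded_sum by (auto simp: graded_sum_def direct_sum_def)

lemma i_p: "(i 1 \<bullet> p 1) \<boxplus> (i (-1) \<bullet> p (-1)) = Id C Z"
  using graded_sum by (auto simp: graded_sum_def direct_sum_def)

lemma p_i' [simp]:
  assumes "arr h"
  shows "tgt h = Zc 1 \<Longrightarrow> p 1 \<bullet> i 1 \<bullet> h = h" "tgt h = Zc (-1) \<Longrightarrow> p (-1) \<bullet> i (-1) \<bullet> h = h"
    "tgt h = Zc 1 \<Longrightarrow> p (-1) \<bullet> i 1 \<bullet> h = ZeroMor C (src h) (Zc (-1))"
    "tgt h = Zc (-1) \<Longrightarrow> p 1 \<bullet> i (-1) \<bullet> h = ZeroMor C (src h) (Zc 1)"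
  using assms by (simp_all flip: comp_assoc')

section \<open>Testing equations on homogeneous components\<close>

lemma whiskered_i_p:
  assumes "X \<in> Obj C" "Y \<in> Obj C"
  shows "((Id C X \<boxtimes> (i 1 \<boxtimes> Id C Y)) \<bullet> (Id C X \<boxtimes> (p 1 \<boxtimes> Id C Y)))
    \<boxplus> ((Id C X \<boxtimes> (i (-1) \<boxtimes> Id C Y)) \<bullet> (Id C X \<boxtimes> (p (-1) \<boxtimes> Id C Y))) = Id C (X \<odot> (Z \<odot> Y))"
proof -
  have "Id C X \<boxtimes> (((i 1 \<bullet> p 1) \<boxplus> (i (-1) \<bullet> p (-1))) \<boxtimes> Id C Y) = Id C (X \<odot> (Z \<odot> Y))"
    unfolding i_p using assms by simp
  then show ?thesis
    using assms by (simp add: tensor_comp)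
qed

text \<open>The embeddings stay jointly epic after tensoring, because \<otimes> is biadditive. The
  whiskers X and Y allow the factors of a tensor power of Z to be treated one at a time.\<close>

lemma i_cancel:
  assumes eq: "\<And>\<nu>. sign \<nu> \<Longrightarrow> g \<bullet> (Id C X \<boxtimes> (i \<nu> \<boxtimes> Id C Y)) = h \<bullet> (Id C X \<boxtimes> (i \<nu> \<boxtimes> Id C Y))"
    and [simp]: "X \<in> Obj C" "Y \<in> Obj C" "arr g" "arr h" "src g = X \<odot> (Z \<odot> Y)" "src h = X \<odot> (Z \<odot> Y)"
  shows "g = h"
proof -
  define I where "I \<nu> = Id C X \<boxtimes> (i \<nu> \<boxtimes> Id C Y)" for \<nu>
  define P where "P \<nu> = Id C X \<boxtimes> (p \<nu> \<boxtimes> Id C Y)" for \<nu>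
  have [simp]: "arr (I \<nu>)" "src (I \<nu>) = X \<odot> (Zc \<nu> \<odot> Y)" "tgt (I \<nu>) = X \<odot> (Z \<odot> Y)"
    "arr (P \<nu>)" "src (P \<nu>) = X \<odot> (Z \<odot> Y)" "tgt (P \<nu>) = X \<odot> (Zc \<nu> \<odot> Y)" if "sign \<nu>" for \<nu>
    using that by (simp_all add: I_def P_def)
  have IP: "(I 1 \<bullet> P 1) \<boxplus> (I (-1) \<bullet> P (-1)) = Id C (X \<odot> (Z \<odot> Y))"
    unfolding I_def P_def by (rule whiskered_i_p) simp_all
  have expand: "k = ((k \<bullet> I 1) \<bullet> P 1) \<boxplus> ((k \<bullet> I (-1)) \<bullet> P (-1))"
    if [simp]: "arr k" "src k = X \<odot> (Z \<odot> Y)" for k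
  proof -
    have "k = k \<bullet> ((I 1 \<bullet> P 1) \<boxplus> (I (-1) \<bullet> P (-1)))"
      unfolding IP by simp
    also have "\<dots> = ((k \<bullet> I 1) \<bullet> P 1) \<boxplus> ((k \<bullet> I (-1)) \<bullet> P (-1))"
      by simp
    finally show ?thesis .
  qed
  have "g \<bullet> I \<nu> = h \<bullet> I \<nu>" if "sign \<nu>" for \<nu>
    using eq[OF that] by (simp add: I_def)
  then show ?thesis
    using expand[of g] expand[of h] by (metis assms(4-7) sign_simps(1,2))
qed

lemma p_cancel:
  assumes eq: "\<And>\<nu>. sign \<nu> \<Longrightarrow> (Id C X \<boxtimes> (p \<nu> \<boxtimes> Id C Y)) \<bullet> g = (Id C X \<boxtimes> (p \<nu> \<boxtimes> Id C Y)) \<bullet> h"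
    and [simp]: "X \<in> Obj C" "Y \<in> Obj C" "arr g" "arr h" "tgt g = X \<odot> (Z \<odot> Y)" "tgt h = X \<odot> (Z \<odot> Y)"
  shows "g = h"
proof -
  define I where "I \<nu> = Id C X \<boxtimes> (i \<nu> \<boxtimes> Id C Y)" for \<nu>
  define P where "P \<nu> = Id C X \<boxtimes> (p \<nu> \<boxtimes> Id C Y)" for \<nu>
  have [simp]: "arr (I \<nu>)" "src (I \<nu>) = X \<odot> (Zc \<nu> \<odot> Y)" "tgt (I \<nu>) = X \<odot> (Z \<odot> Y)"
    "arr (P \<nu>)" "src (P \<nu>) = X \<odot> (Z \<odot> Y)" "tgt (P \<nu>) = X \<odot> (Zc \<nu> \<odot> Y)" if "sign \<nu>" for \<nu>
    using that by (simp_all add: I_def P_def)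
  have IP: "(I 1 \<bullet> P 1) \<boxplus> (I (-1) \<bullet> P (-1)) = Id C (X \<odot> (Z \<odot> Y))"
    unfolding I_def P_def by (rule whiskered_i_p) simp_all
  have expand: "k = (I 1 \<bullet> (P 1 \<bullet> k)) \<boxplus> (I (-1) \<bullet> (P (-1) \<bullet> k))"
    if [simp]: "arr k" "tgt k = X \<odot> (Z \<odot> Y)" for k
  proof -
    have "k = ((I 1 \<bullet> P 1) \<boxplus> (I (-1) \<bullet> P (-1))) \<bullet> k"
      unfolding IP by simp
    also have "\<dots> = (I 1 \<bullet> (P 1 \<bullet> k)) \<boxplus> (I (-1) \<bullet> (P (-1) \<bullet> k))"
      by simp
    finally show ?thesis .
  qed
  have "P \<nu> \<bullet> g = P \<nu> \<bullet> h" if "sign \<nu>" for \<nu>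
    using eq[OF that] by (simp add: P_def)
  then show ?thesis
    using expand[of g] expand[of h] by (metis assms(4-7) sign_simps(1,2))
qed

lemma i1_cancel:
  assumes "\<And>\<alpha>. sign \<alpha> \<Longrightarrow> g \<bullet> i \<alpha> = h \<bullet> i \<alpha>"
    and "arr g" "arr h" "src g = Z" "src h = Z"
  shows "g = h"
  by (rule i_cancel[of g "TUnit C" "TUnit C"]) (use assms in simp_all)

lemma i2_cancel:
  assumes eq: "\<And>\<alpha> \<beta>. sign \<alpha> \<Longrightarrow> sign \<beta> \<Longrightarrow> g \<bullet> (i \<alpha> \<boxtimes> i \<beta>) = h \<bullet> (i \<alpha> \<boxtimes> i \<beta>)"
    and [simp]: "arr g" "arr h" "src g = Z \<odot> Z" "src h = Z \<odot> Z"
  shows "g = h"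
proof (rule i_cancel[of g "TUnit C" Z])
  fix \<alpha> assume [simp]: "sign \<alpha>"
  show "g \<bullet> (Id C (TUnit C) \<boxtimes> (i \<alpha> \<boxtimes> Id C Z)) = h \<bullet> (Id C (TUnit C) \<boxtimes> (i \<alpha> \<boxtimes> Id C Z))"
    by (rule i_cancel[of _ "Zc \<alpha>" "TUnit C"]) (simp_all add: tensor_comp eq)
qed simp_all

lemma i3_cancel:
  assumes eq: "\<And>\<alpha> \<beta> \<gamma>. sign \<alpha> \<Longrightarrow> sign \<beta> \<Longrightarrow> sign \<gamma>
      \<Longrightarrow> g \<bullet> (i \<alpha> \<boxtimes> (i \<beta> \<boxtimes> i \<gamma>)) = h \<bullet> (i \<alpha> \<boxtimes> (i \<beta> \<boxtimes> i \<gamma>))"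
    and [simp]: "arr g" "arr h" "src g = Z \<odot> (Z \<odot> Z)" "src h = Z \<odot> (Z \<odot> Z)"
  shows "g = h"
proof (rule i_cancel[of g "TUnit C" "Z \<odot> Z"])
  fix \<alpha> assume [simp]: "sign \<alpha>"
  have "g \<bullet> (i \<alpha> \<boxtimes> Id C (Z \<odot> Z)) = h \<bullet> (i \<alpha> \<boxtimes> Id C (Z \<odot> Z))"
  proof (rule i_cancel[of _ "Zc \<alpha>" Z])
    fix \<beta> assume [simp]: "sign \<beta>"
    show "(g \<bullet> (i \<alpha> \<boxtimes> Id C (Z \<odot> Z))) \<bullet> (Id C (Zc \<alpha>) \<boxtimes> (i \<beta> \<boxtimes> Id C Z))
        = (h \<bullet> (i \<alpha> \<boxtimes> Id C (Z \<odot> Z))) \<bullet> (Id C (Zc \<alpha>) \<boxtimes> (i \<beta> \<boxtimes> Id C Z))"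
      by (rule i_cancel[of _ "Zc \<alpha> \<odot> Zc \<beta>" "TUnit C"])
        (simp_all add: tensor_comp tensor_assoc' eq flip: tensor_id')
  qed simp_all
  then show "g \<bullet> (Id C (TUnit C) \<boxtimes> (i \<alpha> \<boxtimes> Id C (Z \<odot> Z)))
      = h \<bullet> (Id C (TUnit C) \<boxtimes> (i \<alpha> \<boxtimes> Id C (Z \<odot> Z)))"
    by simp
qed simp_all

lemma p3_cancel:
  assumes eq: "\<And>\<alpha> \<beta> \<gamma>. sign \<alpha> \<Longrightarrow> sign \<beta> \<Longrightarrow> sign \<gamma>
      \<Longrightarrow> (p \<alpha> \<boxtimes> (p \<beta> \<boxtimes> p \<gamma>)) \<bullet> g = (p \<alpha> \<boxtimes> (p \<beta> \<boxtimes> p \<gamma>)) \<bullet> h"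
    and [simp]: "arr g" "arr h" "tgt g = Z \<odot> (Z \<odot> Z)" "tgt h = Z \<odot> (Z \<odot> Z)"
  shows "g = h"
proof (rule p_cancel[of "TUnit C" "Z \<odot> Z"])
  fix \<alpha> assume [simp]: "sign \<alpha>"
  have "(p \<alpha> \<boxtimes> Id C (Z \<odot> Z)) \<bullet> g = (p \<alpha> \<boxtimes> Id C (Z \<odot> Z)) \<bullet> h"
  proof (rule p_cancel[of "Zc \<alpha>" Z])
    fix \<beta> assume [simp]: "sign \<beta>"
    show "(Id C (Zc \<alpha>) \<boxtimes> (p \<beta> \<boxtimes> Id C Z)) \<bullet> (p \<alpha> \<boxtimes> Id C (Z \<odot> Z)) \<bullet> g
        = (Id C (Zc \<alpha>) \<boxtimes> (p \<beta> \<boxtimes> Id C Z)) \<bullet> (p \<alpha> \<boxtimes> Id C (Z \<odot> Z)) \<bullet> h"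
      by (rule p_cancel[of "Zc \<alpha> \<odot> Zc \<beta>" "TUnit C"])
        (simp_all add: tensor_comp tensor_comp' tensor_assoc' eq flip: tensor_id')
  qed simp_all
  then show "(Id C (TUnit C) \<boxtimes> (p \<alpha> \<boxtimes> Id C (Z \<odot> Z))) \<bullet> g
      = (Id C (TUnit C) \<boxtimes> (p \<alpha> \<boxtimes> Id C (Z \<odot> Z))) \<bullet> h"
    by simp
qed simp_all

section \<open>The structure morphisms of Z and their restrictions\<close>

definition FZ where
  "FZ = graded_frobenius_data C F Z (\<lambda>\<nu>. \<iota> \<nu> \<bullet> p \<nu>) (\<lambda>\<nu>. i \<nu> \<bullet> \<pi> \<nu>)"

definition NZ where
  "NZ = graded_nakayama C F (\<lambda>\<nu>. \<iota> \<nu> \<bullet> p \<nu>) (\<lambda>\<nu>. i \<nu> \<bullet> \<pi> \<nu>)"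

abbreviation "\<mu> \<equiv> Mul FZ"
abbreviation "\<Delta> \<equiv> Comul FZ"

lemma Car_FZ [simp]: "Car FZ = Z"
  by (simp add: FZ_def graded_frobenius_data_def)

lemma Mul_FZ: "\<mu> = sum_pm C (\<lambda>\<alpha>. sum_pm C (\<lambda>\<beta>. i (\<alpha> * \<beta>) \<bullet> m \<alpha> \<beta> \<bullet> (p \<alpha> \<boxtimes> p \<beta>)))"
proof -
  have "(i (\<alpha> * \<beta>) \<bullet> \<pi> (\<alpha> * \<beta>)) \<bullet> Mul F \<bullet> ((\<iota> \<alpha> \<bullet> p \<alpha>) \<boxtimes> (\<iota> \<beta> \<bullet> p \<beta>))
      = i (\<alpha> * \<beta>) \<bullet> m \<alpha> \<beta> \<bullet> (p \<alpha> \<boxtimes> p \<beta>)"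
    if "sign \<alpha>" "sign \<beta>" for \<alpha> \<beta>
    using that by (simp add: m_def tensor_comp)
  from this[of 1 1] this[of 1 "-1"] this[of "-1" 1] this[of "-1" "-1"]
  show ?thesis
    by (simp add: FZ_def graded_frobenius_data_def sum_pm_def)
qed

lemma Comul_FZ: "\<Delta> = sum_pm C (\<lambda>\<alpha>. sum_pm C (\<lambda>\<beta>. (i \<alpha> \<boxtimes> i \<beta>) \<bullet> d \<alpha> \<beta> \<bullet> p (\<alpha> * \<beta>)))"
proof -
  have "((i \<alpha> \<bullet> \<pi> \<alpha>) \<boxtimes> (i \<beta> \<bullet> \<pi> \<beta>)) \<bullet> Comul F \<bullet> \<iota> (\<alpha> * \<beta>) \<bullet> p (\<alpha> * \<beta>)
      = (i \<alpha> \<boxtimes> i \<beta>) \<bullet> d \<alpha> \<beta> \<bullet> p (\<alpha> * \<beta>)"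
    if "sign \<alpha>" "sign \<beta>" for \<alpha> \<beta>
    using that by (simp add: d_def tensor_comp')
  from this[of 1 1] this[of 1 "-1"] this[of "-1" 1] this[of "-1" "-1"]
  show ?thesis
    by (simp add: FZ_def graded_frobenius_data_def sum_pm_def)
qed

lemma Unit_FZ: "Unit FZ = i 1 \<bullet> u"
  by (simp add: FZ_def graded_frobenius_data_def u_def)

lemma Counit_FZ: "Counit FZ = e \<bullet> p 1"
  by (simp add: FZ_def graded_frobenius_data_def e_def)

lemma NZ_eq: "NZ = sum_pm C (\<lambda>\<nu>. i \<nu> \<bullet> n \<nu> \<bullet> p \<nu>)"
  by (simp add: NZ_def graded_nakayama_def sum_pm_def n_def)

lemma FZ_typing [simp]:
  "arr \<mu>" "src \<mu> = Z \<odot> Z" "tgt \<mu> = Z" "arr \<Delta>" "src \<Delta> = Z" "tgt \<Delta> = Z \<odot> Z"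
  "arr (Unit FZ)" "src (Unit FZ) = TUnit C" "tgt (Unit FZ) = Z"
  "arr (Counit FZ)" "src (Counit FZ) = Z" "tgt (Counit FZ) = TUnit C"
  "arr NZ" "src NZ = Z" "tgt NZ = Z"
  unfolding Mul_FZ Comul_FZ Unit_FZ Counit_FZ NZ_eq sum_pm_def by simp_all

lemma mu_i:
  assumes "sign \<alpha>" "sign \<beta>"
  shows "\<mu> \<bullet> (i \<alpha> \<boxtimes> i \<beta>) = i (\<alpha> * \<beta>) \<bullet> m \<alpha> \<beta>"
  using assms unfolding Mul_FZ sum_pm_def sign_def by (auto simp: tensor_comp)

lemma delta_i:
  assumes "sign \<gamma>"
  shows "\<Delta> \<bullet> i \<gamma> = sum_pm C (\<lambda>\<alpha>. (i \<alpha> \<boxtimes> i (\<alpha> * \<gamma>)) \<bullet> d \<alpha> (\<alpha> * \<gamma>))"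
  using assms unfolding Comul_FZ sum_pm_def sign_def by auto

lemma p_delta:
  assumes "sign \<alpha>" "sign \<beta>"
  shows "(p \<alpha> \<boxtimes> p \<beta>) \<bullet> \<Delta> = d \<alpha> \<beta> \<bullet> p (\<alpha> * \<beta>)"
  using assms unfolding Comul_FZ sum_pm_def sign_def by (auto simp: tensor_comp')

text \<open>With the degrees of the input and of one output leg fixed, the grading leaves a single
  summand. This keeps sums out of the Frobenius relations, where the other leg feeds into
  \<mu>.\<close>

lemma p_delta_i:
  assumes "sign \<alpha>" "sign \<gamma>"
  shows "(p \<alpha> \<boxtimes> Id C Z) \<bullet> \<Delta> \<bullet> i \<gamma> = (Id C (Zc \<alpha>) \<boxtimes> i (\<alpha> * \<gamma>)) \<bullet> d \<alpha> (\<alpha> * \<gamma>)"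
    "(Id C Z \<boxtimes> p \<alpha>) \<bullet> \<Delta> \<bullet> i \<gamma> = (i (\<gamma> * \<alpha>) \<boxtimes> Id C (Zc \<alpha>)) \<bullet> d (\<gamma> * \<alpha>) \<alpha>"
  using assms unfolding delta_i[OF assms(2)] sum_pm_def sign_def by (auto simp: tensor_comp')

lemma NZ_i:
  assumes "sign \<nu>"
  shows "NZ \<bullet> i \<nu> = i \<nu> \<bullet> n \<nu>"
  using assms unfolding NZ_eq sum_pm_def sign_def by auto

lemma Z_mul_assoc: "\<mu> \<bullet> (\<mu> \<boxtimes> Id C Z) = \<mu> \<bullet> (Id C Z \<boxtimes> \<mu>)"
proof (rule i3_cancel)
  fix \<alpha> \<beta> \<gamma> assume s [simp]: "sign \<alpha>" "sign \<beta>" "sign \<gamma>"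
  have "(\<mu> \<bullet> (\<mu> \<boxtimes> Id C Z)) \<bullet> (i \<alpha> \<boxtimes> (i \<beta> \<boxtimes> i \<gamma>)) = \<mu> \<bullet> (\<mu> \<boxtimes> Id C Z) \<bullet> ((i \<alpha> \<boxtimes> i \<beta>) \<boxtimes> i \<gamma>)"
    by (simp add: tensor_assoc')
  also have "\<dots> = \<mu> \<bullet> (i (\<alpha> * \<beta>) \<boxtimes> i \<gamma>) \<bullet> (m \<alpha> \<beta> \<boxtimes> Id C (Zc \<gamma>))"
    by (simp add: tensor_comp mu_i)
  also have "\<dots> = i (\<alpha> * \<beta> * \<gamma>) \<bullet> m (\<alpha> * \<beta>) \<gamma> \<bullet> (m \<alpha> \<beta> \<boxtimes> Id C (Zc \<gamma>))"
    using comp_cong[OF mu_i[of "\<alpha> * \<beta>" \<gamma>], of "m \<alpha> \<beta> \<boxtimes> Id C (Zc \<gamma>)"] by simp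
  also have "\<dots> = i (\<alpha> * (\<beta> * \<gamma>)) \<bullet> m \<alpha> (\<beta> * \<gamma>) \<bullet> (Id C (Zc \<alpha>) \<boxtimes> m \<beta> \<gamma>)"
    by (simp add: m_assoc mult.assoc)
  also have "\<dots> = \<mu> \<bullet> (i \<alpha> \<boxtimes> i (\<beta> * \<gamma>)) \<bullet> (Id C (Zc \<alpha>) \<boxtimes> m \<beta> \<gamma>)"
    using comp_cong[OF mu_i[of \<alpha> "\<beta> * \<gamma>"], of "Id C (Zc \<alpha>) \<boxtimes> m \<beta> \<gamma>"] by simp
  also have "\<dots> = (\<mu> \<bullet> (Id C Z \<boxtimes> \<mu>)) \<bullet> (i \<alpha> \<boxtimes> (i \<beta> \<boxtimes> i \<gamma>))"
    by (simp add: tensor_comp mu_i)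
  finally show "(\<mu> \<bullet> (\<mu> \<boxtimes> Id C Z)) \<bullet> (i \<alpha> \<boxtimes> (i \<beta> \<boxtimes> i \<gamma>))
      = (\<mu> \<bullet> (Id C Z \<boxtimes> \<mu>)) \<bullet> (i \<alpha> \<boxtimes> (i \<beta> \<boxtimes> i \<gamma>))" .
qed simp_all

lemma Z_unit: "\<mu> \<bullet> (Unit FZ \<boxtimes> Id C Z) = Id C Z" "\<mu> \<bullet> (Id C Z \<boxtimes> Unit FZ) = Id C Z"
proof -
  show "\<mu> \<bullet> (Unit FZ \<boxtimes> Id C Z) = Id C Z"
  proof (rule i1_cancel)
    fix \<alpha> assume s [simp]: "sign \<alpha>"
    have "(Unit FZ \<boxtimes> Id C Z) \<bullet> i \<alpha> = (i 1 \<boxtimes> i \<alpha>) \<bullet> (u \<boxtimes> Id C (Zc \<alpha>))"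
      using tensor_comp[of "Id C (TUnit C)" "Unit FZ" "i \<alpha>" "Id C Z"]
        by (simp add: tensor_comp Unit_FZ)
    then show "(\<mu> \<bullet> (Unit FZ \<boxtimes> Id C Z)) \<bullet> i \<alpha> = Id C Z \<bullet> i \<alpha>"
      using comp_cong[OF mu_i[of 1 \<alpha>], of "u \<boxtimes> Id C (Zc \<alpha>)"] by (simp add: m_unit)
  qed simp_all
  show "\<mu> \<bullet> (Id C Z \<boxtimes> Unit FZ) = Id C Z"
  proof (rule i1_cancel)
    fix \<alpha> assume s [simp]: "sign \<alpha>"
    have "(Id C Z \<boxtimes> Unit FZ) \<bullet> i \<alpha> = (i \<alpha> \<boxtimes> i 1) \<bullet> (Id C (Zc \<alpha>) \<boxtimes> u)"
      using tensor_comp[of "i \<alpha>" "Id C Z" "Id C (TUnit C)" "Unit FZ"]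
        by (simp add: tensor_comp Unit_FZ)
    then show "(\<mu> \<bullet> (Id C Z \<boxtimes> Unit FZ)) \<bullet> i \<alpha> = Id C Z \<bullet> i \<alpha>"
      using comp_cong[OF mu_i[of \<alpha> 1], of "Id C (Zc \<alpha>) \<boxtimes> u"] by (simp add: m_unit)
  qed simp_all
qed

lemma Z_comul_coassoc: "(\<Delta> \<boxtimes> Id C Z) \<bullet> \<Delta> = (Id C Z \<boxtimes> \<Delta>) \<bullet> \<Delta>"
proof (rule p3_cancel)
  fix \<alpha> \<beta> \<gamma> assume s [simp]: "sign \<alpha>" "sign \<beta>" "sign \<gamma>"
  have "(p \<alpha> \<boxtimes> (p \<beta> \<boxtimes> p \<gamma>)) \<bullet> (\<Delta> \<boxtimes> Id C Z) \<bullet> \<Delta> = ((p \<alpha> \<boxtimes> p \<beta>) \<boxtimes> p \<gamma>) \<bullet> (\<Delta> \<boxtimes> Id C Z) \<bullet> \<Delta>"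
    by (simp add: tensor_assoc')
  also have "\<dots> = ((d \<alpha> \<beta> \<bullet> p (\<alpha> * \<beta>)) \<boxtimes> p \<gamma>) \<bullet> \<Delta>"
    by (simp add: tensor_comp' p_delta)
  also have "\<dots> = (d \<alpha> \<beta> \<boxtimes> Id C (Zc \<gamma>)) \<bullet> (p (\<alpha> * \<beta>) \<boxtimes> p \<gamma>) \<bullet> \<Delta>"
    by (simp add: tensor_comp')
  also have "\<dots> = ((d \<alpha> \<beta> \<boxtimes> Id C (Zc \<gamma>)) \<bullet> d (\<alpha> * \<beta>) \<gamma>) \<bullet> p (\<alpha> * \<beta> * \<gamma>)"
    by (simp add: p_delta)
  also have "\<dots> = (Id C (Zc \<alpha>) \<boxtimes> d \<beta> \<gamma>) \<bullet> (p \<alpha> \<boxtimes> p (\<beta> * \<gamma>)) \<bullet> \<Delta>"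
    by (simp only: d_coassoc s) (simp add: p_delta mult.assoc)
  also have "\<dots> = (p \<alpha> \<boxtimes> (d \<beta> \<gamma> \<bullet> p (\<beta> * \<gamma>))) \<bullet> \<Delta>"
    by (simp add: tensor_comp')
  also have "\<dots> = (p \<alpha> \<boxtimes> (p \<beta> \<boxtimes> p \<gamma>)) \<bullet> (Id C Z \<boxtimes> \<Delta>) \<bullet> \<Delta>"
    by (simp add: tensor_comp' p_delta)
  finally show "(p \<alpha> \<boxtimes> (p \<beta> \<boxtimes> p \<gamma>)) \<bullet> (\<Delta> \<boxtimes> Id C Z) \<bullet> \<Delta> = (p \<alpha> \<boxtimes> (p \<beta> \<boxtimes> p \<gamma>)) \<bullet> (Id C Z \<boxtimes> \<Delta>) \<bullet> \<Delta>" .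
qed simp_all

lemma p1_cancel:
  assumes "\<And>\<alpha>. sign \<alpha> \<Longrightarrow> p \<alpha> \<bullet> g = p \<alpha> \<bullet> h"
    and "arr g" "arr h" "tgt g = Z" "tgt h = Z"
  shows "g = h"
  by (rule p_cancel[of "TUnit C" "TUnit C"]) (use assms in simp_all)

lemma Z_counit: "(Counit FZ \<boxtimes> Id C Z) \<bullet> \<Delta> = Id C Z" "(Id C Z \<boxtimes> Counit FZ) \<bullet> \<Delta> = Id C Z"
proof -
  show "(Counit FZ \<boxtimes> Id C Z) \<bullet> \<Delta> = Id C Z"
  proof (rule p1_cancel)
    fix \<alpha> assume s [simp]: "sign \<alpha>"
    have "p \<alpha> \<bullet> (Counit FZ \<boxtimes> Id C Z) = (e \<boxtimes> Id C (Zc \<alpha>)) \<bullet> (p 1 \<boxtimes> p \<alpha>)"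
      using tensor_comp[of "Counit FZ" "Id C (TUnit C)" "Id C Z" "p \<alpha>"]
        by (simp add: tensor_comp Counit_FZ)
    from comp_cong[OF this, of \<Delta>]
    have "p \<alpha> \<bullet> (Counit FZ \<boxtimes> Id C Z) \<bullet> \<Delta> = ((e \<boxtimes> Id C (Zc \<alpha>)) \<bullet> d 1 \<alpha>) \<bullet> p \<alpha>"
      by (simp add: p_delta)
    then show "p \<alpha> \<bullet> (Counit FZ \<boxtimes> Id C Z) \<bullet> \<Delta> = p \<alpha> \<bullet> Id C Z"
      by (simp only: d_counit s) simp
  qed simp_all
  show "(Id C Z \<boxtimes> Counit FZ) \<bullet> \<Delta> = Id C Z"
  proof (rule p1_cancel)
    fix \<alpha> assume s [simp]: "sign \<alpha>"
    have "p \<alpha> \<bullet> (Id C Z \<boxtimes> Counit FZ) = (Id C (Zc \<alpha>) \<boxtimes> e) \<bullet> (p \<alpha> \<boxtimes> p 1)"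
      using tensor_comp[of "Id C Z" "p \<alpha>" "Counit FZ" "Id C (TUnit C)"]
        by (simp add: tensor_comp Counit_FZ)
    from comp_cong[OF this, of \<Delta>]
    have "p \<alpha> \<bullet> (Id C Z \<boxtimes> Counit FZ) \<bullet> \<Delta> = ((Id C (Zc \<alpha>) \<boxtimes> e) \<bullet> d \<alpha> 1) \<bullet> p \<alpha>"
      by (simp add: p_delta)
    then show "p \<alpha> \<bullet> (Id C Z \<boxtimes> Counit FZ) \<bullet> \<Delta> = p \<alpha> \<bullet> Id C Z"
      by (simp only: d_counit s) simp
  qed simp_all
qed

lemma Z_frobenius:
  "(Id C Z \<boxtimes> \<mu>) \<bullet> (\<Delta> \<boxtimes> Id C Z) = \<Delta> \<bullet> \<mu>" "(\<mu> \<boxtimes> Id C Z) \<bullet> (Id C Z \<boxtimes> \<Delta>) = \<Delta> \<bullet> \<mu>"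
proof -
  show "(Id C Z \<boxtimes> \<mu>) \<bullet> (\<Delta> \<boxtimes> Id C Z) = \<Delta> \<bullet> \<mu>"
  proof (rule i2_cancel)
    fix \<delta> \<gamma> assume s [simp]: "sign \<delta>" "sign \<gamma>"
    show "((Id C Z \<boxtimes> \<mu>) \<bullet> (\<Delta> \<boxtimes> Id C Z)) \<bullet> (i \<delta> \<boxtimes> i \<gamma>) = (\<Delta> \<bullet> \<mu>) \<bullet> (i \<delta> \<boxtimes> i \<gamma>)"
    proof (rule p_cancel[of "TUnit C" Z])
      fix \<alpha> assume t [simp]: "sign \<alpha>"
      \<comment> \<open>The degree of the inner leg of \<Delta> on Z_\<delta> when the outer leg has
        degree \<alpha>, since signs are their own inverses.\<close>
      let ?\<beta> = "\<alpha> * \<delta>"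
      have "(p \<alpha> \<boxtimes> Id C Z) \<bullet> (Id C Z \<boxtimes> \<mu>) \<bullet> (\<Delta> \<boxtimes> Id C Z) \<bullet> (i \<delta> \<boxtimes> i \<gamma>)
          = (Id C (Zc \<alpha>) \<boxtimes> \<mu>) \<bullet> (p \<alpha> \<boxtimes> (Id C Z \<boxtimes> Id C Z)) \<bullet> ((\<Delta> \<bullet> i \<delta>) \<boxtimes> i \<gamma>)"
        by (simp add: tensor_comp tensor_comp')
      \<comment> \<open>The two identities are kept unmerged so that one of them can be regrouped
        with the projection of the outer leg.\<close>
      also have "(p \<alpha> \<boxtimes> (Id C Z \<boxtimes> Id C Z)) \<bullet> ((\<Delta> \<bullet> i \<delta>) \<boxtimes> i \<gamma>) = ((p \<alpha> \<boxtimes> Id C Z) \<bullet> \<Delta> \<bullet> i \<delta>) \<boxtimes> i \<gamma>"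
        by (simp add: tensor_comp del: tensor_id' flip: tensor_assoc')
      also have "\<dots> = (Id C (Zc \<alpha>) \<boxtimes> (i ?\<beta> \<boxtimes> i \<gamma>)) \<bullet> (d \<alpha> ?\<beta> \<boxtimes> Id C (Zc \<gamma>))"
        by (simp add: p_delta_i tensor_comp flip: tensor_assoc')
      also have "(Id C (Zc \<alpha>) \<boxtimes> \<mu>) \<bullet> \<dots>
          = (Id C (Zc \<alpha>) \<boxtimes> i (?\<beta> * \<gamma>)) \<bullet> (Id C (Zc \<alpha>) \<boxtimes> m ?\<beta> \<gamma>) \<bullet> (d \<alpha> ?\<beta> \<boxtimes> Id C (Zc \<gamma>))"
        by (simp add: tensor_comp' mu_i sign_square)
      also have "(Id C (Zc \<alpha>) \<boxtimes> m ?\<beta> \<gamma>) \<bullet> (d \<alpha> ?\<beta> \<boxtimes> Id C (Zc \<gamma>)) = d \<alpha> (\<alpha> * (\<delta> * \<gamma>)) \<bullet> m \<delta> \<gamma>"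
        using m_d[of \<alpha> ?\<beta> \<gamma>] by (simp add: sign_square mult.assoc)
      also have "(Id C (Zc \<alpha>) \<boxtimes> i (?\<beta> * \<gamma>)) \<bullet> \<dots> = (p \<alpha> \<boxtimes> Id C Z) \<bullet> \<Delta> \<bullet> i (\<delta> * \<gamma>) \<bullet> m \<delta> \<gamma>"
        using arg_cong[OF p_delta_i(1)[of \<alpha> "\<delta> * \<gamma>"], of "\<lambda>x. x \<bullet> m \<delta> \<gamma>"]
        by (simp add: mult.assoc sign_square)
      also have "\<dots> = (p \<alpha> \<boxtimes> Id C Z) \<bullet> \<Delta> \<bullet> \<mu> \<bullet> (i \<delta> \<boxtimes> i \<gamma>)"
        by (simp add: mu_i)
      finally show "(Id C (TUnit C) \<boxtimes> (p \<alpha> \<boxtimes> Id C Z)) \<bullet> ((Id C Z \<boxtimes> \<mu>) \<bullet> (\<Delta> \<boxtimes> Id C Z)) \<bullet> (i \<delta> \<boxtimes> i \<gamma>)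
          = (Id C (TUnit C) \<boxtimes> (p \<alpha> \<boxtimes> Id C Z)) \<bullet> (\<Delta> \<bullet> \<mu>) \<bullet> (i \<delta> \<boxtimes> i \<gamma>)"
        by simp
    qed simp_all
  qed simp_all
  show "(\<mu> \<boxtimes> Id C Z) \<bullet> (Id C Z \<boxtimes> \<Delta>) = \<Delta> \<bullet> \<mu>"
  proof (rule i2_cancel)
    fix \<gamma> \<delta> assume s [simp]: "sign \<gamma>" "sign \<delta>"
    show "((\<mu> \<boxtimes> Id C Z) \<bullet> (Id C Z \<boxtimes> \<Delta>)) \<bullet> (i \<gamma> \<boxtimes> i \<delta>) = (\<Delta> \<bullet> \<mu>) \<bullet> (i \<gamma> \<boxtimes> i \<delta>)"
    proof (rule p_cancel[of Z "TUnit C"])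
      fix \<alpha> assume t [simp]: "sign \<alpha>"
      let ?\<beta> = "\<delta> * \<alpha>"
      have \<beta>: "?\<beta> * \<alpha> = \<delta>" "\<gamma> * \<delta> * \<alpha> = \<gamma> * ?\<beta>"
        using s t by (auto simp: sign_def)
      have "(Id C Z \<boxtimes> p \<alpha>) \<bullet> (\<mu> \<boxtimes> Id C Z) \<bullet> (Id C Z \<boxtimes> \<Delta>) \<bullet> (i \<gamma> \<boxtimes> i \<delta>)
          = (\<mu> \<boxtimes> Id C (Zc \<alpha>)) \<bullet> ((Id C Z \<boxtimes> Id C Z) \<boxtimes> p \<alpha>) \<bullet> (i \<gamma> \<boxtimes> (\<Delta> \<bullet> i \<delta>))"
        by (simp add: tensor_comp tensor_comp')
      also have "((Id C Z \<boxtimes> Id C Z) \<boxtimes> p \<alpha>) \<bullet> (i \<gamma> \<boxtimes> (\<Delta> \<bullet> i \<delta>)) = i \<gamma> \<boxtimes> ((Id C Z \<boxtimes> p \<alpha>) \<bullet> \<Delta> \<bullet> i \<delta>)"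
        by (simp add: tensor_comp tensor_assoc' del: tensor_id')
      also have "\<dots> = ((i \<gamma> \<boxtimes> i ?\<beta>) \<boxtimes> Id C (Zc \<alpha>)) \<bullet> (Id C (Zc \<gamma>) \<boxtimes> d ?\<beta> \<alpha>)"
        by (simp add: p_delta_i tensor_comp tensor_assoc')
      also have "(\<mu> \<boxtimes> Id C (Zc \<alpha>)) \<bullet> \<dots>
          = (i (\<gamma> * ?\<beta>) \<boxtimes> Id C (Zc \<alpha>)) \<bullet> (m \<gamma> ?\<beta> \<boxtimes> Id C (Zc \<alpha>)) \<bullet> (Id C (Zc \<gamma>) \<boxtimes> d ?\<beta> \<alpha>)"
        by (simp add: tensor_comp' mu_i \<beta>)
      also have "(m \<gamma> ?\<beta> \<boxtimes> Id C (Zc \<alpha>)) \<bullet> (Id C (Zc \<gamma>) \<boxtimes> d ?\<beta> \<alpha>) = d (\<gamma> * ?\<beta>) \<alpha> \<bullet> m \<gamma> \<delta>"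
        using m_d'[of \<gamma> ?\<beta> \<alpha>] by (simp only: \<beta> s t sign_simps)
      also have "(i (\<gamma> * ?\<beta>) \<boxtimes> Id C (Zc \<alpha>)) \<bullet> d (\<gamma> * ?\<beta>) \<alpha> \<bullet> m \<gamma> \<delta>
          = (Id C Z \<boxtimes> p \<alpha>) \<bullet> \<Delta> \<bullet> i (\<gamma> * \<delta>) \<bullet> m \<gamma> \<delta>"
        using arg_cong[OF p_delta_i(2)[of \<alpha> "\<gamma> * \<delta>"], of "\<lambda>x. x \<bullet> m \<gamma> \<delta>"]
        by (simp add: mult.assoc sign_square)
      also have "\<dots> = (Id C Z \<boxtimes> p \<alpha>) \<bullet> \<Delta> \<bullet> \<mu> \<bullet> (i \<gamma> \<boxtimes> i \<delta>)"
        by (simp add: mu_i)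
      finally show "(Id C Z \<boxtimes> (p \<alpha> \<boxtimes> Id C (TUnit C))) \<bullet> ((\<mu> \<boxtimes> Id C Z) \<bullet> (Id C Z \<boxtimes> \<Delta>)) \<bullet> (i \<gamma> \<boxtimes> i \<delta>)
          = (Id C Z \<boxtimes> (p \<alpha> \<boxtimes> Id C (TUnit C))) \<bullet> (\<Delta> \<bullet> \<mu>) \<bullet> (i \<gamma> \<boxtimes> i \<delta>)"
        by simp
    qed simp_all
  qed simp_all
qed

lemma Z_frobenius_algebra: "frobenius_algebra C FZ"
  by (simp add: frobenius_algebra_def algebra_def coalgebra_def hom_iff
      Z_mul_assoc Z_unit Z_comul_coassoc Z_counit Z_frobenius)

lemma Z_graded: "Z2_graded_frobenius_algebra C FZ Zc i p"
  unfolding Z2_graded_frobenius_algebra_def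
proof (intro conjI ballI)
  show "frobenius_algebra C FZ" by (rule Z_frobenius_algebra)
  show "graded_sum C (Car FZ) Zc i p" by (simp add: graded_sum)
  show "\<exists>x\<in>Hom C (Zc \<alpha> \<odot> Zc \<beta>) (Zc (\<alpha> * \<beta>)). \<mu> \<bullet> (i \<alpha> \<boxtimes> i \<beta>) = i (\<alpha> * \<beta>) \<bullet> x"
    if "\<alpha> \<in> {1, -1}" "\<beta> \<in> {1, -1}" for \<alpha> \<beta>
  proof -
    have s: "sign \<alpha>" "sign \<beta>" using that by (simp_all only: sign_def)
    show ?thesis
      by (intro bexI[of _ "m \<alpha> \<beta>"] mu_i) (simp_all add: hom_iff s)
  qed
  show "\<exists>x\<in>Hom C (TUnit C) (Zc 1). Unit FZ = i 1 \<bullet> x"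
    by (intro bexI[of _ u] Unit_FZ) (simp add: hom_iff)
  show "\<exists>x. (\<forall>\<alpha>\<in>{1, -1}. x \<alpha> \<in> Hom C (Zc \<gamma>) (Zc \<alpha> \<odot> Zc (\<alpha> * \<gamma>)))
      \<and> \<Delta> \<bullet> i \<gamma> = sum_pm C (\<lambda>\<alpha>. (i \<alpha> \<boxtimes> i (\<alpha> * \<gamma>)) \<bullet> x \<alpha>)"
    if "\<gamma> \<in> {1, -1}" for \<gamma>
  proof -
    have s: "sign \<gamma>" using that by (simp only: sign_def)
    have "d \<alpha> (\<alpha> * \<gamma>) \<in> Hom C (Zc \<gamma>) (Zc \<alpha> \<odot> Zc (\<alpha> * \<gamma>))" if "sign \<alpha>" for \<alpha>
      using that s by (simp add: hom_iff sign_square)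
    then show ?thesis
      by (intro exI[of _ "\<lambda>\<alpha>. d \<alpha> (\<alpha> * \<gamma>)"] conjI delta_i s) (simp_all add: sign_def)
  qed
  show "Counit FZ \<bullet> i (-1) = ZeroMor C (Zc (-1)) (TUnit C)"
    by (simp add: Counit_FZ)
qed

lemma signed_i:
  assumes "sign \<nu>"
  shows "signed C Z NZ \<gamma> \<bullet> i \<nu> = i \<nu> \<bullet> signed C (Zc \<nu>) (n \<nu>) \<gamma>"
  using assms by (simp add: signed_def NZ_i)

lemma mu_signed:
  assumes s: "sign \<alpha>" "sign \<beta>"
  shows "\<mu> \<bullet> (signed C Z NZ \<gamma> \<boxtimes> Id C Z) \<bullet> (i \<alpha> \<boxtimes> i \<beta>)
      = i (\<alpha> * \<beta>) \<bullet> m \<alpha> \<beta> \<bullet> (signed C (Zc \<alpha>) (n \<alpha>) \<gamma> \<boxtimes> Id C (Zc \<beta>))"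
    "\<mu> \<bullet> (Id C Z \<boxtimes> signed C Z NZ \<gamma>) \<bullet> (i \<alpha> \<boxtimes> i \<beta>)
      = i (\<alpha> * \<beta>) \<bullet> m \<alpha> \<beta> \<bullet> (Id C (Zc \<alpha>) \<boxtimes> signed C (Zc \<beta>) (n \<beta>) \<gamma>)"
  using s comp_cong[OF mu_i[OF s], of "signed C (Zc \<alpha>) (n \<alpha>) \<gamma> \<boxtimes> Id C (Zc \<beta>)"]
    comp_cong[OF mu_i[OF s], of "Id C (Zc \<alpha>) \<boxtimes> signed C (Zc \<beta>) (n \<beta>) \<gamma>"]
  by (simp_all add: tensor_comp signed_i)

lemma mu_braid:
  assumes s: "sign \<alpha>" "sign \<beta>"
  shows "\<mu> \<bullet> Braid C Z Z \<bullet> (i \<alpha> \<boxtimes> i \<beta>) = i (\<alpha> * \<beta>) \<bullet> m \<beta> \<alpha> \<bullet> Braid C (Zc \<alpha>) (Zc \<beta>)"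
proof -
  have "Braid C Z Z \<bullet> (i \<alpha> \<boxtimes> i \<beta>) = (i \<beta> \<boxtimes> i \<alpha>) \<bullet> Braid C (Zc \<alpha>) (Zc \<beta>)"
    using s by (intro braid_natural) (simp_all add: hom_iff)
  then show ?thesis
    using s comp_cong[OF mu_i[of \<beta> \<alpha>], of "Braid C (Zc \<alpha>) (Zc \<beta>)"] by (simp add: mult.commute)
qed

lemma Z_commutative:
  assumes s: "sign \<alpha>" "sign \<beta>" and \<gamma>: "\<gamma> = (if \<alpha> = -1 \<and> \<beta> = -1 then -1 else 1)"
  shows "\<mu> \<bullet> Braid C Z Z \<bullet> (i \<alpha> \<boxtimes> i \<beta>) = \<mu> \<bullet> (signed C Z NZ \<gamma> \<boxtimes> Id C Z) \<bullet> (i \<alpha> \<boxtimes> i \<beta>)"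
    "\<mu> \<bullet> Braid C Z Z \<bullet> (i \<alpha> \<boxtimes> i \<beta>) = \<mu> \<bullet> (Id C Z \<boxtimes> signed C Z NZ \<gamma>) \<bullet> (i \<alpha> \<boxtimes> i \<beta>)"
  unfolding mu_braid[OF s] mu_signed[OF s] using m_braid[OF s \<gamma>] by simp_all

lemma NZ_NZ: "NZ \<bullet> NZ = Id C Z"
proof (rule i1_cancel)
  fix \<alpha> assume s [simp]: "sign \<alpha>"
  have "NZ \<bullet> i \<alpha> \<bullet> n \<alpha> = i \<alpha> \<bullet> n \<alpha> \<bullet> n \<alpha>"
    by (intro comp_cong NZ_i) simp_all
  then show "(NZ \<bullet> NZ) \<bullet> i \<alpha> = Id C Z \<bullet> i \<alpha>"
    by (simp add: NZ_i n_n)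
qed simp_all

lemma NZ_i_1: "NZ \<bullet> i 1 = i 1"
  by (simp add: NZ_i n_1)

text \<open>By uniqueness it suffices to check b_Z (id \<otimes> N^Z) = b_Z \<sigma> on homogeneous
  arguments, where the right side is graded commutativity followed by the counit.\<close>

lemma nakayama_FZ: "nakayama C FZ = NZ"
proof -
  interpret Zf: frobenius_object C FZ
    by unfold_locales (rule Z_frobenius_algebra)
  have b [simp]: "arr (frobenius_pairing C FZ)" "src (frobenius_pairing C FZ) = Z \<odot> Z"
    by (simp_all add: frobenius_pairing_def)
  have "frobenius_pairing C FZ \<bullet> (Id C Z \<boxtimes> NZ) = frobenius_pairing C FZ \<bullet> Braid C Z Z"
  proof (rule i2_cancel)
    fix \<alpha> \<beta> assume s [simp]: "sign \<alpha>" "sign \<beta>"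
    define \<gamma> :: int where "\<gamma> = (if \<alpha> = -1 \<and> \<beta> = -1 then -1 else 1)"
    have l: "(frobenius_pairing C FZ \<bullet> (Id C Z \<boxtimes> NZ)) \<bullet> (i \<alpha> \<boxtimes> i \<beta>)
        = Counit FZ \<bullet> i (\<alpha> * \<beta>) \<bullet> m \<alpha> \<beta> \<bullet> (Id C (Zc \<alpha>) \<boxtimes> n \<beta>)"
      using mu_signed(2)[OF s, of "-1"] by (simp add: frobenius_pairing_def signed_def)
    have r: "(frobenius_pairing C FZ \<bullet> Braid C Z Z) \<bullet> (i \<alpha> \<boxtimes> i \<beta>)
        = Counit FZ \<bullet> i (\<alpha> * \<beta>) \<bullet> m \<alpha> \<beta> \<bullet> (Id C (Zc \<alpha>) \<boxtimes> signed C (Zc \<beta>) (n \<beta>) \<gamma>)"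
      using mu_braid[OF s] m_braid(2)[OF s \<gamma>_def] by (simp add: frobenius_pairing_def)
    \<comment> \<open>The twists n_\<beta> and N_\<gamma> can disagree only in the first case; there
      the product has degree -1, so the counit makes both sides zero. For \<beta> = 1 both are the
      identity, for \<alpha> = \<beta> = -1 both are n.\<close>
    consider "\<alpha> = 1" "\<beta> = -1" | "\<beta> = 1" | "\<alpha> = -1" "\<beta> = -1"
      using s by (auto simp: sign_def)
    then show "(frobenius_pairing C FZ \<bullet> (Id C Z \<boxtimes> NZ)) \<bullet> (i \<alpha> \<boxtimes> i \<beta>)
        = (frobenius_pairing C FZ \<bullet> Braid C Z Z) \<bullet> (i \<alpha> \<boxtimes> i \<beta>)"
    proof cases
      case 1
      then show ?thesis
        unfolding l r by (simp add: Counit_FZ)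
    qed (unfold l r, simp_all add: \<gamma>_def signed_def n_1)
  qed simp_all
  then show ?thesis
    by (intro Zf.nakayama_unique) (simp_all add: hom_iff)
qed

end

theorem proposition4p23:
  fixes C :: "('o, 'm) cat_data" (structure)
    and A :: "('o, 'm) frobenius_data"
    and Z :: 'o and Zc :: "int \<Rightarrow> 'o"
    and \<iota>A \<pi>A \<iota>Z \<pi>Z :: "int \<Rightarrow> 'm"
  assumes "additive_symmetric_strict_monoidal_category C"
    and "frobenius_algebra C A"
    and "delta_separable C A"
    and "nakayama C A \<bullet> nakayama C A = Id C (Car A)"
    and "\<forall>\<nu>\<in>{1, -1}. splitting C (Car A) (q_idem C A \<nu>) (Zc \<nu>) (\<iota>A \<nu>) (\<pi>A \<nu>)"
    and "graded_sum C Z Zc \<iota>Z \<pi>Z"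
  shows "let e = (\<lambda>\<nu>. \<iota>A \<nu> \<bullet> \<pi>Z \<nu>);
             f = (\<lambda>\<nu>. \<iota>Z \<nu> \<bullet> \<pi>A \<nu>);
             FZ = graded_frobenius_data C A Z e f;
             \<mu>Z = Mul FZ;
             NZ = graded_nakayama C A e f
         in Z2_graded_frobenius_algebra C FZ Zc \<iota>Z \<pi>Z \<and>
            (nakayama C FZ = NZ \<and> NZ \<bullet> NZ = Id C Z \<and> NZ \<bullet> \<iota>Z 1 = \<iota>Z 1) \<and>
            (\<forall>\<alpha>\<in>{1, -1}. \<forall>\<beta>\<in>{1, -1}.
               let \<gamma> = (if \<alpha> = -1 \<and> \<beta> = -1 then -1 else 1) in
               \<mu>Z \<bullet> Braid C Z Z \<bullet> (\<iota>Z \<alpha> \<boxtimes> \<iota>Z \<beta>)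
                 = \<mu>Z \<bullet> (signed C Z NZ \<gamma> \<boxtimes> Id C Z) \<bullet> (\<iota>Z \<alpha> \<boxtimes> \<iota>Z \<beta>) \<and>
               \<mu>Z \<bullet> (signed C Z NZ \<gamma> \<boxtimes> Id C Z) \<bullet> (\<iota>Z \<alpha> \<boxtimes> \<iota>Z \<beta>)
                 = \<mu>Z \<bullet> (Id C Z \<boxtimes> signed C Z NZ \<gamma>) \<bullet> (\<iota>Z \<alpha> \<boxtimes> \<iota>Z \<beta>))"
proof -
  interpret additive_symmetric_strict_monoidal_category C by (rule assms(1))
  interpret graded_frobenius_object C A Zc \<iota>A \<pi>A Z \<iota>Z \<pi>Z
    by unfold_locales (use assms in \<open>auto simp: sign_def\<close>)
  have comm: "Mul FZ \<bullet> Braid C Z Z \<bullet> (\<iota>Z \<alpha> \<boxtimes> \<iota>Z \<beta>)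
        = Mul FZ \<bullet> (signed C Z NZ \<gamma> \<boxtimes> Id C Z) \<bullet> (\<iota>Z \<alpha> \<boxtimes> \<iota>Z \<beta>) \<and>
      Mul FZ \<bullet> (signed C Z NZ \<gamma> \<boxtimes> Id C Z) \<bullet> (\<iota>Z \<alpha> \<boxtimes> \<iota>Z \<beta>)
        = Mul FZ \<bullet> (Id C Z \<boxtimes> signed C Z NZ \<gamma>) \<bullet> (\<iota>Z \<alpha> \<boxtimes> \<iota>Z \<beta>)"
    if "\<alpha> \<in> {1, -1}" "\<beta> \<in> {1, -1}" "\<gamma> = (if \<alpha> = -1 \<and> \<beta> = -1 then -1 else 1)" for \<alpha> \<beta> \<gamma>
    using Z_commutative[of \<alpha> \<beta> \<gamma>] that by (simp add: sign_def)
  show ?thesis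
    unfolding Let_def FZ_def[symmetric] NZ_def[symmetric]
    using Z_graded nakayama_FZ NZ_NZ NZ_i_1 comm by blast
qed

end
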